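(* Let $T$ be a periodic tiling of $\mathbb{R}^d$ ($d\geqslant2$) with point group $G$ and positive space group $\Gamma_+$. The fundamental group $\pi_1(\Omega_r)$ is uniquely determined as the pullback, under the quotient map $q\colon\widetilde G\to G$, of the standard extension $\mathbb{Z}^d\to\Gamma_+\to G$ of $\Gamma_+$ to the extension $\mathbb{Z}^d\to\pi_1(\Omega_r)\to\widetilde G$ (with $\mathbb{Z}^d\cong\pi_1(\Omega_t)$ and $\widetilde G\cong\pi_1(\mathrm{Spin}(d)/\widetilde G)$) realised by the fibration $\Omega_t\to\Omega_r\xrightarrow{\theta}\mathrm{Spin}(d)/\widetilde G$.
   Context: A tiling of $\mathbb{R}^d$ is a cover of $\mathbb{R}^d$ by compact $d$-dimensional polyhedral subsets (tiles), possibly labelled, meeting full face to full face and only on boundaries, each tile being a translate of one of a finite set of prototiles. $T$ is periodic if its translational symmetries form a full-rank lattice $\cong\mathbb{Z}^d$. The positive space group $\Gamma_+$ is the group of all orientation preserving isometries of $\mathbb{R}^d$ preserving $T$; its standard extension is $\mathbb{Z}^d\to\Gamma_+\to G$, with $\mathbb{Z}^d$ the translational symmetries and the finite point group $G\leq\mathrm{SO}(d)$ the group of rotational parts of elements of $\Gamma_+$. The translational (resp. rotational) hull $\Omega_t$ (resp. $\Omega_r$) of $T$ is the space of tilings all of whose finite patches appear in $T$ up to translation (resp. up to orientation preserving isometry), with the topology in which two tilings are close if they agree on a large ball about the origin after a small translation followed by a small rotation of either. For periodic $T$, $\Omega_t$ is a $d$-torus. $\Omega_r=\mathrm{SO}(d)\cdot\Omega_t$.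 $\mathrm{Spin}(d)$ denotes the universal cover of $\mathrm{SO}(d)$ (so, by convention here, $\mathrm{Spin}(2)\cong\mathbb{R}$); $\widetilde G\leq\mathrm{Spin}(d)$ is the preimage of $G$ and $q\colon\widetilde G\to G$ the projection. $\mathrm{Spin}(d)$ acts on tilings through $\mathrm{SO}(d)$. The orientation map $\theta\colon\Omega_r\to\mathrm{Spin}(d)/\widetilde G$ (left cosets) is $\theta(s(T'))=[s]$ for $T'\in\Omega_t$, $s\in\mathrm{Spin}(d)$; it is a fibre bundle with fibre $\Omega_t$. Base points are omitted. *)

theory Defs
  imports
    "HOL-Analysis.Analysis"
    "HOL-Algebra.Elementary_Groups"
    "HOL-Algebra.Left_Coset"
begin

section \<open>Tilings\<close>

text \<open>A compact, purely \<open>d\<close>-dimensional polyhedral set. It need be neither convex nor connected.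
  (The library predicate \<open>polyhedron\<close> only covers convex sets.)\<close>

definition polyhedral_body :: "'a::euclidean_space set \<Rightarrow> bool" where
  "polyhedral_body P \<longleftrightarrow>
     (\<exists>\<C>. finite \<C> \<and> \<C> \<noteq> {} \<and> (\<forall>C\<in>\<C>. polytope C \<and> aff_dim C = int DIM('a)) \<and> P = \<Union>\<C>)"

text \<open>Since tiles may be non-convex, the library's \<open>face_of\<close> does not apply. The open faces of a
  polyhedral set are the connected components of the strata on which the germ of the set is constant
  up to translation; faces are their closures. For a convex polytope these are exactly its nonempty
  faces, the polytope itself included.\<close>

definition same_germ :: "'a::real_normed_vector set \<Rightarrow> 'a \<Rightarrow> 'a \<Rightarrow> bool" where
  "same_germ P x y \<longleftrightarrow> (\<exists>r>0. \<forall>v. norm v < r \<longrightarrow> (x + v \<in> P \<longleftrightarrow> y + v \<in> P))"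

definition is_face :: "'a::real_normed_vector set \<Rightarrow> 'a set \<Rightarrow> bool" where
  "is_face F P \<longleftrightarrow>
     (\<exists>x\<in>P. F = closure (connected_component_set {y \<in> P. same_germ P x y} x))"

text \<open>A tile is a set together with a label; unlabelled tilings are the case \<open>'l = unit\<close>.\<close>

type_synonym ('n, 'l) tile = "(real ^ 'n) set \<times> 'l"
type_synonym ('n, 'l) tiling = "('n, 'l) tile set"

text \<open>Motions carry labels along unchanged.\<close>

definition act :: "(real ^ 'n \<Rightarrow> real ^ 'n) \<Rightarrow> ('n, 'l) tiling \<Rightarrow> ('n, 'l) tiling" where
  "act f T = map_prod (image f) id ` T"

definition tiling :: "('n::finite, 'l) tiling \<Rightarrow> bool" where
  "tiling T \<longleftrightarrow>
     (\<forall>t\<in>T. polyhedral_body (fst t)) \<and>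
     (\<Union>t\<in>T. fst t) = UNIV \<and>
     (\<forall>t\<in>T. \<forall>u\<in>T. t \<noteq> u \<longrightarrow>
        fst t \<inter> fst u \<subseteq> frontier (fst t) \<inter> frontier (fst u) \<and>
        (\<exists>\<F>. (\<forall>F\<in>\<F>. is_face F (fst t) \<and> is_face F (fst u)) \<and> fst t \<inter> fst u = \<Union>\<F>)) \<and>
     (\<exists>\<P>. finite \<P> \<and> (\<forall>t\<in>T. \<exists>u\<in>\<P>. \<exists>x. t = map_prod (image ((+) x)) id u))"


section \<open>Symmetries\<close>

definition linear_part :: "(real ^ 'n \<Rightarrow> real ^ 'n) \<Rightarrow> real ^ 'n ^ 'n" where
  "linear_part f = matrix (\<lambda>v. f v - f 0)"

definition orientation_preserving_isometry :: "(real ^ 'n::finite \<Rightarrow> real ^ 'n) \<Rightarrow> bool" where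
  "orientation_preserving_isometry f \<longleftrightarrow>
     (\<forall>x y. dist (f x) (f y) = dist x y) \<and> det (linear_part f) = 1"

definition translation_group :: "('n::finite, 'l) tiling \<Rightarrow> (real ^ 'n) monoid" where
  "translation_group T = \<lparr>carrier = {x. act ((+) x) T = T}, mult = (+), one = 0\<rparr>"

definition periodic :: "('n::finite, 'l) tiling \<Rightarrow> bool" where
  "periodic T \<longleftrightarrow>
     (\<exists>b :: 'n \<Rightarrow> real ^ 'n. inj b \<and> independent (range b) \<and>
        carrier (translation_group T) = {(\<Sum>i\<in>UNIV. of_int (k i) *\<^sub>R b i) | k :: 'n \<Rightarrow> int. True})"

definition positive_space_group ::
  "('n::finite, 'l) tiling \<Rightarrow> (real ^ 'n \<Rightarrow> real ^ 'n) monoid" where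
  "positive_space_group T =
     \<lparr>carrier = {f. orientation_preserving_isometry f \<and> act f T = T}, mult = (\<circ>), one = id\<rparr>"

definition special_orthogonal_group :: "(real ^ 'n::finite ^ 'n) monoid" where
  "special_orthogonal_group = \<lparr>carrier = {A. rotation_matrix A}, mult = (**), one = mat 1\<rparr>"

definition point_group :: "('n::finite, 'l) tiling \<Rightarrow> (real ^ 'n ^ 'n) monoid" where
  "point_group T =
     special_orthogonal_group\<lparr>carrier := linear_part ` carrier (positive_space_group T)\<rparr>"


section \<open>Hulls\<close>

definition translational_hull :: "('n::finite, 'l) tiling \<Rightarrow> ('n, 'l) tiling set" where
  "translational_hull T =
     {T'. tiling T' \<and> (\<forall>P. finite P \<and> P \<subseteq> T' \<longrightarrow> (\<exists>x. act ((+) x) P \<subseteq> T))}"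

definition rotational_hull :: "('n::finite, 'l) tiling \<Rightarrow> ('n, 'l) tiling set" where
  "rotational_hull T =
     {T'. tiling T' \<and>
       (\<forall>P. finite P \<and> P \<subseteq> T' \<longrightarrow> (\<exists>f. orientation_preserving_isometry f \<and> act f P \<subseteq> T))}"

definition agree_on :: "(real ^ 'n) set \<Rightarrow> ('n, 'l) tiling \<Rightarrow> ('n, 'l) tiling \<Rightarrow> bool" where
  "agree_on S T T' \<longleftrightarrow> {t \<in> T. fst t \<inter> S \<noteq> {}} = {t \<in> T'. fst t \<inter> S \<noteq> {}}"

definition close :: "real \<Rightarrow> ('n::finite, 'l) tiling \<Rightarrow> ('n, 'l) tiling \<Rightarrow> bool" where
  "close \<epsilon> T T' \<longleftrightarrow>
     (\<exists>x A. norm x < \<epsilon> \<and> rotation_matrix A \<and> norm (A - mat 1) < \<epsilon> \<and>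
        (agree_on (ball 0 (1 / \<epsilon>)) (act (\<lambda>v. A *v (x + v)) T) T' \<or>
         agree_on (ball 0 (1 / \<epsilon>)) T (act (\<lambda>v. A *v (x + v)) T')))"

lemma close_mono:
  assumes "close \<delta> T T'" "0 < \<delta>" "\<delta> \<le> \<epsilon>"
  shows "close \<epsilon> T T'"
proof -
  have sub: "ball (0 :: real ^ 'a) (1 / \<epsilon>) \<subseteq> ball 0 (1 / \<delta>)"
    using assms by (intro subset_ball) (simp add: frac_le)
  have "agree_on (ball 0 (1 / \<epsilon>)) U V" if "agree_on (ball 0 (1 / \<delta>)) U V"
    for U V :: "('a, 'b) tiling"
    using that sub unfolding agree_on_def by blast
  moreover obtain x A where "norm x < \<delta>" "rotation_matrix A" "norm (A - mat 1) < \<delta>"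
    "agree_on (ball 0 (1 / \<delta>)) (act (\<lambda>v. A *v (x + v)) T) T' \<or>
     agree_on (ball 0 (1 / \<delta>)) T (act (\<lambda>v. A *v (x + v)) T')"
    using assms(1) unfolding close_def by blast
  ultimately show ?thesis
    unfolding close_def using assms(3)
    by (intro exI[of _ x] exI[of _ A]) auto
qed

lemma istopologyI:
  assumes "\<And>S U. L S \<Longrightarrow> L U \<Longrightarrow> L (S \<inter> U)"
    and "\<And>\<K>. \<forall>S\<in>\<K>. L S \<Longrightarrow> L (\<Union>\<K>)"
  shows "istopology L"
  using assms by (simp add: istopology_def)

definition hull_topology :: "('n::finite, 'l) tiling set \<Rightarrow> ('n, 'l) tiling topology" where
  "hull_topology \<Omega> =
     topology (\<lambda>U. U \<subseteq> \<Omega> \<and> (\<forall>T\<in>U. \<exists>\<epsilon>>0. \<forall>T'\<in>\<Omega>. close \<epsilon> T T' \<longrightarrow> T' \<in> U))"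

lemma openin_hull_topology:
  "openin (hull_topology \<Omega>) U \<longleftrightarrow>
     U \<subseteq> \<Omega> \<and> (\<forall>T\<in>U. \<exists>\<epsilon>>0. \<forall>T'\<in>\<Omega>. close \<epsilon> T T' \<longrightarrow> T' \<in> U)"
proof -
  let ?L = "\<lambda>U. U \<subseteq> \<Omega> \<and> (\<forall>T\<in>U. \<exists>\<epsilon>>0. \<forall>T'\<in>\<Omega>. close \<epsilon> T T' \<longrightarrow> T' \<in> U)"
  have "?L (S \<inter> U)" if S: "?L S" and U: "?L U" for S U
  proof (intro conjI ballI)
    show "S \<inter> U \<subseteq> \<Omega>" using S by blast
    fix T assume T: "T \<in> S \<inter> U"
    obtain \<delta> where \<delta>: "\<delta> > 0" "\<forall>T'\<in>\<Omega>. close \<delta> T T' \<longrightarrow> T' \<in> S" using S T by blast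
    obtain \<eta> where \<eta>: "\<eta> > 0" "\<forall>T'\<in>\<Omega>. close \<eta> T T' \<longrightarrow> T' \<in> U" using U T by blast
    have pos: "0 < min \<delta> \<eta>" using \<delta> \<eta> by simp
    show "\<exists>\<epsilon>>0. \<forall>T'\<in>\<Omega>. close \<epsilon> T T' \<longrightarrow> T' \<in> S \<inter> U"
    proof (intro exI[of _ "min \<delta> \<eta>"] conjI ballI impI pos)
      fix T' assume T': "T' \<in> \<Omega>" "close (min \<delta> \<eta>) T T'"
      have "close \<delta> T T'" "close \<eta> T T'"
        by (rule close_mono[OF T'(2) pos], simp)+
      with T'(1) \<delta>(2) \<eta>(2) show "T' \<in> S \<inter> U" by blast
    qed
  qed
  moreover have "?L (\<Union>\<K>)" if "\<forall>S\<in>\<K>. ?L S" for \<K>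
  proof (intro conjI ballI)
    show "\<Union>\<K> \<subseteq> \<Omega>" using that by blast
    fix T assume "T \<in> \<Union>\<K>"
    then obtain S where S: "S \<in> \<K>" "T \<in> S" by blast
    with that obtain \<epsilon> where "\<epsilon> > 0" "\<forall>T'\<in>\<Omega>. close \<epsilon> T T' \<longrightarrow> T' \<in> S" by blast
    with S(1) show "\<exists>\<epsilon>>0. \<forall>T'\<in>\<Omega>. close \<epsilon> T T' \<longrightarrow> T' \<in> \<Union>\<K>" by blast
  qed
  ultimately have "istopology ?L"
    by (rule istopologyI)
  then show ?thesis
    unfolding hull_topology_def by (simp add: topology_inverse')
qed


section \<open>The fundamental group of a topology\<close>

definition loop_at :: "'a topology \<Rightarrow> 'a \<Rightarrow> (real \<Rightarrow> 'a) \<Rightarrow> bool" where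
  "loop_at X x p \<longleftrightarrow> pathin X p \<and> p 0 = x \<and> p 1 = x"

definition loop_class :: "'a topology \<Rightarrow> 'a \<Rightarrow> (real \<Rightarrow> 'a) \<Rightarrow> (real \<Rightarrow> 'a) set" where
  "loop_class X x p =
     {q. homotopic_with (\<lambda>r. r 0 = x \<and> r 1 = x) (top_of_set {0..1}) X p q}"

text \<open>As for the library's \<open>joinpaths\<close> (which is tied to a type class), \<open>p\<close> is traversed first.\<close>

definition concat_paths :: "(real \<Rightarrow> 'a) \<Rightarrow> (real \<Rightarrow> 'a) \<Rightarrow> real \<Rightarrow> 'a" where
  "concat_paths p q = (\<lambda>t. if t \<le> 1 / 2 then p (2 * t) else q (2 * t - 1))"

definition fundamental_group :: "'a topology \<Rightarrow> 'a \<Rightarrow> (real \<Rightarrow> 'a) set monoid" where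
  "fundamental_group X x =
     \<lparr>carrier = {loop_class X x p | p. loop_at X x p},
      mult = (\<lambda>C D. \<Union>p\<in>C. \<Union>q\<in>D. loop_class X x (concat_paths p q)),
      one = loop_class X x (\<lambda>_. x)\<rparr>"

definition induced_hom ::
  "'b topology \<Rightarrow> 'a \<Rightarrow> ('a \<Rightarrow> 'b) \<Rightarrow> (real \<Rightarrow> 'a) set \<Rightarrow> (real \<Rightarrow> 'b) set" where
  "induced_hom Y x f C = (\<Union>p\<in>C. loop_class Y (f x) (f \<circ> p))"


section \<open>The spin group and the orientation map\<close>

text \<open>\<open>S\<close>, with covering homomorphism \<open>\<pi>\<close>, is the universal cover of the topological group \<open>H\<close>;
  this determines \<open>S\<close> and \<open>\<pi>\<close> up to isomorphism. (Simple connectedness includes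
  path-connectedness.)\<close>

definition universal_covering_group ::
  "('s::topological_space) monoid \<Rightarrow> ('s \<Rightarrow> 'h) \<Rightarrow> ('h::topological_space) monoid \<Rightarrow> bool" where
  "universal_covering_group S \<pi> H \<longleftrightarrow>
     group S \<and>
     continuous_on (carrier S \<times> carrier S) (\<lambda>(x, y). x \<otimes>\<^bsub>S\<^esub> y) \<and>
     continuous_on (carrier S) (\<lambda>x. inv\<^bsub>S\<^esub> x) \<and>
     \<pi> \<in> hom S H \<and>
     covering_space (carrier S) \<pi> (carrier H) \<and>
     simply_connected (carrier S)"

text \<open>The group \<open>G\<close>-tilde; \<open>\<pi>\<close> restricts on it to the quotient map \<open>q\<close>.\<close>

definition lifted_point_group ::
  "'s monoid \<Rightarrow> ('s \<Rightarrow> real ^ 'n ^ 'n) \<Rightarrow> ('n::finite, 'l) tiling \<Rightarrow> 's monoid" where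
  "lifted_point_group S \<pi> T = S\<lparr>carrier := {s \<in> carrier S. \<pi> s \<in> carrier (point_group T)}\<rparr>"

definition coset_topology :: "('s::topological_space) monoid \<Rightarrow> 's set \<Rightarrow> 's set topology" where
  "coset_topology S H =
     topology (\<lambda>U. U \<subseteq> lcosets\<^bsub>S\<^esub> H \<and>
       openin (top_of_set (carrier S)) {s \<in> carrier S. s <#\<^bsub>S\<^esub> H \<in> U})"

lemma openin_coset_topology:
  "openin (coset_topology S H) U \<longleftrightarrow>
     U \<subseteq> lcosets\<^bsub>S\<^esub> H \<and> openin (top_of_set (carrier S)) {s \<in> carrier S. s <#\<^bsub>S\<^esub> H \<in> U}"
proof -
  let ?L = "\<lambda>U. U \<subseteq> lcosets\<^bsub>S\<^esub> H \<and>
    openin (top_of_set (carrier S)) {s \<in> carrier S. s <#\<^bsub>S\<^esub> H \<in> U}"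
  have "?L (V \<inter> W)" if "?L V" "?L W" for V W
  proof -
    have eq: "{s \<in> carrier S. s <#\<^bsub>S\<^esub> H \<in> V \<inter> W} =
        {s \<in> carrier S. s <#\<^bsub>S\<^esub> H \<in> V} \<inter> {s \<in> carrier S. s <#\<^bsub>S\<^esub> H \<in> W}"
      by blast
    show ?thesis
      unfolding eq using that by blast
  qed
  moreover have "?L (\<Union>\<K>)" if "\<forall>V\<in>\<K>. ?L V" for \<K>
  proof -
    have eq: "{s \<in> carrier S. s <#\<^bsub>S\<^esub> H \<in> \<Union>\<K>} =
        (\<Union>V\<in>\<K>. {s \<in> carrier S. s <#\<^bsub>S\<^esub> H \<in> V})"
      by blast
    show ?thesis
      unfolding eq using that by blast
  qed
  ultimately have "istopology ?L"
    by (rule istopologyI)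
  then show ?thesis
    unfolding coset_topology_def by (simp add: topology_inverse')
qed

definition orientation_map ::
  "'s monoid \<Rightarrow> ('s \<Rightarrow> real ^ 'n ^ 'n) \<Rightarrow> ('n::finite, 'l) tiling \<Rightarrow> ('n, 'l) tiling \<Rightarrow> 's set" where
  "orientation_map S \<pi> T T'' =
     (THE C. \<exists>s\<in>carrier S. \<exists>T'\<in>translational_hull T.
        T'' = act ((*v) (\<pi> s)) T' \<and> C = s <#\<^bsub>S\<^esub> carrier (lifted_point_group S \<pi> T))"


section \<open>Group extensions\<close>

definition group_extension ::
  "('a, 'c) monoid_scheme \<Rightarrow> ('a \<Rightarrow> 'e) \<Rightarrow> ('e, 'd) monoid_scheme \<Rightarrow> ('e \<Rightarrow> 'q) \<Rightarrow>
   ('q, 'f) monoid_scheme \<Rightarrow> bool" where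
  "group_extension A \<iota> E \<rho> Q \<longleftrightarrow>
     group A \<and> group E \<and> group Q \<and> \<iota> \<in> mon A E \<and> \<rho> \<in> epi E Q \<and>
     \<iota> ` carrier A = kernel E Q \<rho>"

definition fibre_product :: "'e monoid \<Rightarrow> ('e \<Rightarrow> 'q) \<Rightarrow> 'r monoid \<Rightarrow> ('r \<Rightarrow> 'q) \<Rightarrow> ('e \<times> 'r) monoid" where
  "fibre_product E \<rho> R \<sigma> =
     (E \<times>\<times> R)\<lparr>carrier := {(e, r). e \<in> carrier E \<and> r \<in> carrier R \<and> \<rho> e = \<sigma> r}\<rparr>"

definition extension_iso ::
  "'a monoid \<Rightarrow> ('a \<Rightarrow> 'e) \<Rightarrow> 'e monoid \<Rightarrow> ('e \<Rightarrow> 'q) \<Rightarrow> 'q monoid \<Rightarrow>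
   'a' monoid \<Rightarrow> ('a' \<Rightarrow> 'e') \<Rightarrow> 'e' monoid \<Rightarrow> ('e' \<Rightarrow> 'q') \<Rightarrow> 'q' monoid \<Rightarrow>
   ('a \<Rightarrow> 'a') \<Rightarrow> ('e \<Rightarrow> 'e') \<Rightarrow> ('q \<Rightarrow> 'q') \<Rightarrow> bool" where
  "extension_iso A \<iota> E \<rho> Q A' \<iota>' E' \<rho>' Q' \<alpha> \<kappa> \<beta> \<longleftrightarrow>
     \<alpha> \<in> iso A A' \<and> \<kappa> \<in> iso E E' \<and> \<beta> \<in> iso Q Q' \<and>
     (\<forall>a\<in>carrier A. \<kappa> (\<iota> a) = \<iota>' (\<alpha> a)) \<and>
     (\<forall>e\<in>carrier E. \<rho>' (\<kappa> e) = \<beta> (\<rho> e))"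


section \<open>Canonical identifications of the outer groups\<close>

text \<open>Both identifications send a group element to the class of the image of a path running \<^emph>\<open>from\<close>
  that element \<^emph>\<open>to\<close> the identity. With loops concatenated in order of traversal and left cosets,
  the opposite direction would give an anti-homomorphism on the lifted point group.\<close>

definition translation_loop_class ::
  "('n::finite, 'l) tiling \<Rightarrow> real ^ 'n \<Rightarrow> (real \<Rightarrow> ('n, 'l) tiling) set" where
  "translation_loop_class T x =
     loop_class (hull_topology (translational_hull T)) T (\<lambda>t. act ((+) ((1 - t) *\<^sub>R x)) T)"

definition coset_loop_class ::
  "('s::topological_space) monoid \<Rightarrow> 's set \<Rightarrow> 's \<Rightarrow> (real \<Rightarrow> 's set) set" where
  "coset_loop_class S H g =
     (THE C. \<exists>\<gamma>. path \<gamma> \<and> path_image \<gamma> \<subseteq> carrier S \<and> pathstart \<gamma> = g \<and> pathfinish \<gamma> = \<one>\<^bsub>S\<^esub> \<and>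
        C = loop_class (coset_topology S H) (\<one>\<^bsub>S\<^esub> <#\<^bsub>S\<^esub> H) (\<lambda>t. \<gamma> t <#\<^bsub>S\<^esub> H))"

end

theory Submission
  imports Defs
begin

text \<open>
  The three spaces are quotients of simply connected topological groups by discrete subgroups:
  \<open>\<Omega>\<^sub>t\<close> of \<open>\<real>\<^sup>d\<close> by the periods of \<open>T\<close>, \<open>\<Omega>\<^sub>r\<close> of the semidirect product of \<open>Spin(d)\<close> and
  \<open>\<real>\<^sup>d\<close> by the elements acting on \<open>T\<close> trivially, and the base of \<open>Spin(d)\<close> by the lifted point group.
  The stabiliser in the middle is exactly the pullback of \<open>\<Gamma>\<^sub>+\<close>.
  For a simply connected group \<open>S\<close> with discrete subgroup \<open>H\<close>, sending \<open>h\<close> to the class of the image of a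
  path from \<open>h\<close> to the identity is an isomorphism from \<open>H\<close> to the fundamental group of \<open>S/H\<close>, natural
  with respect to homomorphisms. Applied to the two homomorphisms \<open>v \<mapsto> (1, v)\<close> and \<open>(s, v) \<mapsto> s\<close>, this
  carries the pullback extension to the one realised by the fibration.

  That the hulls carry the quotient topology is a compactness argument: if \<open>h\<^sub>k T\<close> agrees with \<open>T'\<close>, up to
  motions tending to the identity, on balls of growing radius, then \<open>h\<^sub>k\<close> can be corrected by periods so
  as to subconverge to some \<open>h\<close>, and \<open>h T = T'\<close> since a convergent sequence of copies of one tile
  inside a tiling is eventually constant.
\<close>

section \<open>Quotients of simply connected groups by discrete subgroups\<close>

text \<open>About \<open>Spin\<close> only this is available: it is a simply connected topological
  group covering the rotations, on a type that carries just a topology. Sequences and balls are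
  therefore used one level down, on pairs of a rotation matrix and a vector; openness of the
  covering map then lifts the outcome to the group above. Exactness of the sequence of fundamental
  groups is not drawn from the homotopy sequence of a fibration. The pullback is exact by algebra,
  sending an element to the class of its lifts gives three isomorphisms forming two commuting
  squares, and exactness is carried across. The middle isomorphism is also the witness
  \<open>\<kappa>\<close>. Hulls and coset spaces are topologies on sets, so covering theory is set
  up for a map \<open>q\<close> onto an arbitrary \<open>Y\<close> with the quotient topology.
  Discreteness has two sources: a compact tile is invariant under no nonzero translation, which
  excludes short periods, and the rotational part of a symmetry, if close to the identity, must fix
  a lattice basis.\<close>

lemma prod_topology_top_of_set:
  "prod_topology (top_of_set A) (top_of_set B) = top_of_set (A \<times> B)"
  by (simp add: prod_topology_subtopology subtopology_subtopology euclidean_product_topology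
      Times_Int_Times flip: subtopology_Times)

text \<open>Free homotopies of the two coordinate loops, run simultaneously, form a homotopy of the
  pair. The product in question is that of \<open>Spin\<close> with the vector space.\<close>

lemma simply_connected_prod:
  assumes A: "simply_connected A" and B: "simply_connected B"
  shows "simply_connected (A \<times> B)"
  unfolding simply_connected_def
proof (intro allI impI, elim conjE)
  fix p q :: "real \<Rightarrow> 'a \<times> 'b"
  assume p: "path p" "pathfinish p = pathstart p" "path_image p \<subseteq> A \<times> B"
    and q: "path q" "pathfinish q = pathstart q" "path_image q \<subseteq> A \<times> B"
  have path: "path (fst \<circ> r)" "path (snd \<circ> r)" if "path r" for r :: "real \<Rightarrow> 'a \<times> 'b"
    using that by (auto simp: path_def intro!: continuous_on_compose continuous_intros)
  have "homotopic_loops A (fst \<circ> p) (fst \<circ> q)"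
    using A p q path unfolding simply_connected_def
    by (auto simp: path_image_def pathstart_def pathfinish_def image_subset_iff mem_Times_iff)
  moreover have "homotopic_loops B (snd \<circ> p) (snd \<circ> q)"
    using B p q path unfolding simply_connected_def
    by (auto simp: path_image_def pathstart_def pathfinish_def image_subset_iff mem_Times_iff)
  ultimately show "homotopic_loops (A \<times> B) p q"
    unfolding homotopic_loops
    apply clarify
    subgoal for h k
      by (rule_tac x="\<lambda>z. (h z, k z)" in exI) (auto intro: continuous_intros simp: path_defs)
    done
qed

text \<open>The library's \<open>covering_space_open_map\<close> is restricted to metric spaces.\<close>

lemma covering_space_open_map':
  fixes p :: "'a::topological_space \<Rightarrow> 'b::topological_space"
  assumes p: "covering_space C p S" and U: "openin (top_of_set C) U"
  shows "openin (top_of_set S) (p ` U)"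
proof (subst openin_subopen, intro ballI)
  fix y assume "y \<in> p ` U"
  then obtain x where x: "x \<in> U" "y = p x" by blast
  then have "x \<in> C" using U openin_imp_subset by blast
  then obtain V W q where V: "x \<in> V" "openin (top_of_set C) V"
    and W: "p x \<in> W" "openin (top_of_set S) W" and h: "homeomorphism V W p q"
    using covering_space_local_homeomorphism[OF p] by metis
  have "openin (top_of_set V) (U \<inter> V)"
    by (rule openin_subset_trans[OF openin_Int[OF U V(2)]]) (use openin_imp_subset[OF V(2)] in auto)
  from openin_trans[OF homeomorphism_imp_open_map[OF h this] W(2)]
  have "openin (top_of_set S) (p ` (U \<inter> V))" .
  then show "\<exists>T. openin (top_of_set S) T \<and> y \<in> T \<and> T \<subseteq> p ` U"
    using x V(1) by blast
qed

lemma (in group) cancel_inv_left [simp]: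
  assumes "a \<in> carrier G" "x \<in> carrier G"
  shows "inv a \<otimes> (a \<otimes> x) = x" "a \<otimes> (inv a \<otimes> x) = x"
  using assms by (simp_all flip: m_assoc)

text \<open>The explicit form of the homotopy class attached to \<open>h\<close>. Values outside the
  unit interval are left free, in line with homotopies over \<open>top_of_set {0..1}\<close>, so
  that it can coincide with a \<open>loop_class\<close> as a set of functions on all reals.\<close>

definition lift_class :: "('s::topological_space) monoid \<Rightarrow> ('s \<Rightarrow> 'y) \<Rightarrow> 's \<Rightarrow> (real \<Rightarrow> 'y) set" where
  "lift_class S q h =
     {p. \<exists>\<gamma>. continuous_on {0..1} \<gamma> \<and> \<gamma> ` {0..1} \<subseteq> carrier S \<and> \<gamma> 0 = h \<and> \<gamma> 1 = \<one>\<^bsub>S\<^esub> \<and>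
        (\<forall>t\<in>{0..1}. q (\<gamma> t) = p t)}"

text \<open>The quotient is given by a map \<open>q\<close> whose fibres are the left cosets of
  \<open>H\<close>, not by the cosets themselves, so that orbit maps into a hull fit as well.
  Isolating the identity expresses discreteness, since translations carry the isolating
  neighbourhood to every other element of \<open>H\<close>.\<close>

locale discrete_quotient = group S
  for S :: "('s::topological_space) monoid" (structure) +
  fixes H :: "'s set" and q :: "'s \<Rightarrow> 'y" and Y :: "'y topology"
  assumes continuous_mult: "continuous_on (carrier S \<times> carrier S) (\<lambda>(x, y). x \<otimes> y)"
    and continuous_inv: "continuous_on (carrier S) (\<lambda>x. inv x)"
    and simply_connected_carrier: "simply_connected (carrier S)"
    and subgroup_H: "subgroup H S"
    and discrete_H: "\<exists>O'. openin (top_of_set (carrier S)) O' \<and> O' \<inter> H = {\<one>}"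
    and openin_iff: "\<And>U. openin Y U \<longleftrightarrow>
       U \<subseteq> q ` carrier S \<and> openin (top_of_set (carrier S)) {x \<in> carrier S. q x \<in> U}"
    and q_eq_iff: "\<And>x y. x \<in> carrier S \<Longrightarrow> y \<in> carrier S \<Longrightarrow> q x = q y \<longleftrightarrow> inv x \<otimes> y \<in> H"
begin

section \<open>Topology of the quotient map\<close>

lemma continuous_on_mult [continuous_intros]:
  assumes "continuous_on K f" "continuous_on K g" "f ` K \<subseteq> carrier S" "g ` K \<subseteq> carrier S"
  shows "continuous_on K (\<lambda>k. f k \<otimes> g k)"
  using continuous_on_compose2[OF continuous_mult, of K "\<lambda>k. (f k, g k)"] assms
  by (auto intro!: continuous_intros)

lemma continuous_on_minv [continuous_intros]:
  assumes "continuous_on K f" "f ` K \<subseteq> carrier S"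
  shows "continuous_on K (\<lambda>k. inv (f k))"
  using continuous_on_compose2[OF continuous_inv, of K f] assms by auto

lemma H_carrier: "h \<in> H \<Longrightarrow> h \<in> carrier S"
  by (rule subgroup.mem_carrier[OF subgroup_H])

lemma q_mult_H: "x \<in> carrier S \<Longrightarrow> h \<in> H \<Longrightarrow> q (x \<otimes> h) = q x"
  using q_eq_iff[of x "x \<otimes> h"] by (simp add: H_carrier)

lemma topspace_Y: "topspace Y = q ` carrier S"
proof -
  have "{x \<in> carrier S. q x \<in> q ` carrier S} = carrier S" by auto
  then have "openin Y (q ` carrier S)"
    by (simp add: openin_iff)
  then have "q ` carrier S \<subseteq> topspace Y"
    by (rule openin_subset)
  moreover have "topspace Y \<subseteq> q ` carrier S"
    using openin_topspace[of Y] unfolding openin_iff by blast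
  ultimately show ?thesis by blast
qed

lemma continuous_q: "continuous_map (top_of_set (carrier S)) Y q"
  unfolding continuous_map using openin_iff topspace_Y by auto

lemma continuous_map_q_comp:
  assumes "continuous_on K f" "f ` K \<subseteq> carrier S"
  shows "continuous_map (top_of_set K) Y (\<lambda>k. q (f k))"
proof -
  have "continuous_map (top_of_set K) (top_of_set (carrier S)) f"
    using assms by auto
  from continuous_map_compose[OF this continuous_q] show ?thesis by (simp add: o_def)
qed

text \<open>The image is the preimage under the inverse translation, which is continuous. The
  two-sided form serves both left translates, around a given point, and right translates by
  \<open>H\<close>.\<close>

lemma openin_translate:
  assumes U: "openin (top_of_set (carrier S)) U" and a: "a \<in> carrier S" and b: "b \<in> carrier S"
  shows "openin (top_of_set (carrier S)) ((\<lambda>x. a \<otimes> x \<otimes> b) ` U)"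
proof -
  have sub: "U \<subseteq> carrier S" using U openin_imp_subset by blast
  have eq: "(\<lambda>x. a \<otimes> x \<otimes> b) ` U = carrier S \<inter> (\<lambda>x. inv a \<otimes> x \<otimes> inv b) -` U"
  proof (intro equalityI subsetI)
    fix y assume "y \<in> (\<lambda>x. a \<otimes> x \<otimes> b) ` U"
    then obtain x where "x \<in> U" "y = a \<otimes> x \<otimes> b" by blast
    moreover have "x \<in> carrier S" using sub \<open>x \<in> U\<close> by blast
    moreover have "inv a \<otimes> (a \<otimes> x \<otimes> b) \<otimes> inv b = x"
      using a b \<open>x \<in> carrier S\<close> by (simp add: m_assoc)
    ultimately show "y \<in> carrier S \<inter> (\<lambda>x. inv a \<otimes> x \<otimes> inv b) -` U"
      using a b sub by auto
  next
    fix y assume y: "y \<in> carrier S \<inter> (\<lambda>x. inv a \<otimes> x \<otimes> inv b) -` U"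
    then have "a \<otimes> (inv a \<otimes> y \<otimes> inv b) \<otimes> b = y"
      using a b by (simp add: m_assoc)
    with y show "y \<in> (\<lambda>x. a \<otimes> x \<otimes> b) ` U" by force
  qed
  have "continuous_on (carrier S) (\<lambda>x. inv a \<otimes> x \<otimes> inv b)"
    using a b by (intro continuous_intros) auto
  then show ?thesis
    unfolding eq by (rule continuous_openin_preimage) (use a b U in auto)
qed

text \<open>The saturation of \<open>U\<close> is the union of its right translates by elements of
  \<open>H\<close>, each of them open.\<close>

lemma open_map_q:
  assumes U: "openin (top_of_set (carrier S)) U"
  shows "openin Y (q ` U)"
proof -
  have sub: "U \<subseteq> carrier S" using U openin_imp_subset by blast
  have "{x \<in> carrier S. q x \<in> q ` U} = (\<Union>h\<in>H. (\<lambda>x. \<one> \<otimes> x \<otimes> h) ` U)"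
  proof (intro equalityI subsetI)
    fix x assume "x \<in> {x \<in> carrier S. q x \<in> q ` U}"
    then obtain u where u: "u \<in> U" "x \<in> carrier S" "q u = q x" by auto
    then have "inv u \<otimes> x \<in> H" using sub q_eq_iff by blast
    moreover have "\<one> \<otimes> u \<otimes> (inv u \<otimes> x) = x"
      using u sub by (auto simp: m_assoc)
    ultimately show "x \<in> (\<Union>h\<in>H. (\<lambda>x. \<one> \<otimes> x \<otimes> h) ` U)" using u by force
  next
    fix x assume "x \<in> (\<Union>h\<in>H. (\<lambda>x. \<one> \<otimes> x \<otimes> h) ` U)"
    then obtain h u where "h \<in> H" "u \<in> U" "x = u \<otimes> h" using sub by auto
    then show "x \<in> {x \<in> carrier S. q x \<in> q ` U}"
      using q_mult_H sub H_carrier by auto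
  qed
  moreover have "openin (top_of_set (carrier S)) (\<Union>h\<in>H. (\<lambda>x. \<one> \<otimes> x \<otimes> h) ` U)"
    using openin_translate[OF U] H_carrier by blast
  ultimately show ?thesis
    using openin_iff sub by auto
qed

text \<open>The map sending \<open>(n, m)\<close> to \<open>inv n \<otimes> m\<close> is continuous
  at the pair of identities, so a small box around that pair lands in the neighbourhood that meets
  \<open>H\<close> in the identity only.\<close>

lemma injective_nbhd:
  "\<exists>N. openin (top_of_set (carrier S)) N \<and> \<one> \<in> N \<and> (\<forall>n\<in>N. \<forall>m\<in>N. inv n \<otimes> m \<in> H \<longrightarrow> n = m)"
proof -
  obtain O' where O': "openin (top_of_set (carrier S)) O'" "O' \<inter> H = {\<one>}"
    using discrete_H by blast
  let ?f = "\<lambda>z. inv (fst z) \<otimes> snd z"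
  have "continuous_on (carrier S \<times> carrier S) ?f"
    by (intro continuous_intros) auto
  then have "openin (top_of_set (carrier S \<times> carrier S)) ((carrier S \<times> carrier S) \<inter> ?f -` O')"
    by (rule continuous_openin_preimage) (use O' in auto)
  then have *: "openin (prod_topology (top_of_set (carrier S)) (top_of_set (carrier S)))
      ((carrier S \<times> carrier S) \<inter> ?f -` O')"
    by (simp add: prod_topology_top_of_set)
  have "(\<one>, \<one>) \<in> (carrier S \<times> carrier S) \<inter> ?f -` O'"
    using O' by auto
  from openin_prod_topology_alt[THEN iffD1, rule_format, OF * this]
  obtain A B where AB: "openin (top_of_set (carrier S)) A" "openin (top_of_set (carrier S)) B"
    "\<one> \<in> A" "\<one> \<in> B" "A \<times> B \<subseteq> (carrier S \<times> carrier S) \<inter> ?f -` O'"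
    by (elim exE conjE)
  have "n = m" if n: "n \<in> A \<inter> B" and m: "m \<in> A \<inter> B" and H: "inv n \<otimes> m \<in> H" for n m
  proof -
    have "(n, m) \<in> (carrier S \<times> carrier S) \<inter> ?f -` O'" using AB n m by blast
    then have "n \<in> carrier S" "m \<in> carrier S" "inv n \<otimes> m \<in> O'" by auto
    moreover from this have "inv n \<otimes> m = \<one>" using H O'(2) by blast
    ultimately show "n = m"
      by (metis inv_closed inv_equality inv_inv)
  qed
  then show ?thesis
    using AB by (intro exI[of _ "A \<inter> B"]) blast
qed

text \<open>On the translate of an injectivity neighbourhood to \<open>x\<close> the map
  \<open>q\<close> is injective, continuous and open, so its inverse there is the section.\<close>

lemma local_section:
  assumes x: "x \<in> carrier S"
  shows "\<exists>V \<sigma>. openin Y V \<and> q x \<in> V \<and> continuous_map (subtopology Y V) (top_of_set (carrier S)) \<sigma> \<and>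
    (\<forall>y\<in>V. q (\<sigma> y) = y)"
proof -
  obtain N where N: "openin (top_of_set (carrier S)) N" "\<one> \<in> N"
    and N_inj: "\<And>n m. n \<in> N \<Longrightarrow> m \<in> N \<Longrightarrow> inv n \<otimes> m \<in> H \<Longrightarrow> n = m"
    using injective_nbhd by blast
  \<comment> \<open>The trailing unit only brings the left translate into the two-sided shape of
    \<open>openin_translate\<close>.\<close>
  define W where "W = (\<lambda>n. x \<otimes> n \<otimes> \<one>) ` N"
  have W: "openin (top_of_set (carrier S)) W"
    unfolding W_def using openin_translate[OF N(1) x] by simp
  have WS: "W \<subseteq> carrier S" using W openin_imp_subset by blast
  have NS: "N \<subseteq> carrier S" using N(1) openin_imp_subset by blast
  have inW: "\<exists>n\<in>N. a = x \<otimes> n" if "a \<in> W" for a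
  proof -
    from that obtain n where "n \<in> N" "a = x \<otimes> n \<otimes> \<one>" unfolding W_def by blast
    moreover from this have "a = x \<otimes> n" using NS x by (metis m_closed r_one subsetD)
    ultimately show ?thesis by blast
  qed
  have inj: "inj_on q W"
  proof (rule inj_onI)
    fix a b assume "a \<in> W" "b \<in> W" and eq: "q a = q b"
    then obtain n m where n: "n \<in> N" "a = x \<otimes> n" and m: "m \<in> N" "b = x \<otimes> m"
      using inW by blast
    have "inv a \<otimes> b \<in> H" using eq q_eq_iff \<open>a \<in> W\<close> \<open>b \<in> W\<close> WS by blast
    moreover have "inv a \<otimes> b = inv n \<otimes> m"
      using n m NS x by (auto simp: m_assoc inv_mult_group subset_iff)
    ultimately show "a = b" using N_inj n m by metis
  qed
  define V where "V = q ` W"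
  define \<sigma> where "\<sigma> = inv_into W q"
  have V: "openin Y V" unfolding V_def by (rule open_map_q[OF W])
  have q\<sigma>: "q (\<sigma> y) = y" "\<sigma> y \<in> W" if "y \<in> V" for y
    using that unfolding V_def \<sigma>_def by (simp_all add: f_inv_into_f inv_into_into)
  have \<sigma>q: "\<sigma> (q w) = w" if "w \<in> W" for w
    using that inj unfolding \<sigma>_def by (simp add: inv_into_f_f)
  have topV: "topspace (subtopology Y V) = V"
    using openin_subset[OF V] by (rule topspace_subtopology_subset)
  have "continuous_map (subtopology Y V) (top_of_set (carrier S)) \<sigma>"
    unfolding continuous_map topV
  proof (intro conjI allI impI)
    show "\<sigma> ` V \<subseteq> topspace (top_of_set (carrier S))"
      using q\<sigma>(2) WS by auto
    fix U assume U: "openin (top_of_set (carrier S)) U"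
    then have "openin (top_of_set (carrier S)) (U \<inter> W)"
      using W by (rule openin_Int)
    then have "openin Y (q ` (U \<inter> W))" by (rule open_map_q)
    moreover have "{y \<in> V. \<sigma> y \<in> U} = V \<inter> q ` (U \<inter> W)"
    proof (intro equalityI subsetI)
      fix y assume "y \<in> {y \<in> V. \<sigma> y \<in> U}"
      then show "y \<in> V \<inter> q ` (U \<inter> W)" using q\<sigma>[of y] by force
    next
      fix y assume "y \<in> V \<inter> q ` (U \<inter> W)"
      then show "y \<in> {y \<in> V. \<sigma> y \<in> U}" using \<sigma>q by auto
    qed
    ultimately show "openin (subtopology Y V) {y \<in> V. \<sigma> y \<in> U}"
      using openin_subtopology_Int2 by metis
  qed
  moreover have "q x \<in> V"
    unfolding V_def W_def using N(2) x by force
  ultimately show ?thesis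
    using V q\<sigma> by blast
qed

section \<open>Lifting maps through the quotient map\<close>

definition lifts :: "('k::topological_space \<Rightarrow> 'y) \<Rightarrow> 'k set \<Rightarrow> bool" where
  "lifts F K \<longleftrightarrow> (\<exists>f. continuous_on K f \<and> f ` K \<subseteq> carrier S \<and> (\<forall>k\<in>K. q (f k) = F k))"

text \<open>The quotient of the two lifts takes values in the discrete set \<open>H\<close>, hence
  is locally constant, hence constant on the connected set \<open>K\<close>; it is the identity at
  \<open>k0\<close>.\<close>

lemma lift_unique:
  assumes K: "connected K" and f: "continuous_on K f" "f ` K \<subseteq> carrier S"
    and g: "continuous_on K g" "g ` K \<subseteq> carrier S"
    and eq: "\<And>k. k \<in> K \<Longrightarrow> q (f k) = q (g k)" and k0: "k0 \<in> K" "f k0 = g k0"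
    and k: "k \<in> K"
  shows "f k = g k"
proof -
  obtain O' where O': "openin (top_of_set (carrier S)) O'" "O' \<inter> H = {\<one>}"
    using discrete_H by blast
  define d where "d = (\<lambda>k. inv (f k) \<otimes> g k)"
  have fS: "f k \<in> carrier S" and gS: "g k \<in> carrier S" if "k \<in> K" for k
    using that f g by auto
  have inv_fS: "(\<lambda>k. inv (f k)) ` K \<subseteq> carrier S"
    using fS by auto
  have d: "continuous_on K d" "d ` K \<subseteq> carrier S"
    unfolding d_def using f g inv_fS fS gS by (auto intro!: continuous_on_mult continuous_on_minv)
  have dH: "d k \<in> H" if "k \<in> K" for k
    using that eq fS gS q_eq_iff unfolding d_def by blast
  \<comment> \<open>The translate of \<open>O'\<close> by \<open>h\<close> meets \<open>H\<close> in
    \<open>h\<close> alone, so each fibre of \<open>d\<close> is the preimage of an open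
    set.\<close>
  have op: "openin (top_of_set K) {k \<in> K. d k = h}" if h: "h \<in> H" for h
  proof -
    have "openin (top_of_set (carrier S)) ((\<lambda>x. h \<otimes> x \<otimes> \<one>) ` O')"
      using openin_translate[OF O'(1) H_carrier[OF h] one_closed] .
    then have "openin (top_of_set K) (K \<inter> d -` ((\<lambda>x. h \<otimes> x \<otimes> \<one>) ` O'))"
      by (rule continuous_openin_preimage[OF d(1), rotated]) (use d(2) in auto)
    moreover have "K \<inter> d -` ((\<lambda>x. h \<otimes> x \<otimes> \<one>) ` O') = {k \<in> K. d k = h}"
    proof (intro equalityI subsetI)
      fix k assume "k \<in> K \<inter> d -` ((\<lambda>x. h \<otimes> x \<otimes> \<one>) ` O')"
      then obtain x where x: "k \<in> K" "x \<in> O'" "d k = h \<otimes> x \<otimes> \<one>" by blast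
      have xS: "x \<in> carrier S" using O'(1) x(2) openin_imp_subset by blast
      have "d k = h \<otimes> x" using x xS H_carrier[OF h] by simp
      then have "x = inv h \<otimes> d k" using xS H_carrier[OF h] by simp
      then have "x \<in> H"
        using subgroup.m_closed[OF subgroup_H subgroup.m_inv_closed[OF subgroup_H h] dH[OF x(1)]] by simp
      then have "x = \<one>" using O'(2) x(2) by blast
      then show "k \<in> {k \<in> K. d k = h}" using x H_carrier[OF h] by simp
    next
      fix k assume k: "k \<in> {k \<in> K. d k = h}"
      then have "d k = h \<otimes> \<one> \<otimes> \<one>" using H_carrier[OF h] by simp
      moreover have "\<one> \<in> O'" using O'(2) by blast
      ultimately show "k \<in> K \<inter> d -` ((\<lambda>x. h \<otimes> x \<otimes> \<one>) ` O')"
        using k by blast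
    qed
    ultimately show ?thesis by simp
  qed
  have "openin (top_of_set K) {k \<in> K. d k = \<one>}"
    using op subgroup.one_closed[OF subgroup_H] by blast
  moreover have "openin (top_of_set K) (\<Union>h\<in>H - {\<one>}. {k \<in> K. d k = h})"
    using op by (intro openin_Union) blast
  moreover have "(\<Union>h\<in>H - {\<one>}. {k \<in> K. d k = h}) = K - {k \<in> K. d k = \<one>}"
    using dH by blast
  ultimately have "closedin (top_of_set K) {k \<in> K. d k = \<one>}"
    "openin (top_of_set K) {k \<in> K. d k = \<one>}"
    by (auto simp: closedin_def)
  then have "{k \<in> K. d k = \<one>} = {} \<or> {k \<in> K. d k = \<one>} = K"
    using K unfolding connected_clopen by blast
  moreover have "k0 \<in> {k \<in> K. d k = \<one>}"
    using k0 fS[OF k0(1)] unfolding d_def by simp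
  ultimately have "d k = \<one>" using k by blast
  then show ?thesis
    unfolding d_def using fS[OF k] gS[OF k] by (metis inv_closed inv_equality inv_inv)
qed

text \<open>Two points over the same value differ by right multiplication with an element of
  \<open>H\<close>, and multiplying a whole lift by that element changes nothing below.
  \<open>lifts\<close> can therefore leave the base point open.\<close>

lemma lifts_basepoint:
  assumes "lifts F K" "k0 \<in> K" "x0 \<in> carrier S" "q x0 = F k0"
  shows "\<exists>f. continuous_on K f \<and> f ` K \<subseteq> carrier S \<and> (\<forall>k\<in>K. q (f k) = F k) \<and> f k0 = x0"
proof -
  obtain f where f: "continuous_on K f" "f ` K \<subseteq> carrier S" "\<And>k. k \<in> K \<Longrightarrow> q (f k) = F k"
    using assms(1) unfolding lifts_def by blast
  have fk0: "f k0 \<in> carrier S" using f(2) assms(2) by blast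
  define h where "h = inv (f k0) \<otimes> x0"
  have h: "h \<in> H"
    unfolding h_def using q_eq_iff[OF fk0 assms(3)] f(3)[OF assms(2)] assms(4) by simp
  show ?thesis
  proof (intro exI[of _ "\<lambda>k. f k \<otimes> h"] conjI ballI)
    show "continuous_on K (\<lambda>k. f k \<otimes> h)"
      using f(1,2) H_carrier[OF h] by (intro continuous_on_mult continuous_on_const) auto
    show "(\<lambda>k. f k \<otimes> h) ` K \<subseteq> carrier S"
      using f(2) H_carrier[OF h] by auto
    show "q (f k \<otimes> h) = F k" if "k \<in> K" for k
      using q_mult_H[OF _ h, of "f k"] f(2,3) that by auto
    show "f k0 \<otimes> h = x0"
      unfolding h_def using fk0 assms(3) by simp
  qed
qed

text \<open>The second lift is normalised to agree with the first at one point of the overlap;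
  connectedness of the overlap makes them agree on all of it, and closedness of the pieces allows
  gluing.\<close>

lemma lifts_Un:
  assumes 1: "lifts F K1" and 2: "lifts F K2" and cl: "closed K1" "closed K2"
    and conn: "connected (K1 \<inter> K2)" "K1 \<inter> K2 \<noteq> {}"
  shows "lifts F (K1 \<union> K2)"
proof -
  obtain f where f: "continuous_on K1 f" "f ` K1 \<subseteq> carrier S" "\<And>k. k \<in> K1 \<Longrightarrow> q (f k) = F k"
    using 1 unfolding lifts_def by blast
  obtain k0 where k0: "k0 \<in> K1" "k0 \<in> K2" using conn(2) by blast
  have "f k0 \<in> carrier S" using f(2) k0(1) by blast
  from lifts_basepoint[OF 2 k0(2) this f(3)[OF k0(1)]]
  obtain g where g: "continuous_on K2 g" "g ` K2 \<subseteq> carrier S" "\<forall>k\<in>K2. q (g k) = F k"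
    and g0: "g k0 = f k0"
    by (elim exE conjE)
  have eq: "f k = g k" if "k \<in> K1" "k \<in> K2" for k
    by (rule lift_unique[OF conn(1), where f = f and g = g and ?k0.0 = k0])
      (use f g g0 k0 that in \<open>auto intro: continuous_on_subset\<close>)
  let ?h = "\<lambda>k. if k \<in> K1 then f k else g k"
  have "continuous_on (K1 \<union> K2) ?h"
    using eq by (intro continuous_on_cases cl f g) auto
  moreover have "?h ` (K1 \<union> K2) \<subseteq> carrier S" "\<forall>k\<in>K1 \<union> K2. q (?h k) = F k"
    using f g by auto
  ultimately show ?thesis unfolding lifts_def by blast
qed

text \<open>Lifts exist on small rectangles by local sections, and adjacent rectangles share a
  segment, which is connected. Two nested bisection arguments assemble them: within a thin strip
  along the second coordinate, then across strips along the first.\<close>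

lemma lifts_square:
  fixes F :: "real \<times> real \<Rightarrow> 'y"
  assumes F: "continuous_map (top_of_set ({0..1} \<times> {0..1})) Y F"
  shows "lifts F ({0..1} \<times> {0..1})"
proof -
  \<comment> \<open>The condition is void for rectangles leaving the unit square, because
    \<open>Bolzano\<close> quantifies over all short intervals around a point, including those that
    cross its ends.\<close>
  define P where "P a b c d \<longleftrightarrow> (0 \<le> a \<and> b \<le> 1 \<and> 0 \<le> c \<and> d \<le> 1 \<longrightarrow> lifts F ({a..b} \<times> {c..d}))" for a b c d
  have loc: "\<exists>\<delta>>0. \<forall>a b c d. a \<le> x \<and> x \<le> b \<and> b - a < \<delta> \<and> c \<le> y \<and> y \<le> d \<and> d - c < \<delta> \<longrightarrow> P a b c d"
    if x: "0 \<le> x" "x \<le> 1" and y: "0 \<le> y" "y \<le> 1" for x y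
  proof -
    let ?Q = "{0..1} \<times> {0..1} :: (real \<times> real) set"
    have xy: "(x, y) \<in> ?Q" using x y by simp
    then have "F (x, y) \<in> topspace Y"
      using F by (auto simp: continuous_map_def)
    then obtain s where s: "s \<in> carrier S" "q s = F (x, y)"
      unfolding topspace_Y by (metis imageE)
    obtain V \<sigma> where V: "openin Y V" "F (x, y) \<in> V"
      and \<sigma>: "continuous_map (subtopology Y V) (top_of_set (carrier S)) \<sigma>" "\<forall>y\<in>V. q (\<sigma> y) = y"
      using local_section[OF s(1)] unfolding s(2) by blast
    have opn: "openin (top_of_set ?Q) {z \<in> ?Q. F z \<in> V}"
      using openin_continuous_map_preimage[OF F V(1)] by simp
    have "(x, y) \<in> {z \<in> ?Q. F z \<in> V}" using xy V(2) by simp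
    from bspec[OF conjunct2[OF opn[unfolded openin_euclidean_subtopology_iff]] this]
    obtain \<epsilon> where \<epsilon>: "\<epsilon> > 0" "\<forall>z\<in>?Q. dist z (x, y) < \<epsilon> \<longrightarrow> z \<in> {z \<in> ?Q. F z \<in> V}"
      by (elim exE conjE)
    show ?thesis
    proof (intro exI[of _ "\<epsilon> / 2"] conjI allI impI)
      fix a b c d assume *: "a \<le> x \<and> x \<le> b \<and> b - a < \<epsilon> / 2 \<and> c \<le> y \<and> y \<le> d \<and> d - c < \<epsilon> / 2"
      show "P a b c d"
        unfolding P_def
      proof
        assume **: "0 \<le> a \<and> b \<le> 1 \<and> 0 \<le> c \<and> d \<le> 1"
        have sub: "{a..b} \<times> {c..d} \<subseteq> ?Q" using ** by auto
        have V: "F z \<in> V" if z: "z \<in> {a..b} \<times> {c..d}" for z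
        proof -
          have "dist z (x, y) \<le> \<bar>fst z - x\<bar> + \<bar>snd z - y\<bar>"
            unfolding dist_prod_def dist_real_def by (simp add: sqrt_sum_squares_le_sum_abs)
          also have "\<dots> < \<epsilon>"
          proof -
            have "a \<le> fst z" "fst z \<le> b" "c \<le> snd z" "snd z \<le> d" using z by auto
            then show ?thesis using * by linarith
          qed
          finally have "dist z (x, y) < \<epsilon>" .
          moreover have "z \<in> ?Q" using z sub by (rule subsetD[rotated])
          ultimately show ?thesis using \<epsilon>(2) by blast
        qed
        have "continuous_map (top_of_set ({a..b} \<times> {c..d})) (subtopology Y V) F"
          using continuous_map_from_subtopology_mono[OF F sub] V by (simp add: continuous_map_in_subtopology image_subset_iff)
        then have "continuous_map (top_of_set ({a..b} \<times> {c..d})) (top_of_set (carrier S)) (\<sigma> \<circ> F)"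
          using \<sigma>(1) by (rule continuous_map_compose)
        then have "continuous_on ({a..b} \<times> {c..d}) (\<sigma> \<circ> F)" "(\<sigma> \<circ> F) ` ({a..b} \<times> {c..d}) \<subseteq> carrier S"
          by auto
        then show "lifts F ({a..b} \<times> {c..d})"
          unfolding lifts_def using \<sigma>(2) V by (intro exI[of _ "\<sigma> \<circ> F"]) auto
      qed
    qed (use \<epsilon> in auto)
  qed
  \<comment> \<open>The width \<open>\<delta>\<close> is part of the bisected predicate: at each
    gluing the smaller of two widths is kept, so one positive width remains for the full
    height.\<close>
  have strip: "\<exists>\<delta>>0. \<forall>a b. a \<le> x \<and> x \<le> b \<and> b - a < \<delta> \<longrightarrow> P a b 0 1" if x: "0 \<le> x" "x \<le> 1" for x
  proof (rule Bolzano[where P = "\<lambda>c d. \<exists>\<delta>>0. \<forall>a b. a \<le> x \<and> x \<le> b \<and> b - a < \<delta> \<longrightarrow> P a b c d"])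
    show "(0::real) \<le> 1" by simp
  next
    fix c d e assume 1: "\<exists>\<delta>>0. \<forall>a b. a \<le> x \<and> x \<le> b \<and> b - a < \<delta> \<longrightarrow> P a b c d"
      and 2: "\<exists>\<delta>>0. \<forall>a b. a \<le> x \<and> x \<le> b \<and> b - a < \<delta> \<longrightarrow> P a b d e"
      and cde: "c \<le> d" "d \<le> e"
    obtain \<delta>1 where \<delta>1: "\<delta>1 > 0" "\<forall>a b. a \<le> x \<and> x \<le> b \<and> b - a < \<delta>1 \<longrightarrow> P a b c d"
      using 1 by (elim exE conjE)
    obtain \<delta>2 where \<delta>2: "\<delta>2 > 0" "\<forall>a b. a \<le> x \<and> x \<le> b \<and> b - a < \<delta>2 \<longrightarrow> P a b d e"
      using 2 by (elim exE conjE)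
    show "\<exists>\<delta>>0. \<forall>a b. a \<le> x \<and> x \<le> b \<and> b - a < \<delta> \<longrightarrow> P a b c e"
    proof (intro exI[of _ "min \<delta>1 \<delta>2"] conjI allI impI)
      fix a b assume ab: "a \<le> x \<and> x \<le> b \<and> b - a < min \<delta>1 \<delta>2"
      show "P a b c e"
        unfolding P_def
      proof
        assume "0 \<le> a \<and> b \<le> 1 \<and> 0 \<le> c \<and> e \<le> 1"
        then have "lifts F ({a..b} \<times> {c..d})" "lifts F ({a..b} \<times> {d..e})"
          using \<delta>1(2) \<delta>2(2) ab cde unfolding P_def by auto
        moreover have "({a..b} \<times> {c..d}) \<inter> ({a..b} \<times> {d..e}) = {a..b} \<times> {d}"
          using cde by auto
        moreover have "({a..b} \<times> {c..d}) \<union> ({a..b} \<times> {d..e}) = {a..b} \<times> {c..e}"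
          using cde by auto
        moreover have "connected ({a..b} \<times> {d})" "{a..b} \<times> {d} \<noteq> {}"
          using ab by (auto intro: connected_Times)
        ultimately show "lifts F ({a..b} \<times> {c..e})"
          using lifts_Un[of F "{a..b} \<times> {c..d}" "{a..b} \<times> {d..e}"]
          by (simp add: closed_Times)
      qed
    qed (use \<delta>1 \<delta>2 in auto)
  next
    fix y :: real assume "0 \<le> y" "y \<le> 1"
    from loc[OF x this] obtain \<delta> where \<delta>: "\<delta> > 0" "\<forall>a b c d. a \<le> x \<and> x \<le> b \<and> b - a < \<delta> \<and>
        c \<le> y \<and> y \<le> d \<and> d - c < \<delta> \<longrightarrow> P a b c d"
      by (elim exE conjE)
    then show "\<exists>\<delta>>0. \<forall>c d. c \<le> y \<and> y \<le> d \<and> d - c < \<delta> \<longrightarrow>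
        (\<exists>\<delta>>0. \<forall>a b. a \<le> x \<and> x \<le> b \<and> b - a < \<delta> \<longrightarrow> P a b c d)"
      by (intro exI[of _ \<delta>] conjI allI impI) auto
  qed
  have "P 0 1 0 1"
  proof (rule Bolzano[where P = "\<lambda>a b. P a b 0 1"])
    show "(0::real) \<le> 1" by simp
  next
    fix a b c assume ab: "P a b 0 1" and bc: "P b c 0 1" and abc: "a \<le> b" "b \<le> c"
    show "P a c 0 1"
      unfolding P_def
    proof
      assume "0 \<le> a \<and> c \<le> 1 \<and> 0 \<le> (0::real) \<and> (1::real) \<le> 1"
      then have "lifts F ({a..b} \<times> {0..1})" "lifts F ({b..c} \<times> {0..1})"
        using ab bc abc unfolding P_def by auto
      moreover have "({a..b} \<times> {0..1::real}) \<inter> ({b..c} \<times> {0..1}) = {b} \<times> {0..1}"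
        using abc by auto
      moreover have "({a..b} \<times> {0..1::real}) \<union> ({b..c} \<times> {0..1}) = {a..c} \<times> {0..1}"
        using abc by auto
      moreover have "connected ({b} \<times> {0..1::real})" "{b} \<times> {0..1::real} \<noteq> {}"
        by (auto intro: connected_Times)
      ultimately show "lifts F ({a..c} \<times> {0..1})"
        using lifts_Un[of F "{a..b} \<times> {0..1}" "{b..c} \<times> {0..1}"]
        by (simp add: closed_Times)
    qed
  next
    fix x :: real assume "0 \<le> x" "x \<le> 1"
    then show "\<exists>\<delta>>0. \<forall>a b. a \<le> x \<and> x \<le> b \<and> b - a < \<delta> \<longrightarrow> P a b 0 1"
      by (rule strip)
  qed
  then show ?thesis unfolding P_def by simp
qed

section \<open>Loops in the quotient and the endpoints of their lifts\<close>

abbreviation y0 where "y0 \<equiv> q \<one>"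

text \<open>The path is read as a map of the square that ignores its first coordinate, so that the
  square lemma applies. Normalising the lift at time 1 leaves its starting point as the element of
  \<open>H\<close> sought.\<close>

lemma lift_path:
  assumes "loop_at Y y0 p"
  shows "\<exists>h\<in>H. p \<in> lift_class S q h"
proof -
  have p: "continuous_map (top_of_set {0..1}) Y p" "p 0 = y0" "p 1 = y0"
    using assms unfolding loop_at_def pathin_def by auto
  have "continuous_map (top_of_set ({0..1::real} \<times> {0..1::real})) (top_of_set {0..1}) snd"
    by (auto intro: continuous_intros)
  from continuous_map_compose[OF this p(1)]
  have "lifts (p \<circ> snd) ({0..1::real} \<times> {0..1::real})" by (rule lifts_square)
  from lifts_basepoint[OF this, of "(0, 1)" \<one>] p
  obtain f where f: "continuous_on ({0..1::real} \<times> {0..1::real}) f" "f ` ({0..1} \<times> {0..1}) \<subseteq> carrier S"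
    "\<forall>k\<in>{0..1} \<times> {0..1}. q (f k) = (p \<circ> snd) k" "f (0, 1) = \<one>"
    by auto
  have f0: "f (0, 0) \<in> carrier S" using f(2) by auto
  have "q \<one> = q (f (0, 0))" using f(3) p by simp
  then have "f (0, 0) \<in> H" using q_eq_iff[OF one_closed f0] f0 by simp
  moreover have "p \<in> lift_class S q (f (0, 0))"
    unfolding lift_class_def
  proof (intro CollectI exI[of _ "\<lambda>t. f (0, t)"] conjI ballI)
    show "continuous_on {0..1} (\<lambda>t. f (0, t))"
      by (rule continuous_on_compose2[OF f(1)]) (auto intro: continuous_intros)
  qed (use f in auto)
  ultimately show ?thesis by blast
qed

lemma lift_class_loop:
  assumes "h \<in> H" "p \<in> lift_class S q h"
  shows "loop_at Y y0 p"
proof -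
  obtain \<gamma> where \<gamma>: "continuous_on {0..1} \<gamma>" "\<gamma> ` {0..1} \<subseteq> carrier S" "\<gamma> 0 = h" "\<gamma> 1 = \<one>"
    "\<forall>t\<in>{0..1}. q (\<gamma> t) = p t"
    using assms(2) unfolding lift_class_def by blast
  have "continuous_map (top_of_set {0..1}) Y p"
    by (rule continuous_map_eq[OF continuous_map_q_comp[OF \<gamma>(1,2)]]) (use \<gamma>(5) in auto)
  moreover have "p 0 = q \<one>"
    using \<gamma>(3,5) q_mult_H[OF one_closed assms(1)] H_carrier[OF assms(1)] by (metis atLeastAtMost_iff l_one order_refl zero_le_one)
  moreover have "p 1 = q \<one>" using bspec[OF \<gamma>(5), of 1] \<gamma>(4) by simp
  ultimately show ?thesis unfolding loop_at_def pathin_def by simp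
qed

text \<open>Dividing one lift by the other gives a null-homotopic loop, which contracts freely to the
  identity; translating each stage of that homotopy to start at the identity keeps endpoints fixed.\<close>

lemma lift_class_homotopic:
  assumes h: "h \<in> H" and p: "p \<in> lift_class S q h" and r: "r \<in> lift_class S q h"
  shows "homotopic_with (\<lambda>r. r 0 = y0 \<and> r 1 = y0) (top_of_set {0..1}) Y p r"
proof -
  obtain \<gamma> where \<gamma>: "continuous_on {0..1} \<gamma>" "\<gamma> ` {0..1} \<subseteq> carrier S" "\<gamma> 0 = h" "\<gamma> 1 = \<one>"
    "\<forall>t\<in>{0..1}. q (\<gamma> t) = p t"
    using p unfolding lift_class_def by blast
  obtain \<delta> where \<delta>: "continuous_on {0..1} \<delta>" "\<delta> ` {0..1} \<subseteq> carrier S" "\<delta> 0 = h" "\<delta> 1 = \<one>"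
    "\<forall>t\<in>{0..1}. q (\<delta> t) = r t"
    using r unfolding lift_class_def by blast
  have \<gamma>S: "\<gamma> t \<in> carrier S" and \<delta>S: "\<delta> t \<in> carrier S" if "t \<in> {0..1}" for t
    using \<gamma>(2) \<delta>(2) that by auto
  have hS: "h \<in> carrier S" by (rule H_carrier[OF h])
  define \<eta> where "\<eta> = (\<lambda>t. \<gamma> t \<otimes> inv (\<delta> t))"
  have \<eta>: "path \<eta>" "path_image \<eta> \<subseteq> carrier S" "\<eta> 0 = \<one>" "\<eta> 1 = \<one>"
    unfolding \<eta>_def path_def path_image_def using \<gamma> \<delta> hS \<gamma>S \<delta>S
    by (auto intro!: continuous_on_mult continuous_on_minv)
  have "homotopic_loops (carrier S) \<eta> (\<lambda>_. \<one>)"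
    by (rule simply_connected_carrier[unfolded simply_connected_def, rule_format])
      (use \<eta> in \<open>auto simp: path_def path_image_def pathstart_def pathfinish_def\<close>)
  then obtain F where F: "continuous_on ({0..1::real} \<times> {0..1::real}) F" "F \<in> ({0..1} \<times> {0..1}) \<rightarrow> carrier S"
    "\<forall>t\<in>{0..1}. F (0, t) = \<eta> t" "\<forall>t\<in>{0..1}. F (1, t) = \<one>"
    "\<forall>s\<in>{0..1}. pathfinish (F \<circ> Pair s) = pathstart (F \<circ> Pair s)"
    unfolding homotopic_loops by blast
  have FS: "F (s, t) \<in> carrier S" if "s \<in> {0..1}" "t \<in> {0..1}" for s t
    using F(2) that by auto
  have F01: "F (s, 1) = F (s, 0)" if "s \<in> {0..1}" for s
    using F(5) that by (simp add: pathfinish_def pathstart_def)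
  define G where "G = (\<lambda>z. inv (F (fst z, 0)) \<otimes> F z \<otimes> \<delta> (snd z))"
  have c1: "continuous_on ({0..1} \<times> {0..1}) (\<lambda>z. F (fst z, 0))"
    by (rule continuous_on_compose2[OF F(1)]) (auto intro!: continuous_intros)
  have c2: "continuous_on ({0..1::real} \<times> {0..1}) (\<lambda>z. \<delta> (snd z))"
    by (rule continuous_on_compose2[OF \<delta>(1)]) (auto intro: continuous_intros)
  have G: "continuous_on ({0..1} \<times> {0..1}) G" "G ` ({0..1} \<times> {0..1}) \<subseteq> carrier S"
    unfolding G_def using FS \<delta>S
    by (auto intro!: continuous_on_mult continuous_on_minv c1 c2 F(1))
  have GS: "G (s, t) \<in> carrier S" if "s \<in> {0..1}" "t \<in> {0..1}" for s t
    using G(2) that by auto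
  have "homotopic_with (\<lambda>r. r 0 = h \<and> r 1 = \<one>) (top_of_set {0..1}) (top_of_set (carrier S)) \<gamma> \<delta>"
  proof (subst homotopic_with)
    show "\<exists>h'. continuous_map (prod_topology (top_of_set {0..1::real}) (top_of_set {0..1::real})) (top_of_set (carrier S)) h' \<and>
      (\<forall>x\<in>topspace (top_of_set {0..1}). h' (0, x) = \<gamma> x) \<and>
      (\<forall>x\<in>topspace (top_of_set {0..1}). h' (1, x) = \<delta> x) \<and>
      (\<forall>t\<in>{0..1}. h' (t, 0) = h \<and> h' (t, 1) = \<one>)"
    proof (intro exI[of _ G] conjI ballI)
      show "continuous_map (prod_topology (top_of_set {0..1::real}) (top_of_set {0..1::real})) (top_of_set (carrier S)) G"
        unfolding prod_topology_top_of_set using G by auto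
      fix t :: real
      show "G (t, 0) = h" if "t \<in> {0..1}"
        unfolding G_def using FS[OF that, of 0] \<delta>(3) hS by (simp add: m_assoc)
      show "G (t, 1) = \<one>" if "t \<in> {0..1}"
        unfolding G_def using FS[OF that, of 0] \<delta>(4) F01[OF that] by simp
      show "G (0, t) = \<gamma> t" if "t \<in> topspace (top_of_set {0..1})"
        unfolding G_def using F(3) \<eta>(3) \<gamma>S[of t] \<delta>S[of t] that by (simp add: \<eta>_def m_assoc)
      show "G (1, t) = \<delta> t" if "t \<in> topspace (top_of_set {0..1})"
        unfolding G_def using F(4) \<delta>S[of t] that by simp
    qed
  qed auto
  from homotopic_with_compose_continuous_map_left[OF this continuous_q]
  have "homotopic_with (\<lambda>r. r 0 = y0 \<and> r 1 = y0) (top_of_set {0..1}) Y (q \<circ> \<gamma>) (q \<circ> \<delta>)"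
    using q_mult_H[OF one_closed h] hS by auto
  then show ?thesis
    by (rule homotopic_with_eq) (use \<gamma>(5) \<delta>(5) in auto)
qed

text \<open>The homotopy is lifted with value the identity at \<open>(0, 1)\<close>. Uniqueness of
  lifts identifies three sides of the square in turn: \<open>\<gamma>\<close> along the beginning of
  the homotopy, the constant identity over time 1, and the constant \<open>h\<close> over time 0.
  The remaining side is a lift of \<open>r\<close> of the required kind.\<close>

lemma homotopic_lift_class:
  assumes h: "h \<in> H" and p: "p \<in> lift_class S q h"
    and pr: "homotopic_with (\<lambda>r. r 0 = y0 \<and> r 1 = y0) (top_of_set {0..1}) Y p r"
  shows "r \<in> lift_class S q h"
proof -
  obtain \<gamma> where \<gamma>: "continuous_on {0..1} \<gamma>" "\<gamma> ` {0..1} \<subseteq> carrier S" "\<gamma> 0 = h" "\<gamma> 1 = \<one>"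
    "\<forall>t\<in>{0..1}. q (\<gamma> t) = p t"
    using p unfolding lift_class_def by blast
  obtain F where F: "continuous_map (top_of_set ({0..1::real} \<times> {0..1::real})) Y F"
    "\<forall>t. F (0, t) = p t" "\<forall>t. F (1, t) = r t" "\<forall>s\<in>{0..1}. F (s, 0) = y0 \<and> F (s, 1) = y0"
    using pr unfolding homotopic_with_def prod_topology_top_of_set by blast
  have "q \<one> = F (0, 1)" using F(4) by simp
  from lifts_basepoint[OF lifts_square[OF F(1)] _ one_closed this]
  obtain f where f: "continuous_on ({0..1} \<times> {0..1}) f" "f ` ({0..1} \<times> {0..1}) \<subseteq> carrier S"
    "\<forall>k\<in>{0..1} \<times> {0..1}. q (f k) = F k" "f (0, 1) = \<one>"
    by auto
  have hS: "h \<in> carrier S" by (rule H_carrier[OF h])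
  have qh: "q h = y0" using q_mult_H[OF one_closed h] hS by simp
  have fS: "f (s, t) \<in> carrier S" if "s \<in> {0..1}" "t \<in> {0..1}" for s t
    using f(2) that by auto
  have c1: "continuous_on {0..1} (\<lambda>t. f (s, t))" if "s \<in> {0..1}" for s
    by (rule continuous_on_compose2[OF f(1)]) (use that in \<open>auto intro: continuous_intros\<close>)
  have c2: "continuous_on {0..1} (\<lambda>s. f (s, t))" if "t \<in> {0..1}" for t
    by (rule continuous_on_compose2[OF f(1)]) (use that in \<open>auto intro: continuous_intros\<close>)
  have conn: "connected {0..1::real}" by simp
  have "f (0, 0) = \<gamma> 0"
    by (rule lift_unique[OF conn, where f = "\<lambda>t. f (0, t)" and g = \<gamma> and ?k0.0 = 1])
      (use c1 fS \<gamma> f F in auto)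
  moreover have "f (1, 1) = \<one>"
    by (rule lift_unique[OF conn, where f = "\<lambda>s. f (s, 1)" and g = "\<lambda>_. \<one>" and ?k0.0 = 0])
      (use c2 fS f F in auto)
  moreover have "f (1, 0) = h"
    by (rule lift_unique[OF conn, where f = "\<lambda>s. f (s, 0)" and g = "\<lambda>_. h" and ?k0.0 = 0])
      (use c2 fS f F hS qh \<gamma>(3) \<open>f (0, 0) = \<gamma> 0\<close> in auto)
  ultimately show ?thesis
    unfolding lift_class_def using f(3) F(3) fS c1
    by (intro CollectI exI[of _ "\<lambda>t. f (1, t)"]) auto
qed

lemma loop_class_eq:
  assumes "h \<in> H" "p \<in> lift_class S q h"
  shows "loop_class Y y0 p = lift_class S q h"
  unfolding loop_class_def
  using lift_class_homotopic[OF assms] homotopic_lift_class[OF assms] by blast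

text \<open>Two lifts of one path that both end at the identity coincide, and so do their starting
  points.\<close>

lemma lift_class_inj:
  assumes "p \<in> lift_class S q h" "p \<in> lift_class S q k"
  shows "h = k"
proof -
  obtain \<gamma> where \<gamma>: "continuous_on {0..1} \<gamma>" "\<gamma> ` {0..1} \<subseteq> carrier S" "\<gamma> 0 = h" "\<gamma> 1 = \<one>"
    "\<forall>t\<in>{0..1}. q (\<gamma> t) = p t"
    using assms(1) unfolding lift_class_def by blast
  obtain \<delta> where \<delta>: "continuous_on {0..1} \<delta>" "\<delta> ` {0..1} \<subseteq> carrier S" "\<delta> 0 = k" "\<delta> 1 = \<one>"
    "\<forall>t\<in>{0..1}. q (\<delta> t) = p t"
    using assms(2) unfolding lift_class_def by blast
  have "connected {0..1::real}" by simp
  from lift_unique[OF this \<gamma>(1,2) \<delta>(1,2), of 1 0] show ?thesis using \<gamma> \<delta> by auto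
qed

text \<open>A free homotopy between the constant loops at \<open>h\<close> and at the identity,
  followed at one fixed time, is such a path.\<close>

lemma carrier_path:
  assumes "h \<in> carrier S"
  shows "\<exists>\<gamma>. continuous_on {0..1::real} \<gamma> \<and> \<gamma> ` {0..1} \<subseteq> carrier S \<and> \<gamma> 0 = h \<and> \<gamma> 1 = \<one>"
proof -
  have "homotopic_loops (carrier S) (\<lambda>_. h) (\<lambda>_. \<one>)"
    by (rule simply_connected_carrier[unfolded simply_connected_def, rule_format])
      (use assms in \<open>auto simp: path_def path_image_def pathstart_def pathfinish_def\<close>)
  then obtain F where F: "continuous_on ({0..1::real} \<times> {0..1::real}) F" "F \<in> ({0..1} \<times> {0..1}) \<rightarrow> carrier S"
    "\<forall>t\<in>{0..1}. F (0, t) = h" "\<forall>t\<in>{0..1}. F (1, t) = \<one>"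
    unfolding homotopic_loops by blast
  have "continuous_on {0..1} (\<lambda>s. F (s, 0))"
    by (rule continuous_on_compose2[OF F(1)]) (auto intro: continuous_intros)
  then show ?thesis
    using F by (intro exI[of _ "\<lambda>s. F (s, 0)"]) auto
qed

lemma lift_class_nonempty:
  assumes "h \<in> carrier S"
  shows "lift_class S q h \<noteq> {}"
proof -
  obtain \<gamma> where "continuous_on {0..1::real} \<gamma>" "\<gamma> ` {0..1} \<subseteq> carrier S" "\<gamma> 0 = h" "\<gamma> 1 = \<one>"
    using carrier_path[OF assms] by blast
  then have "(\<lambda>t. q (\<gamma> t)) \<in> lift_class S q h" unfolding lift_class_def by blast
  then show ?thesis by blast
qed

text \<open>Right translation by \<open>k\<close> is invisible to \<open>q\<close>. The translate of
  \<open>\<gamma>\<close> runs from \<open>h \<otimes> k\<close> to \<open>k\<close>, where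
  \<open>\<delta>\<close> takes over and runs to the identity; this fixes the order of the
  factors.\<close>

lemma lift_class_concat:
  assumes h: "h \<in> H" and k: "k \<in> H" and p: "p \<in> lift_class S q h" and r: "r \<in> lift_class S q k"
  shows "concat_paths p r \<in> lift_class S q (h \<otimes> k)"
proof -
  obtain \<gamma> where \<gamma>: "continuous_on {0..1} \<gamma>" "\<gamma> ` {0..1} \<subseteq> carrier S" "\<gamma> 0 = h" "\<gamma> 1 = \<one>"
    "\<forall>t\<in>{0..1}. q (\<gamma> t) = p t"
    using p unfolding lift_class_def by blast
  obtain \<delta> where \<delta>: "continuous_on {0..1} \<delta>" "\<delta> ` {0..1} \<subseteq> carrier S" "\<delta> 0 = k" "\<delta> 1 = \<one>"
    "\<forall>t\<in>{0..1}. q (\<delta> t) = r t"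
    using r unfolding lift_class_def by blast
  have kS: "k \<in> carrier S" by (rule H_carrier[OF k])
  define \<epsilon> where "\<epsilon> = (\<lambda>t. if t \<in> {0..1/2::real} then \<gamma> (2 * t) \<otimes> k else \<delta> (2 * t - 1))"
  have "continuous_on {0..1/2} (\<lambda>t. \<gamma> (2 * t))"
    by (rule continuous_on_compose2[OF \<gamma>(1)]) (auto intro!: continuous_intros)
  then have c1: "continuous_on {0..1/2} (\<lambda>t. \<gamma> (2 * t) \<otimes> k)"
    by (intro continuous_on_mult continuous_on_const) (use \<gamma>(2) kS in auto)
  have c2: "continuous_on {1/2..1} (\<lambda>t. \<delta> (2 * t - 1))"
    by (rule continuous_on_compose2[OF \<delta>(1)]) (auto intro!: continuous_intros)
  have "continuous_on ({0..1/2} \<union> {1/2..1}) \<epsilon>"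
    unfolding \<epsilon>_def
  proof (intro continuous_on_cases c1 c2)
    show "\<forall>t. t \<in> {0..1/2} \<and> t \<notin> {0..1/2::real} \<or> t \<in> {1/2..1} \<and> t \<in> {0..1/2} \<longrightarrow>
        \<gamma> (2 * t) \<otimes> k = \<delta> (2 * t - 1)"
    proof (intro allI impI)
      fix t :: real assume "t \<in> {0..1/2} \<and> t \<notin> {0..1/2} \<or> t \<in> {1/2..1} \<and> t \<in> {0..1/2}"
      then have "t = 1/2" by auto
      then have "2 * t = 1" "2 * t - 1 = 0" by simp_all
      then show "\<gamma> (2 * t) \<otimes> k = \<delta> (2 * t - 1)" using \<gamma>(4) \<delta>(3) kS by (simp only: l_one)
    qed
  qed auto
  then have "continuous_on {0..1} \<epsilon>" by (simp flip: split_01)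
  moreover have "\<epsilon> ` {0..1} \<subseteq> carrier S"
    unfolding \<epsilon>_def using \<gamma>(2) \<delta>(2) kS by (auto simp: image_subset_iff)
  moreover have "\<epsilon> 0 = h \<otimes> k" "\<epsilon> 1 = \<one>"
    unfolding \<epsilon>_def using \<gamma> \<delta> by auto
  moreover have "q (\<epsilon> t) = concat_paths p r t" if "t \<in> {0..1}" for t
    using that \<gamma>(2,5) \<delta>(2,5) q_mult_H[OF _ k, of "\<gamma> (2 * t)"]
    unfolding \<epsilon>_def concat_paths_def by (auto simp: image_subset_iff)
  ultimately show ?thesis unfolding lift_class_def by blast
qed

lemma carrier_fundamental_group:
  "carrier (fundamental_group Y y0) = lift_class S q ` H"
proof -
  have "\<exists>p. C = loop_class Y y0 p \<and> loop_at Y y0 p" if C: "C \<in> lift_class S q ` H" for C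
  proof -
    obtain h where h: "h \<in> H" "C = lift_class S q h" using C by blast
    obtain p where p: "p \<in> lift_class S q h" using lift_class_nonempty[OF H_carrier[OF h(1)]] by blast
    show ?thesis
      using loop_class_eq[OF h(1) p] lift_class_loop[OF h(1) p] h(2) by blast
  qed
  moreover have "C \<in> lift_class S q ` H" if C: "C = loop_class Y y0 p" "loop_at Y y0 p" for C p
  proof -
    obtain h where h: "h \<in> H" "p \<in> lift_class S q h" using lift_path[OF C(2)] by blast
    show ?thesis using loop_class_eq[OF h] C(1) h(1) by blast
  qed
  ultimately show ?thesis
    unfolding fundamental_group_def by auto
qed

text \<open>The product in \<open>fundamental_group\<close> is a union over all pairs of
  representatives. Every term is the same class, and nonemptiness of both index sets keeps the union
  from collapsing to the empty set.\<close>

lemma lift_class_mult: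
  assumes h: "h \<in> H" and k: "k \<in> H"
  shows "lift_class S q h \<otimes>\<^bsub>fundamental_group Y y0\<^esub> lift_class S q k = lift_class S q (h \<otimes> k)"
proof -
  have hk: "h \<otimes> k \<in> H" using subgroup.m_closed[OF subgroup_H h k] .
  have "loop_class Y y0 (concat_paths p r) = lift_class S q (h \<otimes> k)"
    if "p \<in> lift_class S q h" "r \<in> lift_class S q k" for p r
    using loop_class_eq[OF hk lift_class_concat[OF h k that]] .
  then have "(\<Union>p\<in>lift_class S q h. \<Union>r\<in>lift_class S q k. loop_class Y y0 (concat_paths p r)) =
    (\<Union>p\<in>lift_class S q h. \<Union>r\<in>lift_class S q k. lift_class S q (h \<otimes> k))"
    by simp
  also have "\<dots> = lift_class S q (h \<otimes> k)"
    using lift_class_nonempty[OF H_carrier[OF h]] lift_class_nonempty[OF H_carrier[OF k]] by simp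
  finally show ?thesis unfolding fundamental_group_def by simp
qed

theorem lift_class_iso:
  "lift_class S q \<in> iso (S\<lparr>carrier := H\<rparr>) (fundamental_group Y y0)"
proof -
  have "inj_on (lift_class S q) H"
  proof (rule inj_onI)
    fix h k assume hk: "h \<in> H" "k \<in> H" "lift_class S q h = lift_class S q k"
    obtain p where "p \<in> lift_class S q h" using lift_class_nonempty[OF H_carrier[OF hk(1)]] by blast
    then show "h = k" using lift_class_inj hk(3) by blast
  qed
  then show ?thesis
    unfolding iso_def hom_def bij_betw_def
    by (auto simp: carrier_fundamental_group lift_class_mult)
qed

end

text \<open>If \<open>\<gamma>\<close> lifts \<open>p\<close> from \<open>h\<close> to the identity,
  then \<open>f\<close> after \<open>\<gamma>\<close> lifts \<open>F \<circ> p\<close> from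
  \<open>f h\<close> to the identity. This naturality yields both commuting squares of the final
  isomorphism of extensions.\<close>

lemma induced_hom_lift_class:
  assumes "discrete_quotient S H q Y" and "discrete_quotient S' H' q' Y'"
    and f: "continuous_on (carrier S) f" "f ` carrier S \<subseteq> carrier S'" "f \<one>\<^bsub>S\<^esub> = \<one>\<^bsub>S'\<^esub>" "f ` H \<subseteq> H'"
    and F: "\<And>x. x \<in> carrier S \<Longrightarrow> F (q x) = q' (f x)"
    and h: "h \<in> H"
  shows "induced_hom Y' (q \<one>\<^bsub>S\<^esub>) F (lift_class S q h) = lift_class S' q' (f h)"
proof -
  interpret S: discrete_quotient S H q Y by fact
  interpret S': discrete_quotient S' H' q' Y' by fact
  have fh: "f h \<in> H'" using f(4) h by blast
  have F1: "F (q \<one>\<^bsub>S\<^esub>) = q' \<one>\<^bsub>S'\<^esub>" using F[OF S.one_closed] f(3) by simp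
  have "loop_class Y' (q' \<one>\<^bsub>S'\<^esub>) (F \<circ> p) = lift_class S' q' (f h)" if p: "p \<in> lift_class S q h" for p
  proof (rule S'.loop_class_eq[OF fh])
    obtain \<gamma> where \<gamma>: "continuous_on {0..1} \<gamma>" "\<gamma> ` {0..1} \<subseteq> carrier S" "\<gamma> 0 = h" "\<gamma> 1 = \<one>\<^bsub>S\<^esub>"
      "\<forall>t\<in>{0..1}. q (\<gamma> t) = p t"
      using p unfolding lift_class_def by blast
    have "continuous_on {0..1} (\<lambda>t. f (\<gamma> t))"
      by (rule continuous_on_compose2[OF f(1) \<gamma>(1,2)])
    moreover have "(\<lambda>t. f (\<gamma> t)) ` {0..1} \<subseteq> carrier S'" using f(2) \<gamma>(2) by (auto simp: image_subset_iff)
    moreover have "\<forall>t\<in>{0..1}. q' (f (\<gamma> t)) = (F \<circ> p) t"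
      using F \<gamma>(2,5) by (metis comp_apply imageI subsetD)
    ultimately show "F \<circ> p \<in> lift_class S' q' (f h)"
      unfolding lift_class_def using \<gamma>(3,4) f(3) by (intro CollectI exI[of _ "\<lambda>t. f (\<gamma> t)"]) simp
  qed
  then show ?thesis
    unfolding induced_hom_def F1 using S.lift_class_nonempty[OF S.H_carrier[OF h]] by simp
qed

section \<open>Rigid motions and tilings\<close>

declare transpose_matrix_vector [simp del]

section \<open>Continuity of matrix operations and the compact group of rotations\<close>

lemma tendsto_matrix_mult [tendsto_intros]:
  fixes f :: "'a \<Rightarrow> real ^ 'n::finite ^ 'm::finite" and g :: "'a \<Rightarrow> real ^ 'k::finite ^ 'n"
  assumes "(f \<longlongrightarrow> A) F" "(g \<longlongrightarrow> B) F"
  shows "((\<lambda>x. f x ** g x) \<longlongrightarrow> A ** B) F"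
  unfolding matrix_matrix_mult_def by (intro tendsto_intros assms)

lemma tendsto_matrix_vector_mult [tendsto_intros]:
  fixes f :: "'a \<Rightarrow> real ^ 'n::finite ^ 'm::finite" and g :: "'a \<Rightarrow> real ^ 'n"
  assumes "(f \<longlongrightarrow> A) F" "(g \<longlongrightarrow> v) F"
  shows "((\<lambda>x. f x *v g x) \<longlongrightarrow> A *v v) F"
  unfolding matrix_vector_mult_def by (intro tendsto_intros assms)

lemma tendsto_transpose [tendsto_intros]:
  fixes f :: "'a \<Rightarrow> real ^ 'n::finite ^ 'm::finite"
  assumes "(f \<longlongrightarrow> A) F"
  shows "((\<lambda>x. transpose (f x)) \<longlongrightarrow> transpose A) F"
  unfolding transpose_def by (intro tendsto_intros assms)

lemma tendsto_det [tendsto_intros]: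
  fixes f :: "'a \<Rightarrow> real ^ 'n::finite ^ 'n"
  assumes "(f \<longlongrightarrow> A) F"
  shows "((\<lambda>x. det (f x)) \<longlongrightarrow> det A) F"
  unfolding det_def by (intro tendsto_intros assms)

text \<open>The norm is the root of the sum of the squares of all entries. Inverting a rotation
  therefore preserves its distance from the identity, which matters because \<open>close\<close>
  allows either tiling to be moved.\<close>

lemma norm_transpose [simp]: "norm (transpose A) = norm (A :: real ^ 'n::finite ^ 'm::finite)"
proof -
  have "norm B = sqrt (\<Sum>i\<in>UNIV. \<Sum>j\<in>UNIV. (B $ i $ j)\<^sup>2)" for B :: "real ^ 'k::finite ^ 'l::finite"
    by (simp add: norm_vec_def L2_set_def sum_nonneg)
  moreover have "(\<Sum>i\<in>UNIV. \<Sum>j\<in>UNIV. (transpose A $ i $ j)\<^sup>2) = (\<Sum>i\<in>UNIV. \<Sum>j\<in>UNIV. (A $ i $ j)\<^sup>2)"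
    unfolding transpose_def by (subst sum.swap) simp
  ultimately show ?thesis by metis
qed

lemma transpose_minus: "transpose (A - B) = transpose A - transpose (B :: real ^ 'n ^ 'm)"
  by (simp add: transpose_def vec_eq_iff)

lemma rotation_matrix_mult:
  "rotation_matrix A \<Longrightarrow> rotation_matrix B \<Longrightarrow> rotation_matrix (A ** B :: real ^ 'n::finite ^ 'n)"
  by (simp add: rotation_matrix_def orthogonal_matrix_mul det_mul)

lemma rotation_matrix_one: "rotation_matrix (mat 1 :: real ^ 'n::finite ^ 'n)"
  by (simp add: rotation_matrix_def orthogonal_matrix_id)

lemma rotation_matrix_transpose:
  "rotation_matrix A \<Longrightarrow> rotation_matrix (transpose A :: real ^ 'n::finite ^ 'n)"
  by (simp add: rotation_matrix_def)

lemma rotation_matrix_inverse: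
  assumes "rotation_matrix (A :: real ^ 'n::finite ^ 'n)"
  shows "transpose A ** A = mat 1" "A ** transpose A = mat 1"
  using assms by (auto simp: rotation_matrix_def orthogonal_matrix_def)

lemma rotation_matrix_cancel:
  assumes "rotation_matrix (A :: real ^ 'n::finite ^ 'n)"
  shows "transpose A *v (A *v x) = x" "A *v (transpose A *v x) = x"
  by (simp_all add: matrix_vector_mul_assoc rotation_matrix_inverse[OF assms])

lemma norm_rotation:
  assumes "rotation_matrix (A :: real ^ 'n::finite ^ 'n)"
  shows "norm (A *v x) = norm x"
proof -
  have "orthogonal_transformation ((*v) A)"
    using assms by (simp add: orthogonal_transformation_matrix rotation_matrix_def)
  then show ?thesis by (rule orthogonal_transformation_norm)
qed

text \<open>Rows of an orthogonal matrix are unit vectors, which bounds the norm; the equations for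
  the transpose and the determinant survive limits.\<close>

lemma compact_rotations: "compact {A :: real ^ 'n::finite ^ 'n. rotation_matrix A}"
proof -
  have "norm A \<le> real CARD('n)" if "rotation_matrix A" for A :: "real ^ 'n ^ 'n"
  proof -
    have "norm A \<le> (\<Sum>i\<in>UNIV. norm (A $ i))"
      unfolding norm_vec_def by (rule L2_set_le_sum) simp
    also have "\<dots> = (\<Sum>i\<in>(UNIV :: 'n set). 1)"
      using that by (intro sum.cong)
        (auto simp: rotation_matrix_def orthogonal_matrix_orthonormal_rows row_def)
    finally show ?thesis by simp
  qed
  then have "bounded {A :: real ^ 'n ^ 'n. rotation_matrix A}"
    unfolding bounded_iff by blast
  moreover have "closed {A :: real ^ 'n ^ 'n. rotation_matrix A}"
    unfolding closed_sequential_limits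
  proof (intro allI impI, elim conjE)
    fix f :: "nat \<Rightarrow> real ^ 'n ^ 'n" and A
    assume f: "\<forall>n. f n \<in> {A. rotation_matrix A}" and lim: "f \<longlonglongrightarrow> A"
    have "(\<lambda>n. transpose (f n) ** f n) \<longlonglongrightarrow> transpose A ** A" "(\<lambda>n. det (f n)) \<longlonglongrightarrow> det A"
      by (intro tendsto_intros lim)+
    moreover have "(\<lambda>n. transpose (f n) ** f n) = (\<lambda>_. mat 1)" "(\<lambda>n. det (f n)) = (\<lambda>_. 1)"
      using f by (auto simp: rotation_matrix_inverse rotation_matrix_def orthogonal_matrix)
    ultimately have "transpose A ** A = mat 1" "det A = 1"
      by (metis LIMSEQ_unique tendsto_const)+
    then show "A \<in> {A. rotation_matrix A}"
      by (simp add: rotation_matrix_def orthogonal_matrix)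
  qed
  ultimately show ?thesis by (simp add: compact_eq_bounded_closed)
qed

text \<open>The rotation comes first and the translation last, opposite to the order in
  \<open>close\<close>; the conversion replaces a vector \<open>x\<close> by
  \<open>A *v x\<close>.\<close>

definition motion :: "real ^ 'n ^ 'n \<Rightarrow> real ^ 'n \<Rightarrow> real ^ 'n::finite \<Rightarrow> real ^ 'n" where
  "motion A v x = A *v x + v"

lemma motion_comp: "motion A v \<circ> motion B w = motion (A ** B) (A *v w + v)"
  by (simp add: motion_def fun_eq_iff matrix_vector_right_distrib matrix_vector_mul_assoc)

lemma motion_one: "motion (mat 1) v = (+) v"
  by (simp add: motion_def fun_eq_iff)

lemma motion_id: "motion (mat 1) 0 = id"
  by (simp add: motion_def fun_eq_iff)

lemma motion_inverse:
  assumes "rotation_matrix A"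
  shows "motion A v \<circ> motion (transpose A) (- (transpose A *v v)) = id"
    "motion (transpose A) (- (transpose A *v v)) \<circ> motion A v = id"
  using rotation_matrix_inverse[OF assms] rotation_matrix_cancel[OF assms]
  by (simp_all add: motion_comp motion_id linear_neg[OF matrix_vector_mul_linear])

lemma linear_part_motion: "linear_part (motion A v) = A"
proof -
  have "(\<lambda>x. motion A v x - motion A v 0) = (*v) A"
    by (simp add: motion_def fun_eq_iff)
  then show ?thesis by (simp add: linear_part_def)
qed

lemma dist_motion:
  assumes "rotation_matrix A"
  shows "dist (motion A v x) (motion A v y) = dist x y"
proof -
  have "motion A v x - motion A v y = A *v (x - y)"
    by (simp add: motion_def matrix_vector_mult_diff_distrib)
  then show ?thesis using norm_rotation[OF assms] by (simp add: dist_norm)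
qed

text \<open>Subtracting the value at the origin turns an isometry into one fixing the origin, and
  such an isometry is linear and orthogonal.\<close>

lemma orientation_preserving_isometry_iff:
  "orientation_preserving_isometry f \<longleftrightarrow> (\<exists>A v. rotation_matrix A \<and> f = motion A v)"
proof
  assume f: "orientation_preserving_isometry f"
  let ?g = "\<lambda>x. f x - f 0"
  have "orthogonal_transformation ?g"
    unfolding orthogonal_transformation_isometry using f
    by (simp add: orientation_preserving_isometry_def dist_norm)
  then have "linear ?g" and "orthogonal_matrix (linear_part f)"
    by (auto simp: orthogonal_transformation_matrix linear_part_def)
  have eq: "?g x = linear_part f *v x" for x
    unfolding linear_part_def by (rule fun_cong[OF matrix_vector_mul(2)[OF \<open>linear ?g\<close>], symmetric])
  have "f = motion (linear_part f) (f 0)"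
    by (rule ext) (simp add: motion_def flip: eq)
  moreover have "rotation_matrix (linear_part f)"
    using f \<open>orthogonal_matrix (linear_part f)\<close>
    by (simp add: orientation_preserving_isometry_def rotation_matrix_def)
  ultimately show "\<exists>A v. rotation_matrix A \<and> f = motion A v" by blast
next
  assume "\<exists>A v. rotation_matrix A \<and> f = motion A v"
  then show "orientation_preserving_isometry f"
    by (auto simp: orientation_preserving_isometry_def dist_motion linear_part_motion rotation_matrix_def)
qed

section \<open>The action on tilings and elementary facts about tiles\<close>

lemma act_comp: "act f (act g T) = act (f \<circ> g) T"
  unfolding act_def image_image prod.map_comp
  by (intro image_cong refl) (auto simp: map_prod_def image_image)

lemma act_id [simp]: "act id T = T"
  by (auto simp: act_def map_prod_def)

lemma act_mono: "P \<subseteq> Q \<Longrightarrow> act f P \<subseteq> act f Q"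
  unfolding act_def by blast

context
  fixes T :: "('n::finite, 'l) tiling"
  assumes T: "tiling T"
begin

lemma tile_polyhedral: "t \<in> T \<Longrightarrow> polyhedral_body (fst t)"
  using T unfolding tiling_def by (elim conjE) (rule bspec)

lemma tile_meet:
  "t \<in> T \<Longrightarrow> u \<in> T \<Longrightarrow> t \<noteq> u \<Longrightarrow> fst t \<inter> fst u \<subseteq> frontier (fst t) \<inter> frontier (fst u) \<and>
    (\<exists>\<F>. (\<forall>F\<in>\<F>. is_face F (fst t) \<and> is_face F (fst u)) \<and> fst t \<inter> fst u = \<Union>\<F>)"
  using T unfolding tiling_def by (elim conjE) simp

lemma tile_prototiles: "\<exists>\<P>. finite \<P> \<and> (\<forall>t\<in>T. \<exists>u\<in>\<P>. \<exists>x. t = map_prod (image ((+) x)) id u)"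
  using T unfolding tiling_def by (elim conjE)

lemma tiling_cover: "\<exists>t\<in>T. x \<in> fst t"
proof -
  have "(\<Union>t\<in>T. fst t) = UNIV" using T unfolding tiling_def by (elim conjE)
  then show ?thesis by blast
qed

lemma tile_compact:
  assumes "t \<in> T"
  shows "compact (fst t)"
proof -
  obtain \<C> where "finite \<C>" "\<forall>C\<in>\<C>. polytope C" "fst t = \<Union>\<C>"
    using tile_polyhedral[OF assms] unfolding polyhedral_body_def by blast
  then show ?thesis using polytope_imp_compact by (metis compact_Union)
qed

text \<open>A polytope of full affine dimension has relative interior equal to its interior, and the
  relative interior of a nonempty convex set is nonempty.\<close>

lemma tile_ball:
  assumes "t \<in> T"
  shows "\<exists>c r. r > 0 \<and> ball c r \<subseteq> fst t"
proof -
  obtain \<C> C where C: "C \<in> \<C>" "polytope C" "aff_dim C = int DIM(real ^ 'n)" "fst t = \<Union>\<C>"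
    using tile_polyhedral[OF assms] unfolding polyhedral_body_def by blast
  have "C \<noteq> {}" using C(3) by auto
  then have "rel_interior C \<noteq> {}"
    using rel_interior_eq_empty[OF polytope_imp_convex[OF C(2)]] by simp
  then have "interior C \<noteq> {}" using interior_rel_interior[OF C(3)] by simp
  then obtain c r where "r > 0" "ball c r \<subseteq> C"
    using mem_interior[of _ C] by auto
  then show ?thesis using C(1,4) by blast
qed

text \<open>Distinct tiles meet only in their frontiers. This is the device by which overlap is
  turned into equality throughout.\<close>

lemma tile_unique:
  assumes "t \<in> T" "u \<in> T" "x \<in> interior (fst t)" "x \<in> fst u"
  shows "t = u"
proof (rule ccontr)
  assume "t \<noteq> u"
  then have "fst t \<inter> fst u \<subseteq> frontier (fst t)"
    using tile_meet[OF assms(1,2)] by simp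
  moreover have "x \<in> fst t" using assms(3) interior_subset by blast
  ultimately show False using assms(3,4) unfolding frontier_def by blast
qed

lemma tiling_nonempty: "T \<noteq> {}"
  using tiling_cover by blast

text \<open>Interiors of tiles are nonempty, open and pairwise disjoint. Countability allows a
  tiling to be exhausted by an increasing sequence of finite patches.\<close>

lemma countable_tiling: "countable T"
proof -
  let ?f = "\<lambda>t. interior (fst t)"
  have inter: "\<exists>c. c \<in> interior (fst t)" if "t \<in> T" for t
    using tile_ball[OF that] by (meson centre_in_ball mem_interior)
  have *: "t = u" if "t \<in> T" "u \<in> T" "x \<in> ?f t" "x \<in> ?f u" for t u x
    using tile_unique[OF that(1,2,3)] that(4) interior_subset by blast
  have "countable (?f ` T)"
    by (rule countable_disjoint_open_subsets) (auto simp: pairwise_def disjnt_def dest: *)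
  moreover have "inj_on ?f T"
  proof (rule inj_onI)
    fix t u assume tu: "t \<in> T" "u \<in> T" "?f t = ?f u"
    obtain c where "c \<in> ?f t" using inter[OF tu(1)] by blast
    then show "t = u" using * tu by metis
  qed
  ultimately show ?thesis using countable_image_inj_on by blast
qed

end

text \<open>An interior point of a tile of \<open>T\<close> is covered by some tile of
  \<open>T'\<close>, which also belongs to \<open>T\<close> and hence is that same tile. Limit
  arguments provide inclusions only; this upgrades them.\<close>

lemma tiling_subset_eq:
  assumes T: "tiling T" and T': "tiling T'" and sub: "T' \<subseteq> T"
  shows "T' = T"
proof
  show "T \<subseteq> T'"
  proof
    fix t assume t: "t \<in> T"
    obtain c r where cr: "r > 0" "ball c r \<subseteq> fst t" using tile_ball[OF T t] by blast
    obtain u where u: "u \<in> T'" "c \<in> fst u" using tiling_cover[OF T'] by blast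
    have "c \<in> interior (fst t)" using cr by (meson mem_interior)
    then have "t = u" using tile_unique[OF T t] sub u by blast
    then show "t \<in> T'" using u by simp
  qed
qed (rule sub)

section \<open>Rigid motions preserve tilings\<close>

context
  fixes A :: "real ^ 'n::finite ^ 'n" and v :: "real ^ 'n"
  assumes A: "rotation_matrix A"
begin

lemma bij_motion: "bij (motion A v)"
  using motion_inverse[OF A, of v] by (metis o_bij)

lemma motion_image: "motion A v ` S = (+) v ` ((*v) A ` S)"
  by (auto simp: motion_def image_image add.commute)

lemma linear_rotation: "linear ((*v) A)" "inj ((*v) A)"
  using rotation_matrix_cancel(1)[OF A] by (auto intro: inj_on_inverseI)

lemma frontier_motion: "frontier (motion A v ` S) = motion A v ` frontier S"
  unfolding motion_image frontier_translation
  unfolding frontier_def interior_injective_linear_image[OF linear_rotation]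
    closure_injective_linear_image[OF linear_rotation, symmetric]
  by (simp add: image_set_diff[OF linear_rotation(2)])

lemma closure_motion: "closure (motion A v ` S) = motion A v ` closure S"
  unfolding motion_image closure_translation
    closure_injective_linear_image[OF linear_rotation, symmetric] ..

lemma polyhedral_body_motion:
  assumes "polyhedral_body P"
  shows "polyhedral_body (motion A v ` P)"
proof -
  obtain \<C> where \<C>: "finite \<C>" "\<C> \<noteq> {}" "\<forall>C\<in>\<C>. polytope C \<and> aff_dim C = int DIM(real ^ 'n)" "P = \<Union>\<C>"
    using assms unfolding polyhedral_body_def by blast
  have "polytope (motion A v ` C) \<and> aff_dim (motion A v ` C) = int DIM(real ^ 'n)" if "C \<in> \<C>" for C
    unfolding motion_image
    using \<C>(3) that linear_rotation
    by (simp add: polytope_translation_eq polytope_linear_image aff_dim_translation_eq)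
  then show ?thesis
    unfolding polyhedral_body_def using \<C>(1,2,4)
    by (intro exI[of _ "(`) (motion A v) ` \<C>"]) auto
qed

lemma continuous_on_motion: "continuous_on S (motion A v)"
  unfolding motion_def by (intro continuous_intros linear_continuous_on) simp

lemma motion_in_image_iff: "motion A v x \<in> motion A v ` S \<longleftrightarrow> x \<in> S"
  using bij_motion by (simp add: bij_is_inj inj_image_mem_iff)

text \<open>A displacement \<open>w\<close> after the motion corresponds to the displacement
  \<open>transpose A *v w\<close> before it. Both have the same norm, so the radius of the germ is
  unchanged.\<close>

lemma same_germ_motion:
  "same_germ (motion A v ` P) (motion A v x) (motion A v y) \<longleftrightarrow> same_germ P x y"
proof -
  have shift: "motion A v z + w \<in> motion A v ` P \<longleftrightarrow> z + transpose A *v w \<in> P" for z w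
  proof -
    have "motion A v z + w = motion A v (z + transpose A *v w)"
      by (simp add: motion_def matrix_vector_right_distrib rotation_matrix_cancel[OF A])
    then show ?thesis by (simp add: motion_in_image_iff)
  qed
  have "(\<forall>w. norm w < r \<longrightarrow> R (transpose A *v w)) \<longleftrightarrow> (\<forall>w. norm w < r \<longrightarrow> R w)"
    for r and R :: "real ^ 'n \<Rightarrow> bool"
  proof (intro iffI allI impI)
    fix w :: "real ^ 'n" assume "\<forall>w. norm w < r \<longrightarrow> R (transpose A *v w)" "norm w < r"
    from spec[OF this(1), of "A *v w"] this(2) show "R w"
      by (simp add: norm_rotation[OF A] rotation_matrix_cancel[OF A])
  next
    fix w :: "real ^ 'n" assume "\<forall>w. norm w < r \<longrightarrow> R w" "norm w < r"
    from spec[OF this(1), of "transpose A *v w"] this(2) show "R (transpose A *v w)"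
      by (simp add: norm_rotation[OF rotation_matrix_transpose[OF A]])
  qed
  from this[of _ "\<lambda>w. x + w \<in> P \<longleftrightarrow> y + w \<in> P"]
  show ?thesis unfolding same_germ_def shift by simp
qed

text \<open>A motion is a homeomorphism carrying strata of constant germ to such strata, hence
  components to components and closures to closures.\<close>

lemma is_face_motion:
  assumes "is_face F P"
  shows "is_face (motion A v ` F) (motion A v ` P)"
proof -
  obtain x where x: "x \<in> P" "F = closure (connected_component_set {y \<in> P. same_germ P x y} x)"
    using assms unfolding is_face_def by blast
  let ?m = "motion A v" and ?n = "motion (transpose A) (- (transpose A *v v))"
  have inv: "?n (?m y) = y" "?m (?n y) = y" for y
    using motion_inverse[OF A, of v] by (simp_all add: fun_eq_iff)
  let ?S = "{y \<in> P. same_germ P x y}" and ?S' = "{y \<in> ?m ` P. same_germ (?m ` P) (?m x) y}"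
  have S': "?S' = ?m ` ?S" using same_germ_motion by auto
  have "continuous_on UNIV ?n"
    unfolding motion_def by (intro continuous_intros linear_continuous_on) simp
  then have "homeomorphism ?S ?S' ?m ?n"
    unfolding homeomorphism_def S' using inv continuous_on_motion
    by (auto simp: image_image intro: continuous_on_subset)
  moreover have "x \<in> ?S" using x(1) unfolding same_germ_def by (auto intro: exI[of _ 1])
  ultimately have "connected_component_set ?S' (?m x) = ?m ` connected_component_set ?S x"
    by (rule connected_component_set_homeomorphism)
  then show ?thesis
    unfolding is_face_def using x by (intro bexI[of _ "?m x"]) (simp_all add: closure_motion)
qed

lemma tiling_motion:
  assumes T: "tiling T"
  shows "tiling (act (motion A v) T)"
proof -
  let ?m = "motion A v"
  have inj: "inj ?m" using bij_motion by (rule bij_is_inj)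
  have "polyhedral_body (fst t)" if "t \<in> act ?m T" for t
    using that tile_polyhedral[OF T] polyhedral_body_motion by (auto simp: act_def)
  moreover have "(\<Union>t\<in>act ?m T. fst t) = UNIV"
  proof -
    have "(\<Union>t\<in>act ?m T. fst t) = ?m ` (\<Union>t\<in>T. fst t)" by (auto simp: act_def)
    also have "(\<Union>t\<in>T. fst t) = UNIV" using tiling_cover[OF T] by blast
    finally show ?thesis using bij_motion by (simp add: bij_is_surj)
  qed
  moreover have "fst t' \<inter> fst u' \<subseteq> frontier (fst t') \<inter> frontier (fst u') \<and>
      (\<exists>\<F>. (\<forall>F\<in>\<F>. is_face F (fst t') \<and> is_face F (fst u')) \<and> fst t' \<inter> fst u' = \<Union>\<F>)"
    if tu': "t' \<in> act ?m T" "u' \<in> act ?m T" "t' \<noteq> u'" for t' u'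
  proof -
    obtain t where t: "t' = map_prod ((`) ?m) id t" "t \<in> T"
      using tu'(1) unfolding act_def by (rule imageE)
    obtain u where u: "u' = map_prod ((`) ?m) id u" "u \<in> T"
      using tu'(2) unfolding act_def by (rule imageE)
    note tu = t(2) u(2) t(1) u(1)
    have "t \<noteq> u" using tu'(3) tu by blast
    from tile_meet[OF T tu(1,2) this]
    obtain \<F> where fr: "fst t \<inter> fst u \<subseteq> frontier (fst t) \<inter> frontier (fst u)" and \<F>: "\<forall>F\<in>\<F>. is_face F (fst t) \<and> is_face F (fst u)" "fst t \<inter> fst u = \<Union>\<F>"
      by (elim conjE exE)
    have f: "fst t' = ?m ` fst t" "fst u' = ?m ` fst u" using tu by auto
    have int: "fst t' \<inter> fst u' = ?m ` (fst t \<inter> fst u)" unfolding f using inj by (simp add: image_Int)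
    have "?m ` (fst t \<inter> fst u) \<subseteq> frontier (fst t') \<inter> frontier (fst u')"
      unfolding f frontier_motion using fr by blast
    moreover have "\<forall>F\<in>(`) ?m ` \<F>. is_face F (fst t') \<and> is_face F (fst u')"
      unfolding f using \<F>(1) is_face_motion by blast
    moreover have "?m ` (fst t \<inter> fst u) = \<Union> ((`) ?m ` \<F>)" unfolding \<F>(2) by blast
    ultimately show ?thesis unfolding int by blast
  qed
  moreover have "\<exists>\<P>. finite \<P> \<and> (\<forall>t\<in>act ?m T. \<exists>u\<in>\<P>. \<exists>x. t = map_prod (image ((+) x)) id u)"
  proof -
    obtain \<P> where \<P>: "finite \<P>" "\<forall>t\<in>T. \<exists>u\<in>\<P>. \<exists>x. t = map_prod (image ((+) x)) id u"
      using tile_prototiles[OF T] by (elim exE conjE)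
    have "\<exists>u\<in>map_prod ((`) ?m) id ` \<P>. \<exists>x. t' = map_prod (image ((+) x)) id u" if "t' \<in> act ?m T" for t'
    proof -
      obtain t where t: "t' = map_prod ((`) ?m) id t" "t \<in> T"
        using \<open>t' \<in> act ?m T\<close> unfolding act_def by (rule imageE)
      obtain u x where u: "u \<in> \<P>" "t = map_prod (image ((+) x)) id u" using \<P>(2) t(2) by blast
      \<comment> \<open>Moving a translate by \<open>x\<close> of a prototile gives the translate by
        \<open>A *v x\<close> of the moved prototile, so the moved prototiles again form a finite
        set.\<close>
      have "?m (x + y) = A *v x + ?m y" for y
        by (simp add: motion_def matrix_vector_right_distrib)
      then have "t' = map_prod (image ((+) (A *v x))) id (map_prod ((`) ?m) id u)"
        unfolding t(1) u(2) by (cases u) (simp add: image_image)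
      then show ?thesis using u(1) by blast
    qed
    then show ?thesis using \<P>(1) by blast
  qed
  ultimately show ?thesis unfolding tiling_def by (intro conjI ballI impI) simp_all
qed

end

section \<open>Hulls of periodic tilings\<close>

lemma tendsto_motion:
  assumes "(f \<longlongrightarrow> A) F" "(g \<longlongrightarrow> v) F" "(h \<longlongrightarrow> x) F"
  shows "((\<lambda>k. motion (f k) (g k) (h k)) \<longlongrightarrow> motion A v x) F"
  unfolding motion_def by (intro tendsto_intros assms)

lemma rotation_matrix_limit:
  assumes "\<And>k. rotation_matrix (A k :: real ^ 'n::finite ^ 'n)" "A \<longlonglongrightarrow> A'"
  shows "rotation_matrix A'"
proof -
  have "closed {A :: real ^ 'n ^ 'n. rotation_matrix A}"
    by (rule compact_imp_closed[OF compact_rotations])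
  from closed_sequentially[OF this, of A A'] assms show ?thesis by simp
qed

text \<open>A convergent sequence of copies of one tile inside a tiling is eventually constant, since
  sufficiently late copies have overlapping interiors.\<close>

lemma tile_limit:
  fixes T :: "('n::finite, 'l) tiling"
  assumes T: "tiling T" and t: "compact (fst t)" "ball c r \<subseteq> fst t" "r > 0"
    and rot: "\<And>k. rotation_matrix (A k)" and A: "A \<longlonglongrightarrow> A'" and v: "v \<longlonglongrightarrow> v'"
    and ev: "\<forall>\<^sub>F k in sequentially. map_prod ((`) (motion (A k) (v k))) id t \<in> T"
  shows "map_prod ((`) (motion A' v')) id t \<in> T"
proof -
  let ?m = "\<lambda>k. motion (A k) (v k)" and ?m' = "motion A' v'"
  have rot': "rotation_matrix A'" using rotation_matrix_limit[OF rot A] .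
  have lim: "(\<lambda>k. ?m k x) \<longlonglongrightarrow> ?m' x" for x
    by (intro tendsto_motion A v tendsto_const)
  have "Cauchy (\<lambda>k. ?m k c)" using lim LIMSEQ_imp_Cauchy by blast
  then obtain N1 where N1: "\<forall>k\<ge>N1. \<forall>l\<ge>N1. dist (?m k c) (?m l c) < r"
    using t(3) unfolding Cauchy_def by blast
  obtain N2 where N2: "\<forall>k\<ge>N2. map_prod ((`) (?m k)) id t \<in> T"
    using ev unfolding eventually_sequentially by (elim exE)
  define N where "N = max N1 N2"
  define u where "u = map_prod ((`) (?m N)) id t"
  have u: "u \<in> T" unfolding u_def N_def using N2 by simp
  have ball_sub: "ball (?m N c) r \<subseteq> fst u"
  proof
    fix y assume y: "y \<in> ball (?m N c) r"
    define x where "x = motion (transpose (A N)) (- (transpose (A N) *v v N)) y"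
    have xy: "?m N x = y"
      unfolding x_def using fun_cong[OF motion_inverse(1)[OF rot]] by (simp add: o_def)
    have "dist c x < r" using y dist_motion[OF rot, of N "v N" c x] by (simp add: xy)
    then have "x \<in> fst t" using t(2) by auto
    then show "y \<in> fst u" using xy unfolding u_def by auto
  qed
  have const: "map_prod ((`) (?m k)) id t = u" if k: "k \<ge> N" for k
  proof (rule tile_unique[OF T u, symmetric])
    show "map_prod ((`) (?m k)) id t \<in> T" using k N2 by (simp add: N_def)
    have "?m k c \<in> ball (?m N c) r" using N1 k by (simp add: N_def)
    then show "?m k c \<in> interior (fst u)"
      using ball_sub interior_maximal[OF _ open_ball] by blast
    have "c \<in> fst t" using t(2,3) by auto
    then show "?m k c \<in> fst (map_prod ((`) (?m k)) id t)" by simp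
  qed
  have closed_u: "closed (fst u)"
    using tile_compact[OF T u] by (rule compact_imp_closed)
  have "?m' ` fst t = fst u"
  proof
    show "?m' ` fst t \<subseteq> fst u"
    proof
      fix y assume "y \<in> ?m' ` fst t"
      then obtain x where x: "x \<in> fst t" "y = ?m' x" by blast
      have "?m (k + N) x \<in> fst u" for k
        using const[of "k + N"] x(1) by (metis fst_map_prod imageI le_add2)
      from closed_sequentially[OF closed_u this LIMSEQ_ignore_initial_segment[OF lim]]
      show "y \<in> fst u" using x(2) by simp
    qed
    \<comment> \<open>Points of \<open>fst u\<close> are pulled back by the inverse motions, which
      converge too; closedness of \<open>fst t\<close> puts the limit of the preimages in
      \<open>fst t\<close>.\<close>
    show "fst u \<subseteq> ?m' ` fst t"
    proof
      fix y assume y: "y \<in> fst u"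
      define x where "x k = motion (transpose (A k)) (- (transpose (A k) *v v k)) y" for k
      define x' where "x' = motion (transpose A') (- (transpose A' *v v')) y"
      have xy: "?m k (x k) = y" for k
        unfolding x_def using fun_cong[OF motion_inverse(1)[OF rot]] by (simp add: o_def)
      have xy': "?m' x' = y"
        unfolding x'_def using fun_cong[OF motion_inverse(1)[OF rot']] by (simp add: o_def)
      have "x (k + N) \<in> fst t" for k
      proof -
        have "?m (k + N) (x (k + N)) \<in> ?m (k + N) ` fst t"
          using y const[of "k + N"] unfolding xy by (metis fst_map_prod le_add2)
        then show ?thesis using motion_in_image_iff[OF rot] by blast
      qed
      moreover have "x \<longlonglongrightarrow> x'"
        unfolding x_def x'_def by (intro tendsto_motion tendsto_intros A v)
      ultimately have "x' \<in> fst t"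
        using closed_sequentially[OF compact_imp_closed[OF t(1)], of "\<lambda>k. x (k + N)"]
          LIMSEQ_ignore_initial_segment by blast
      then show "y \<in> ?m' ` fst t" using xy' by blast
    qed
  qed
  moreover have "snd u = snd t" unfolding u_def by simp
  ultimately have "map_prod ((`) ?m') id t = u" by (simp add: prod_eq_iff)
  then show ?thesis using u by simp
qed

section \<open>Periods and hulls as orbits of rigid motions\<close>

lemma translation_period_neg:
  assumes "act ((+) l) T = T"
  shows "act ((+) (- l)) T = T"
proof -
  have "act ((+) (- l)) (act ((+) l) T) = T"
    unfolding act_comp by (simp add: o_def flip: id_def)
  then show ?thesis by (simp add: assms)
qed

text \<open>The independent vectors are as many as the dimension, hence span. Single basis vectors
  are periods because 0 and 1 are admissible integer coefficients.\<close>

lemma periodic_basis: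
  fixes T :: "('n::finite, 'l) tiling"
  assumes "periodic T"
  obtains b :: "'n \<Rightarrow> real ^ 'n" where "\<And>i. act ((+) (b i)) T = T"
    "\<And>v. \<exists>c. v = (\<Sum>i\<in>UNIV. c i *\<^sub>R b i)"
    "\<And>k :: 'n \<Rightarrow> int. act ((+) (\<Sum>i\<in>UNIV. of_int (k i) *\<^sub>R b i)) T = T"
proof -
  obtain b :: "'n \<Rightarrow> real ^ 'n" where b: "inj b" "independent (range b)"
    "carrier (translation_group T) = {(\<Sum>i\<in>UNIV. of_int (k i) *\<^sub>R b i) | k :: 'n \<Rightarrow> int. True}"
    using assms unfolding periodic_def by (elim exE conjE)
  have L: "act ((+) (\<Sum>i\<in>UNIV. of_int (k i) *\<^sub>R b i)) T = T" for k :: "'n \<Rightarrow> int"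
  proof -
    have "(\<Sum>i\<in>UNIV. of_int (k i) *\<^sub>R b i) \<in> carrier (translation_group T)"
      unfolding b(3) by blast
    then show ?thesis by (simp add: translation_group_def)
  qed
  have "act ((+) (b i)) T = T" for i
  proof -
    have "b i = (\<Sum>j\<in>UNIV. of_int (if j = i then 1 else 0) *\<^sub>R b j)"
      by (simp add: if_distrib[of real_of_int] if_distrib[of "\<lambda>x. x *\<^sub>R _"] cong: if_cong)
    then show ?thesis using L[of "\<lambda>j. if j = i then 1 else 0"] by simp
  qed
  moreover have "\<exists>c. v = (\<Sum>i\<in>UNIV. c i *\<^sub>R b i)" for v
  proof -
    have "UNIV \<subseteq> span (range b)"
      by (rule card_ge_dim_independent[OF _ b(2)]) (simp_all add: card_image[OF b(1)])
    then have "v \<in> span (range b)" by blast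
    moreover have "finite (range b)" by simp
    ultimately obtain u where "v = (\<Sum>w\<in>range b. u w *\<^sub>R w)"
      unfolding span_finite[OF \<open>finite (range b)\<close>] by blast
    also have "\<dots> = (\<Sum>i\<in>UNIV. u (b i) *\<^sub>R b i)"
      using b(1) by (simp add: sum.reindex)
    finally show ?thesis by (rule exI[of _ "\<lambda>i. u (b i)"])
  qed
  ultimately show ?thesis using L that by blast
qed

text \<open>Subtracting the integer parts of the coordinates moves any vector into the fundamental
  parallelepiped, whose size is bounded by the sum of the norms of the basis vectors. It lets
  translation parts be chosen in a compact ball.\<close>

lemma periodic_cobounded:
  fixes T :: "('n::finite, 'l) tiling"
  assumes "periodic T"
  shows "\<exists>R. \<forall>v. \<exists>l. act ((+) l) T = T \<and> norm (v + l) \<le> R"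
proof -
  obtain b :: "'n \<Rightarrow> real ^ 'n" where b: "\<And>i. act ((+) (b i)) T = T"
    "\<And>v. \<exists>c. v = (\<Sum>i\<in>UNIV. c i *\<^sub>R b i)"
    "\<And>k :: 'n \<Rightarrow> int. act ((+) (\<Sum>i\<in>UNIV. of_int (k i) *\<^sub>R b i)) T = T"
    using periodic_basis[OF assms] by metis
  have "\<exists>l. act ((+) l) T = T \<and> norm (v + l) \<le> (\<Sum>i\<in>UNIV. norm (b i))" for v
  proof -
    obtain c where c: "v = (\<Sum>i\<in>UNIV. c i *\<^sub>R b i)" using b(2) by blast
    define l where "l = - (\<Sum>i\<in>UNIV. of_int \<lfloor>c i\<rfloor> *\<^sub>R b i)"
    have "v + l = (\<Sum>i\<in>UNIV. (c i - of_int \<lfloor>c i\<rfloor>) *\<^sub>R b i)"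
      unfolding c l_def by (simp add: sum_subtractf scaleR_diff_left)
    also have "norm \<dots> \<le> (\<Sum>i\<in>UNIV. norm (b i))"
    proof (rule sum_norm_le)
      fix i
      have "norm ((c i - of_int \<lfloor>c i\<rfloor>) *\<^sub>R b i) \<le> 1 * norm (b i)"
        unfolding norm_scaleR by (intro mult_right_mono) (auto simp: abs_le_iff, linarith+)
      then show "norm ((c i - of_int \<lfloor>c i\<rfloor>) *\<^sub>R b i) \<le> norm (b i)" by simp
    qed
    finally have "norm (v + l) \<le> (\<Sum>i\<in>UNIV. norm (b i))" .
    moreover have "act ((+) l) T = T"
      unfolding l_def by (rule translation_period_neg[OF b(3)])
    ultimately show ?thesis by blast
  qed
  then show ?thesis by blast
qed

text \<open>The common parameter of the two hulls: \<open>K\<close> is the trivial group for the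
  translational hull and the group of all rotations for the rotational one. Compactness supplies
  convergent subsequences.\<close>

definition compact_rotation_group :: "(real ^ 'n::finite ^ 'n) set \<Rightarrow> bool" where
  "compact_rotation_group K \<longleftrightarrow> compact K \<and> mat 1 \<in> K \<and>
     (\<forall>A\<in>K. rotation_matrix A \<and> transpose A \<in> K) \<and> (\<forall>A\<in>K. \<forall>B\<in>K. A ** B \<in> K)"

definition motion_orbit :: "(real ^ 'n::finite ^ 'n) set \<Rightarrow> ('n, 'l) tiling \<Rightarrow> ('n, 'l) tiling set" where
  "motion_orbit K T = {act (motion A v) T | A v. A \<in> K}"

lemma compact_rotation_group_trivial: "compact_rotation_group {mat 1}"
  by (simp add: compact_rotation_group_def rotation_matrix_one)

lemma compact_rotation_group_all: "compact_rotation_group {A. rotation_matrix A}"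
  by (simp add: compact_rotation_group_def compact_rotations rotation_matrix_one
      rotation_matrix_transpose rotation_matrix_mult)

text \<open>A period applied before the motion is absorbed by \<open>T\<close>; after the motion it
  appears as \<open>A *v l\<close>.\<close>

lemma act_motion_period:
  assumes "act ((+) l) T = T"
  shows "act (motion A (v + A *v l)) T = act (motion A v) T"
proof -
  have "act (motion A v) (act ((+) l) T) = act (motion A (v + A *v l)) T"
    unfolding act_comp motion_one[of l, symmetric] motion_comp by (simp add: add.commute)
  then show ?thesis by (simp add: assms)
qed

lemma act_motion_inverse:
  assumes "rotation_matrix A"
  shows "act (motion (transpose A) (- (transpose A *v v))) (act (motion A v) T) = T"
    "act (motion A v) (act (motion (transpose A) (- (transpose A *v v))) T) = T"
  unfolding act_comp motion_inverse[OF assms] by simp_all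

context
  fixes K :: "(real ^ 'n::finite ^ 'n) set" and T :: "('n, 'l) tiling"
  assumes K: "compact_rotation_group K" and T: "tiling T" and per: "periodic T"
begin

lemma K_rotation: "A \<in> K \<Longrightarrow> rotation_matrix A"
  using K unfolding compact_rotation_group_def by simp

text \<open>Each patch of an exhaustion of \<open>T'\<close> is moved into \<open>T\<close> by some
  motion, normalised by a period of \<open>T\<close> to lie in a compact set. A limit of a
  subsequence moves every single tile of \<open>T'\<close> into \<open>T\<close>, because each tile
  belongs to all later patches; the inclusion of tilings is then an equality. Conversely, inverting
  the motion that produced \<open>T'\<close> returns every patch to \<open>T\<close>.\<close>

lemma hull_eq_motion_orbit:
  "{T'. tiling T' \<and> (\<forall>P. finite P \<and> P \<subseteq> T' \<longrightarrow> (\<exists>A\<in>K. \<exists>v. act (motion A v) P \<subseteq> T))} = motion_orbit K T"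
proof (intro equalityI subsetI)
  fix T' assume "T' \<in> {T'. tiling T' \<and> (\<forall>P. finite P \<and> P \<subseteq> T' \<longrightarrow> (\<exists>A\<in>K. \<exists>v. act (motion A v) P \<subseteq> T))}"
  then have T': "tiling T'" and patch: "\<And>P. finite P \<Longrightarrow> P \<subseteq> T' \<Longrightarrow> \<exists>A\<in>K. \<exists>v. act (motion A v) P \<subseteq> T"
    by simp_all
  obtain R where R: "\<forall>v. \<exists>l. act ((+) l) T = T \<and> norm (v + l) \<le> R"
    using periodic_cobounded[OF per] by (elim exE)
  obtain t :: "nat \<Rightarrow> _" where t: "range t = T'"
    using countable_tiling[OF T'] tiling_nonempty[OF T'] by (metis range_from_nat_into)
  have "\<exists>p. fst p \<in> K \<and> norm (snd p) \<le> R \<and> act (motion (fst p) (snd p)) (t ` {..k}) \<subseteq> T" for k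
  proof -
    have "t ` {..k} \<subseteq> T'" using t by blast
    from patch[OF _ this] obtain A v where A: "A \<in> K" "act (motion A v) (t ` {..k}) \<subseteq> T"
      by auto
    obtain l where l: "act ((+) l) T = T" "norm (v + l) \<le> R" using R by blast
    have "act (motion A (v + l)) (t ` {..k}) = act ((+) l) (act (motion A v) (t ` {..k}))"
      unfolding act_comp motion_one[of l, symmetric] motion_comp by simp
    also have "\<dots> \<subseteq> T" using act_mono[OF A(2), of "(+) l"] by (simp add: l(1))
    finally show ?thesis using A(1) l(2) by (intro exI[of _ "(A, v + l)"]) simp
  qed
  then have "\<forall>k. \<exists>p. fst p \<in> K \<and> norm (snd p) \<le> R \<and> act (motion (fst p) (snd p)) (t ` {..k}) \<subseteq> T"
    by (rule allI)
  from choice[OF this] obtain f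
    where f: "\<forall>k. fst (f k) \<in> K \<and> norm (snd (f k)) \<le> R \<and> act (motion (fst (f k)) (snd (f k))) (t ` {..k}) \<subseteq> T"
    by (elim exE)
  define A v where "A k = fst (f k)" and "v k = snd (f k)" for k
  have Av: "A k \<in> K" "norm (v k) \<le> R" "act (motion (A k) (v k)) (t ` {..k}) \<subseteq> T" for k
    using f by (auto simp: A_def v_def)
  have cpt: "compact (K \<times> cball (0 :: real ^ 'n) R)"
    using K by (intro compact_Times compact_cball) (simp add: compact_rotation_group_def)
  have "\<forall>k. (A k, v k) \<in> K \<times> cball 0 R" using Av(1,2) by simp
  then obtain p \<phi> where p: "p \<in> K \<times> cball 0 R" "strict_mono \<phi>" "((\<lambda>k. (A k, v k)) \<circ> \<phi>) \<longlonglongrightarrow> p"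
    by (rule seq_compactE[OF compact_imp_seq_compact[OF cpt]])
  obtain A' v' where p': "p = (A', v')" by (cases p)
  have A': "A' \<in> K" using p(1) p' by simp
  have lim: "(\<lambda>k. A (\<phi> k)) \<longlonglongrightarrow> A'" "(\<lambda>k. v (\<phi> k)) \<longlonglongrightarrow> v'"
    using tendsto_fst[OF p(3)] tendsto_snd[OF p(3)] unfolding p' by (simp_all add: o_def)
  have "act (motion A' v') T' \<subseteq> T"
  proof
    fix s assume "s \<in> act (motion A' v') T'"
    then obtain x where x: "s = map_prod ((`) (motion A' v')) id x" "x \<in> T'"
      unfolding act_def by (rule imageE)
    obtain i where "x = t i" using x(2) t by blast
    with x have i: "s = map_prod ((`) (motion A' v')) id (t i)" by simp
    have ti: "t i \<in> T'" using t by blast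
    obtain c r where cr: "r > 0" "ball c r \<subseteq> fst (t i)" using tile_ball[OF T' ti] by blast
    have "map_prod ((`) (motion (A (\<phi> k)) (v (\<phi> k)))) id (t i) \<in> T" if "k \<ge> i" for k
    proof -
      have "i \<le> \<phi> k" using that seq_suble[OF p(2), of k] by simp
      then have "t i \<in> t ` {..\<phi> k}" by blast
      then show ?thesis using Av(3)[of "\<phi> k"] unfolding act_def by blast
    qed
    then have "\<forall>\<^sub>F k in sequentially. map_prod ((`) (motion (A (\<phi> k)) (v (\<phi> k)))) id (t i) \<in> T"
      unfolding eventually_sequentially by blast
    from tile_limit[OF T tile_compact[OF T' ti] cr(2,1) _ lim this] show "s \<in> T"
      using K_rotation Av(1) unfolding i by blast
  qed
  from tiling_subset_eq[OF T tiling_motion[OF K_rotation[OF A'] T'] this]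
  have "act (motion (transpose A') (- (transpose A' *v v'))) T = T'"
    using act_motion_inverse(1)[OF K_rotation[OF A']] by metis
  moreover have "transpose A' \<in> K" using A' K unfolding compact_rotation_group_def by blast
  ultimately show "T' \<in> motion_orbit K T" unfolding motion_orbit_def by blast
next
  fix T' assume "T' \<in> motion_orbit K T"
  then obtain A v where A: "A \<in> K" "T' = act (motion A v) T" unfolding motion_orbit_def by blast
  have "\<exists>A\<in>K. \<exists>v. act (motion A v) P \<subseteq> T" if "P \<subseteq> T'" for P
  proof -
    have "act (motion (transpose A) (- (transpose A *v v))) P \<subseteq> T"
      using act_mono[OF that, of "motion (transpose A) (- (transpose A *v v))"]
      unfolding A(2) act_motion_inverse(1)[OF K_rotation[OF A(1)]] .
    moreover have "transpose A \<in> K" using A(1) K unfolding compact_rotation_group_def by blast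
    ultimately show ?thesis by blast
  qed
  then show "T' \<in> {T'. tiling T' \<and> (\<forall>P. finite P \<and> P \<subseteq> T' \<longrightarrow> (\<exists>A\<in>K. \<exists>v. act (motion A v) P \<subseteq> T))}"
    using tiling_motion[OF K_rotation[OF A(1)] T] A(2) by blast
qed

end

lemma translational_hull_eq:
  assumes "tiling T" "periodic T"
  shows "translational_hull T = motion_orbit {mat 1} T"
  using hull_eq_motion_orbit[OF compact_rotation_group_trivial assms]
  unfolding translational_hull_def by (simp add: motion_one)

lemma rotational_hull_eq:
  assumes "tiling T" "periodic T"
  shows "rotational_hull T = motion_orbit {A. rotation_matrix A} T"
proof -
  have "(\<exists>f. orientation_preserving_isometry f \<and> act f P \<subseteq> T) \<longleftrightarrow>
      (\<exists>A\<in>{A. rotation_matrix A}. \<exists>v. act (motion A v) P \<subseteq> T)" for P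
    unfolding orientation_preserving_isometry_iff by blast
  then show ?thesis
    using hull_eq_motion_orbit[OF compact_rotation_group_all assms]
    unfolding rotational_hull_def by simp
qed

text \<open>Both alternatives in \<open>close\<close> are reduced to one shape, a small motion that
  carries the tiles of \<open>T1\<close> near the origin into \<open>T2\<close>. The extra summand
  \<epsilon> pays for the displacement of \<open>c\<close>, which has to remain inside the ball of
  radius \<open>1 / \<epsilon>\<close>.\<close>

lemma close_tiles:
  assumes "close \<epsilon> T1 T2"
  shows "\<exists>q. rotation_matrix (fst q) \<and> norm (fst q - mat 1) < \<epsilon> \<and> norm (snd q) < \<epsilon> \<and>
    (\<forall>t\<in>T1. \<forall>c\<in>fst t. norm c + \<epsilon> < 1 / \<epsilon> \<longrightarrow> map_prod ((`) (motion (fst q) (snd q))) id t \<in> T2)"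
proof -
  obtain x A where xA: "norm x < \<epsilon>" "rotation_matrix A" "norm (A - mat 1) < \<epsilon>"
    and ag: "agree_on (ball 0 (1 / \<epsilon>)) (act (\<lambda>v. A *v (x + v)) T1) T2 \<or>
      agree_on (ball 0 (1 / \<epsilon>)) T1 (act (\<lambda>v. A *v (x + v)) T2)"
    using assms unfolding close_def by (elim exE conjE)
  have \<epsilon>: "\<epsilon> > 0" using xA(1) norm_ge_zero[of x] by linarith
  have m: "(\<lambda>v. A *v (x + v)) = motion A (A *v x)"
    by (simp add: motion_def fun_eq_iff matrix_vector_right_distrib)
  show ?thesis
    using ag unfolding m
  proof
    assume ag: "agree_on (ball 0 (1 / \<epsilon>)) (act (motion A (A *v x)) T1) T2"
    show ?thesis
    proof (intro exI[of _ "(A, A *v x)"] conjI ballI impI; unfold fst_conv snd_conv)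
      show "rotation_matrix A" "norm (A - mat 1) < \<epsilon>" by (rule xA)+
      show "norm (A *v x) < \<epsilon>" using xA(1) norm_rotation[OF xA(2)] by simp
      fix t c assume t: "t \<in> T1" "c \<in> fst t" "norm c + \<epsilon> < 1 / \<epsilon>"
      let ?s = "map_prod ((`) (motion A (A *v x))) id t"
      have "norm (motion A (A *v x) c) \<le> norm c + norm x"
        unfolding motion_def using norm_triangle_ineq[of "A *v c" "A *v x"]
        by (simp add: norm_rotation[OF xA(2)])
      then have "motion A (A *v x) c \<in> fst ?s \<inter> ball 0 (1 / \<epsilon>)"
        using t xA(1) by simp
      then have "?s \<in> {t \<in> act (motion A (A *v x)) T1. fst t \<inter> ball 0 (1 / \<epsilon>) \<noteq> {}}"
        using t(1) unfolding act_def by blast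
      then show "?s \<in> T2" using ag unfolding agree_on_def by blast
    qed
  next
    assume ag: "agree_on (ball 0 (1 / \<epsilon>)) T1 (act (motion A (A *v x)) T2)"
    \<comment> \<open>Here \<open>T2\<close> is the tiling being moved, so the inverse motion is
      used; its translation part is just \<open>- x\<close>.\<close>
    show ?thesis
    proof (intro exI[of _ "(transpose A, - (transpose A *v (A *v x)))"] conjI ballI impI; unfold fst_conv snd_conv)
      show "rotation_matrix (transpose A)" by (rule rotation_matrix_transpose[OF xA(2)])
      have "transpose A - mat 1 = transpose (A - mat 1)"
        by (simp add: transpose_minus)
      then show "norm (transpose A - mat 1) < \<epsilon>" using xA(3) by (metis norm_transpose)
      show "norm (- (transpose A *v (A *v x))) < \<epsilon>" using xA(1) rotation_matrix_cancel[OF xA(2)] by simp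
      fix t c assume t: "t \<in> T1" "c \<in> fst t" "norm c + \<epsilon> < 1 / \<epsilon>"
      let ?n = "motion (transpose A) (- (transpose A *v (A *v x)))"
      have "c \<in> ball 0 (1 / \<epsilon>)" using t(3) \<epsilon> by simp
      then have "t \<in> {t \<in> T1. fst t \<inter> ball 0 (1 / \<epsilon>) \<noteq> {}}" using t(1,2) by blast
      then have "t \<in> act (motion A (A *v x)) T2" using ag unfolding agree_on_def by blast
      then obtain s where s: "t = map_prod ((`) (motion A (A *v x))) id s" "s \<in> T2"
        unfolding act_def by (rule imageE)
      have "act ?n {t} = act (?n \<circ> motion A (A *v x)) {s}"
        unfolding act_comp[symmetric] s(1) by (simp add: act_def)
      then have "act ?n {t} = {s}"
        unfolding motion_inverse(2)[OF xA(2)] act_id .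
      then have "map_prod ((`) ?n) id t = s" by (simp add: act_def)
      then show "map_prod ((`) ?n) id t \<in> T2" using s(2) by simp
    qed
  qed
qed

text \<open>Nearby parameters give close tilings by continuity of the correcting motion, which
  settles one direction. In the other, a failure of openness at \<open>T'\<close> gives tilings
  outside \<open>U\<close> ever closer to \<open>T'\<close>; along a subsequence their parameters
  converge to a parameter \<open>p\<close> of \<open>T'\<close> itself, and openness of the
  parameter set around \<open>p\<close> is contradicted.\<close>

lemma openin_hull_topology_motion_orbit:
  fixes K :: "(real ^ 'n::finite ^ 'n) set" and T :: "('n, 'l) tiling"
  assumes K: "compact_rotation_group K" and T: "tiling T" and per: "periodic T"
  shows "openin (hull_topology (motion_orbit K T)) U \<longleftrightarrow> U \<subseteq> motion_orbit K T \<and>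
    openin (top_of_set (K \<times> UNIV)) {z \<in> K \<times> UNIV. act (motion (fst z) (snd z)) T \<in> U}"
proof -
  let ?\<Omega> = "motion_orbit K T"
  let ?W = "{z \<in> K \<times> UNIV. act (motion (fst z) (snd z)) T \<in> U}"
  have Krot: "rotation_matrix A" if "A \<in> K" for A using K_rotation[OF K T per that] .
  have "(\<forall>T'\<in>U. \<exists>\<epsilon>>0. \<forall>T''\<in>?\<Omega>. close \<epsilon> T' T'' \<longrightarrow> T'' \<in> U) \<longleftrightarrow> openin (top_of_set (K \<times> UNIV)) ?W"
    if U: "U \<subseteq> ?\<Omega>"
  proof
    assume op: "\<forall>T'\<in>U. \<exists>\<epsilon>>0. \<forall>T''\<in>?\<Omega>. close \<epsilon> T' T'' \<longrightarrow> T'' \<in> U"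
    show "openin (top_of_set (K \<times> UNIV)) ?W"
      unfolding openin_euclidean_subtopology_iff
    proof (intro conjI ballI)
      show "?W \<subseteq> K \<times> UNIV" by blast
      fix z assume z: "z \<in> ?W"
      define A v where "A = fst z" and "v = snd z"
      have A: "A \<in> K" and zU: "act (motion A v) T \<in> U" using z by (auto simp: A_def v_def)
      note rA = Krot[OF A]
      obtain \<epsilon> where \<epsilon>: "\<epsilon> > 0" "\<forall>T''\<in>?\<Omega>. close \<epsilon> (act (motion A v) T) T'' \<longrightarrow> T'' \<in> U"
        using bspec[OF op zU] by (elim exE conjE)
      \<comment> \<open>The correction from the parameters \<open>(A, v)\<close> to
        \<open>y\<close>: moving by \<open>x y\<close> and then rotating by \<open>B y\<close>,
        after \<open>motion A v\<close>, gives the motion of \<open>y\<close>. At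
        \<open>y = z\<close> it is the identity, and it depends continuously on
        \<open>y\<close>.\<close>
      define B where "B = (\<lambda>y :: (real ^ 'n ^ 'n) \<times> (real ^ 'n). fst y ** transpose A)"
      define x where "x = (\<lambda>y. transpose (B y) *v snd y - v)"
      have "(B \<longlongrightarrow> fst z ** transpose A) (at z)" "(x \<longlongrightarrow> transpose (fst z ** transpose A) *v snd z - v) (at z)"
        unfolding x_def B_def by (intro tendsto_intros)+
      then have lim: "(B \<longlongrightarrow> mat 1) (at z)" "(x \<longlongrightarrow> 0) (at z)"
        by (simp_all add: rotation_matrix_inverse[OF rA] flip: A_def v_def)
      have "\<forall>\<^sub>F y in at z. dist (B y) (mat 1) < \<epsilon> \<and> dist (x y) 0 < \<epsilon>"
        by (rule eventually_conj[OF tendstoD[OF lim(1) \<epsilon>(1)] tendstoD[OF lim(2) \<epsilon>(1)]])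
      then obtain d where d: "d > 0" "\<forall>y. y \<noteq> z \<and> dist y z < d \<longrightarrow> dist (B y) (mat 1) < \<epsilon> \<and> dist (x y) 0 < \<epsilon>"
        unfolding eventually_at by auto
      show "\<exists>e>0. \<forall>y\<in>K \<times> UNIV. dist y z < e \<longrightarrow> y \<in> ?W"
      proof (intro exI[of _ d] conjI ballI impI d(1))
        fix y assume y: "y \<in> K \<times> UNIV" "dist y z < d"
        show "y \<in> ?W"
        proof (cases "y = z")
          case False
          have yK: "fst y \<in> K" using y(1) by auto
          have rB: "rotation_matrix (B y)"
            unfolding B_def using Krot[OF yK] rA by (intro rotation_matrix_mult rotation_matrix_transpose)
          have "(\<lambda>u. B y *v (x y + u)) = motion (B y) (B y *v x y)"
            by (simp add: motion_def fun_eq_iff matrix_vector_right_distrib)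
          then have "(\<lambda>u. B y *v (x y + u)) \<circ> motion A v = motion (B y ** A) (B y *v v + B y *v x y)"
            by (simp add: motion_comp)
          also have "B y ** A = fst y"
            unfolding B_def matrix_mul_assoc[symmetric] rotation_matrix_inverse[OF rA] by simp
          also have "B y *v v + B y *v x y = snd y"
            unfolding x_def matrix_vector_mult_diff_distrib rotation_matrix_cancel[OF rB] by simp
          finally have "act (\<lambda>u. B y *v (x y + u)) (act (motion A v) T) = act (motion (fst y) (snd y)) T"
            unfolding act_comp by (rule arg_cong)
          moreover have "norm (x y) < \<epsilon>" "norm (B y - mat 1) < \<epsilon>"
            using spec[OF d(2), of y] y(2) False unfolding dist_norm diff_zero by blast+
          ultimately have "close \<epsilon> (act (motion A v) T) (act (motion (fst y) (snd y)) T)"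
            unfolding close_def agree_on_def using rB by (intro exI[of _ "x y"] exI[of _ "B y"]) simp
          moreover have "act (motion (fst y) (snd y)) T \<in> ?\<Omega>"
            unfolding motion_orbit_def using yK by blast
          ultimately show ?thesis using \<epsilon>(2) y(1) by blast
        qed (use z in simp)
      qed
    qed
  next
    assume W: "openin (top_of_set (K \<times> UNIV)) ?W"
    show "\<forall>T'\<in>U. \<exists>\<epsilon>>0. \<forall>T''\<in>?\<Omega>. close \<epsilon> T' T'' \<longrightarrow> T'' \<in> U"
    proof (rule ballI, rule ccontr)
      fix T' assume T'U: "T' \<in> U" and "\<not> (\<exists>\<epsilon>>0. \<forall>T''\<in>?\<Omega>. close \<epsilon> T' T'' \<longrightarrow> T'' \<in> U)"
      then have no: "\<exists>T''\<in>?\<Omega>. close \<epsilon> T' T'' \<and> T'' \<notin> U" if "\<epsilon> > 0" for \<epsilon>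
        using that by blast
      obtain A0 v0 where A0: "A0 \<in> K" "T' = act (motion A0 v0) T"
        using T'U U unfolding motion_orbit_def by blast
      have T': "tiling T'" unfolding A0(2) by (rule tiling_motion[OF Krot[OF A0(1)] T])
      obtain R where R: "\<forall>v. \<exists>l. act ((+) l) T = T \<and> norm (v + l) \<le> R"
        using periodic_cobounded[OF per] by (elim exE)
      \<comment> \<open>With this choice the radius of agreement \<open>1 / \<epsilon> k\<close> is
        \<open>Suc k\<close>, hence unbounded, while the permitted distortion tends to zero.\<close>
      define \<epsilon> where "\<epsilon> k = 1 / real (Suc k)" for k
      have \<epsilon>0: "\<epsilon> k > 0" for k by (simp add: \<epsilon>_def)
      have "\<exists>p. fst p \<in> K \<and> norm (snd p) \<le> R \<and> close (\<epsilon> k) T' (act (motion (fst p) (snd p)) T) \<and>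
          act (motion (fst p) (snd p)) T \<notin> U" for k
      proof -
        obtain A v where Av: "A \<in> K" "close (\<epsilon> k) T' (act (motion A v) T)" "act (motion A v) T \<notin> U"
          using no[OF \<epsilon>0[of k]] unfolding motion_orbit_def by blast
        obtain l where l: "act ((+) l) T = T" "norm (transpose A *v v + l) \<le> R" using R by blast
        \<comment> \<open>The period acts before the rotation, so the bound \<open>R\<close> is
          invoked for \<open>transpose A *v v\<close>; rotating back preserves norms.\<close>
        have "v + A *v l = A *v (transpose A *v v + l)"
          by (simp add: matrix_vector_right_distrib rotation_matrix_cancel[OF Krot[OF Av(1)]])
        then have "norm (v + A *v l) \<le> R" using l(2) norm_rotation[OF Krot[OF Av(1)]] by simp
        then show ?thesis
          using Av act_motion_period[OF l(1), of A v] by (intro exI[of _ "(A, v + A *v l)"]) simp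
      qed
      then have "\<forall>k. \<exists>p. fst p \<in> K \<and> norm (snd p) \<le> R \<and> close (\<epsilon> k) T' (act (motion (fst p) (snd p)) T) \<and>
          act (motion (fst p) (snd p)) T \<notin> U" by (rule allI)
      from choice[OF this] obtain f where f: "\<forall>k. fst (f k) \<in> K \<and> norm (snd (f k)) \<le> R \<and>
          close (\<epsilon> k) T' (act (motion (fst (f k)) (snd (f k))) T) \<and>
          act (motion (fst (f k)) (snd (f k))) T \<notin> U"
        by (elim exE)
      have cpt: "compact (K \<times> cball (0 :: real ^ 'n) R)"
        using K by (intro compact_Times compact_cball) (simp add: compact_rotation_group_def)
      have "\<forall>k. f k \<in> K \<times> cball 0 R" using f by (simp add: mem_Times_iff)
      then obtain p \<phi> where p: "p \<in> K \<times> cball 0 R" "strict_mono \<phi>" "(f \<circ> \<phi>) \<longlonglongrightarrow> p"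
        by (rule seq_compactE[OF compact_imp_seq_compact[OF cpt]])
      define A v where "A k = fst (f (\<phi> k))" and "v k = snd (f (\<phi> k))" for k
      have AK: "A k \<in> K" for k using f by (simp add: A_def)
      obtain A' v' where p': "p = (A', v')" by (cases p)
      have A': "A' \<in> K" using p(1) p' by simp
      have lim: "A \<longlonglongrightarrow> A'" "v \<longlonglongrightarrow> v'"
        using tendsto_fst[OF p(3)] tendsto_snd[OF p(3)] unfolding p' A_def v_def by (simp_all add: o_def)
      have "\<epsilon> \<longlonglongrightarrow> 0"
      proof -
        have "\<epsilon> = (\<lambda>n. inverse (real (Suc n)))" by (simp add: fun_eq_iff \<epsilon>_def inverse_eq_divide)
        then show ?thesis using LIMSEQ_inverse_real_of_nat by (simp only:)
      qed
      from LIMSEQ_subseq_LIMSEQ[OF this p(2)] have \<epsilon>\<phi>: "(\<lambda>k. \<epsilon> (\<phi> k)) \<longlonglongrightarrow> 0"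
        by (simp add: o_def)
      have "\<exists>q. rotation_matrix (fst q) \<and> norm (fst q - mat 1) < \<epsilon> (\<phi> k) \<and> norm (snd q) < \<epsilon> (\<phi> k) \<and>
          (\<forall>t\<in>T'. \<forall>c\<in>fst t. norm c + \<epsilon> (\<phi> k) < 1 / \<epsilon> (\<phi> k) \<longrightarrow>
            map_prod ((`) (motion (fst q) (snd q))) id t \<in> act (motion (A k) (v k)) T)" for k
      proof -
        have "close (\<epsilon> (\<phi> k)) T' (act (motion (A k) (v k)) T)" using f by (simp add: A_def v_def)
        from close_tiles[OF this] show ?thesis .
      qed
      then have "\<forall>k. \<exists>q. rotation_matrix (fst q) \<and> norm (fst q - mat 1) < \<epsilon> (\<phi> k) \<and> norm (snd q) < \<epsilon> (\<phi> k) \<and>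
          (\<forall>t\<in>T'. \<forall>c\<in>fst t. norm c + \<epsilon> (\<phi> k) < 1 / \<epsilon> (\<phi> k) \<longrightarrow>
            map_prod ((`) (motion (fst q) (snd q))) id t \<in> act (motion (A k) (v k)) T)" by (rule allI)
      from choice[OF this] obtain g where
        g: "\<forall>k. rotation_matrix (fst (g k)) \<and> norm (fst (g k) - mat 1) < \<epsilon> (\<phi> k) \<and> norm (snd (g k)) < \<epsilon> (\<phi> k) \<and>
          (\<forall>t\<in>T'. \<forall>c\<in>fst t. norm c + \<epsilon> (\<phi> k) < 1 / \<epsilon> (\<phi> k) \<longrightarrow>
            map_prod ((`) (motion (fst (g k)) (snd (g k)))) id t \<in> act (motion (A k) (v k)) T)"
        by (elim exE)
      define B w where "B k = fst (g k)" and "w k = snd (g k)" for k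
      have rB: "rotation_matrix (B k)" for k using g by (simp add: B_def)
      have "(\<lambda>k. B k - mat 1) \<longlonglongrightarrow> 0"
        by (rule tendsto_0_le[OF \<epsilon>\<phi>, of _ 1]) (use g \<epsilon>0 in \<open>auto simp: B_def less_imp_le intro!: always_eventually\<close>)
      then have B: "B \<longlonglongrightarrow> mat 1" by (rule Lim_null[THEN iffD2])
      have w: "w \<longlonglongrightarrow> 0"
        by (rule tendsto_0_le[OF \<epsilon>\<phi>, of _ 1]) (use g \<epsilon>0 in \<open>auto simp: w_def less_imp_le intro!: always_eventually\<close>)
      have "T' \<subseteq> act (motion A' v') T"
      proof
        fix t assume t: "t \<in> T'"
        obtain c r where cr: "r > 0" "ball c r \<subseteq> fst t" using tile_ball[OF T' t] by blast
        have ct: "c \<in> fst t" using cr by auto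
        \<comment> \<open>Compare inside the fixed tiling \<open>T\<close>, as
          \<open>tile_limit\<close> requires: \<open>?C k\<close> and \<open>?u k\<close> belong to
          the small motion followed by the inverse of the motion producing the \<open>k\<close>-th
          tiling. Their limit is the inverse of \<open>motion A' v'\<close>.\<close>
        let ?C = "\<lambda>k. transpose (A k) ** B k" and ?u = "\<lambda>k. transpose (A k) *v w k + - (transpose (A k) *v v k)"
        have rC: "rotation_matrix (?C k)" for k
          using rB Krot[OF AK] by (intro rotation_matrix_mult rotation_matrix_transpose)
        \<comment> \<open>The condition of \<open>close_tiles\<close> multiplied by \<epsilon>,
          which avoids a limit of the unbounded \<open>1 / \<epsilon>\<close>.\<close>
        have "(\<lambda>k. 1 - \<epsilon> (\<phi> k) * (norm c + \<epsilon> (\<phi> k))) \<longlonglongrightarrow> 1 - 0 * (norm c + 0)"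
          by (intro tendsto_intros \<epsilon>\<phi>)
        then have "\<forall>\<^sub>F k in sequentially. 0 < 1 - \<epsilon> (\<phi> k) * (norm c + \<epsilon> (\<phi> k))"
          by (rule order_tendstoD) simp
        then have ev: "\<forall>\<^sub>F k in sequentially. map_prod ((`) (motion (?C k) (?u k))) id t \<in> T"
        proof (rule eventually_mono)
          fix k assume "0 < 1 - \<epsilon> (\<phi> k) * (norm c + \<epsilon> (\<phi> k))"
          then have "norm c + \<epsilon> (\<phi> k) < 1 / \<epsilon> (\<phi> k)"
            using \<epsilon>0[of "\<phi> k"] by (simp add: field_simps)
          then have "map_prod ((`) (motion (B k) (w k))) id t \<in> act (motion (A k) (v k)) T"
            using g t ct unfolding B_def w_def by blast
          then have "act (motion (B k) (w k)) {t} \<subseteq> act (motion (A k) (v k)) T"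
            unfolding act_def by simp
          from act_mono[OF this, of "motion (transpose (A k)) (- (transpose (A k) *v v k))"]
          have "act (motion (?C k) (?u k)) {t} \<subseteq> T"
            unfolding act_motion_inverse(1)[OF Krot[OF AK]] unfolding act_comp motion_comp .
          then show "map_prod ((`) (motion (?C k) (?u k))) id t \<in> T" unfolding act_def by simp
        qed
        have lC: "?C \<longlonglongrightarrow> transpose A' ** mat 1" and lu: "?u \<longlonglongrightarrow> transpose A' *v 0 + - (transpose A' *v v')"
          by (intro tendsto_intros lim B w)+
        from tile_limit[where A = ?C and v = ?u, OF T tile_compact[OF T' t] cr(2,1) rC lC lu ev]
        have "act (motion (transpose A') (- (transpose A' *v v'))) {t} \<subseteq> T"
          unfolding act_def by simp
        from act_mono[OF this, of "motion A' v'"]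
        show "t \<in> act (motion A' v') T"
          unfolding act_motion_inverse(2)[OF Krot[OF A']] by simp
      qed
      from tiling_subset_eq[OF tiling_motion[OF Krot[OF A'] T] T' this]
      have "p \<in> ?W" using T'U A' p' by simp
      from bspec[OF conjunct2[OF W[unfolded openin_euclidean_subtopology_iff]] this]
      obtain e where e: "e > 0" "\<forall>y\<in>K \<times> UNIV. dist y p < e \<longrightarrow> y \<in> ?W"
        by (elim exE conjE)
      have "\<forall>\<^sub>F k in sequentially. dist ((f \<circ> \<phi>) k) p < e"
        using p(3) e(1) by (rule tendstoD)
      then obtain k where k: "dist (f (\<phi> k)) p < e"
        unfolding eventually_sequentially by auto
      have "f (\<phi> k) \<in> K \<times> UNIV" using f by (simp add: mem_Times_iff)
      from mp[OF bspec[OF e(2) this] k] have "act (motion (fst (f (\<phi> k))) (snd (f (\<phi> k)))) T \<in> U"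
        by simp
      then show False using f by simp
    qed
  qed
  then show ?thesis unfolding openin_hull_topology by (rule conj_cong[OF refl])
qed

section \<open>The space group and extensions\<close>

text \<open>A period shorter than the inradius of a tile moves that tile onto an overlapping one,
  hence onto itself, and a compact nonempty set is not invariant under a nonzero
  translation.\<close>

lemma translation_periods_discrete:
  fixes T :: "('n::finite, 'l) tiling"
  assumes T: "tiling T"
  shows "\<exists>r>0. \<forall>x. act ((+) x) T = T \<longrightarrow> norm x < r \<longrightarrow> x = 0"
proof -
  obtain t where t: "t \<in> T" using tiling_nonempty[OF T] by blast
  obtain c r where cr: "r > 0" "ball c r \<subseteq> fst t" using tile_ball[OF T t] by blast
  have "x = 0" if x: "act ((+) x) T = T" "norm x < r" for x
  proof -
    let ?s = "map_prod ((`) ((+) x)) id t"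
    have "?s \<in> act ((+) x) T" using t unfolding act_def by (rule imageI)
    then have s: "?s \<in> T" unfolding x(1) .
    have "x + c \<in> ball c r" using x(2) by (simp add: dist_norm)
    then have "x + c \<in> interior (fst t)"
      using interior_maximal[OF cr(2) open_ball] by blast
    moreover have "c \<in> fst t" using cr by auto
    then have "x + c \<in> fst ?s" by simp
    ultimately have "t = ?s" using tile_unique[OF T t s] by blast
    then have shift: "(+) x ` fst t = fst t" by (metis fst_map_prod)
    have "fst t \<noteq> {}" using cr by force
    \<comment> \<open>A point maximising the inner product with \<open>x\<close> could be moved
      further by \<open>x\<close> without leaving the tile, forcing
      \<open>x \<bullet> x \<le> 0\<close>.\<close>
    have "continuous_on (fst t) (\<lambda>y. y \<bullet> x)" by (intro continuous_intros)
    from continuous_attains_sup[OF tile_compact[OF T t] \<open>fst t \<noteq> {}\<close> this]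
    obtain y where y: "y \<in> fst t" "\<forall>z\<in>fst t. z \<bullet> x \<le> y \<bullet> x" by blast
    have "x + y \<in> fst t" using y(1) shift by blast
    then have "(x + y) \<bullet> x \<le> y \<bullet> x" using y(2) by blast
    then have "x \<bullet> x \<le> 0" by (simp add: inner_add_left)
    then have "x \<bullet> x = 0" using inner_ge_zero[of x] by (rule order_antisym)
    then show ?thesis unfolding inner_eq_zero_iff .
  qed
  then show ?thesis using cr(1) by blast
qed

lemma carrier_positive_space_group:
  "f \<in> carrier (positive_space_group T) \<longleftrightarrow> (\<exists>A v. rotation_matrix A \<and> f = motion A v \<and> act f T = T)"
  unfolding positive_space_group_def by (auto simp: orientation_preserving_isometry_iff)

lemma carrier_point_group:
  "A \<in> carrier (point_group T) \<longleftrightarrow> rotation_matrix A \<and> (\<exists>v. act (motion A v) T = T)"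
proof -
  have "A \<in> carrier (point_group T) \<longleftrightarrow> (\<exists>f\<in>carrier (positive_space_group T). A = linear_part f)"
    unfolding point_group_def by auto
  then show ?thesis
    unfolding Bex_def carrier_positive_space_group using linear_part_motion by metis
qed

text \<open>Rotational parts of symmetries map periods to periods. If \<open>A\<close> is near the
  identity, then each \<open>A *v b i - b i\<close> is a period too short to be nonzero, so
  \<open>A\<close> fixes a spanning family.\<close>

lemma point_group_discrete:
  fixes T :: "('n::finite, 'l) tiling"
  assumes T: "tiling T" and per: "periodic T"
  shows "\<exists>\<epsilon>>0. \<forall>A\<in>carrier (point_group T). dist A (mat 1) < \<epsilon> \<longrightarrow> A = mat 1"
proof -
  obtain r where r: "r > 0" "\<forall>x. act ((+) x) T = T \<longrightarrow> norm x < r \<longrightarrow> x = 0"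
    using translation_periods_discrete[OF T] by (elim exE conjE)
  obtain b :: "'n \<Rightarrow> real ^ 'n" where b: "\<And>i. act ((+) (b i)) T = T"
    "\<And>v. \<exists>c. v = (\<Sum>i\<in>UNIV. c i *\<^sub>R b i)"
    using periodic_basis[OF per] by metis
  have lim: "((\<lambda>A. A *v b i - b i) \<longlongrightarrow> mat 1 *v b i - b i) (nhds (mat 1))" for i
    by (intro tendsto_intros filterlim_ident)
  have "\<forall>\<^sub>F A in nhds (mat 1). dist (A *v b i - b i) 0 < r" for i
    using tendstoD[OF lim r(1), of i] by simp
  then have "\<forall>\<^sub>F A in nhds (mat 1). \<forall>i. dist (A *v b i - b i) 0 < r"
    by (rule eventually_all_finite)
  then obtain \<epsilon> where \<epsilon>: "\<epsilon> > 0" "\<forall>A. dist A (mat 1) < \<epsilon> \<longrightarrow> (\<forall>i. dist (A *v b i - b i) 0 < r)"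
    unfolding eventually_nhds_metric by (elim exE conjE)
  have "A = mat 1" if A: "A \<in> carrier (point_group T)" and near: "dist A (mat 1) < \<epsilon>" for A
  proof -
    obtain v where v: "act (motion A v) T = T" using A unfolding carrier_point_group by blast
    have period: "act ((+) (A *v l)) T = T" if "act ((+) l) T = T" for l
    proof -
      have "act ((+) (A *v l)) (act (motion A v) T) = act (motion A v) (act ((+) l) T)"
        unfolding act_comp
        by (rule arg_cong2[where f = act]) (simp_all add: fun_eq_iff motion_def matrix_vector_right_distrib)
      then show ?thesis by (simp only: v that)
    qed
    have fix_b: "A *v b i = b i" for i
    proof -
      have "act ((+) (A *v b i - b i)) T = act ((+) (A *v b i)) (act ((+) (- b i)) T)"
        unfolding act_comp by (rule arg_cong2[where f = act]) (simp_all add: fun_eq_iff)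
      also have "\<dots> = T"
        using period[OF b(1)] translation_period_neg[OF b(1)] by simp
      finally have shift: "act ((+) (A *v b i - b i)) T = T" .
      have "dist (A *v b i - b i) 0 < r" using \<epsilon>(2) near by blast
      then have "norm (A *v b i - b i) < r" by simp
      from r(2)[rule_format, OF shift this]
      show ?thesis by simp
    qed
    have "A *v x = mat 1 *v x" for x
    proof -
      obtain c where c: "x = (\<Sum>i\<in>UNIV. c i *\<^sub>R b i)" using b(2) by blast
      have "A *v x = (\<Sum>i\<in>UNIV. c i *\<^sub>R (A *v b i))"
        unfolding c linear_sum[OF matrix_vector_mul_linear]
        by (simp add: linear_cmul[OF matrix_vector_mul_linear])
      then show ?thesis by (simp add: fix_b c)
    qed
    then show ?thesis by (simp add: matrix_eq)
  qed
  then show ?thesis using \<epsilon>(1) by blast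
qed

section \<open>Group laws and the standard extension\<close>

lemma group_positive_space_group: "group (positive_space_group T)"
proof (rule groupI)
  fix f g assume fg: "f \<in> carrier (positive_space_group T)" "g \<in> carrier (positive_space_group T)"
  then obtain A v B w where *: "rotation_matrix A" "f = motion A v" "act f T = T"
    "rotation_matrix B" "g = motion B w" "act g T = T"
    unfolding carrier_positive_space_group by blast
  have "act (f \<circ> g) T = T" unfolding act_comp[symmetric] using * by simp
  moreover have "f \<circ> g = motion (A ** B) (A *v w + v)" unfolding * motion_comp ..
  ultimately have "f \<circ> g \<in> carrier (positive_space_group T)"
    unfolding carrier_positive_space_group using rotation_matrix_mult[OF *(1,4)] by blast
  then show "f \<otimes>\<^bsub>positive_space_group T\<^esub> g \<in> carrier (positive_space_group T)"
    by (simp add: positive_space_group_def)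
next
  have "id = motion (mat 1) 0" by (rule motion_id[symmetric])
  then have "id \<in> carrier (positive_space_group T)"
    unfolding carrier_positive_space_group using rotation_matrix_one act_id by blast
  then show "\<one>\<^bsub>positive_space_group T\<^esub> \<in> carrier (positive_space_group T)"
    by (simp add: positive_space_group_def)
next
  fix f assume "f \<in> carrier (positive_space_group T)"
  then obtain A v where *: "rotation_matrix A" "f = motion A v" "act f T = T"
    unfolding carrier_positive_space_group by blast
  let ?g = "motion (transpose A) (- (transpose A *v v))"
  have "act ?g T = T" using act_motion_inverse(1)[OF *(1), of v T] *(2,3) by simp
  then have "?g \<in> carrier (positive_space_group T)"
    unfolding carrier_positive_space_group using rotation_matrix_transpose[OF *(1)] by blast
  moreover have "?g \<circ> f = id" unfolding *(2) by (rule motion_inverse(2)[OF *(1)])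
  ultimately show "\<exists>g\<in>carrier (positive_space_group T). g \<otimes>\<^bsub>positive_space_group T\<^esub> f = \<one>\<^bsub>positive_space_group T\<^esub>"
    by (intro bexI[of _ ?g]) (simp_all add: positive_space_group_def)
qed (simp_all add: positive_space_group_def comp_assoc)

lemma group_translation_group: "group (translation_group T)"
proof (rule groupI)
  fix x y assume "x \<in> carrier (translation_group T)" "y \<in> carrier (translation_group T)"
  then have xy: "act ((+) x) T = T" "act ((+) y) T = T" by (simp_all add: translation_group_def)
  have "act ((+) (x + y)) T = act ((+) x) (act ((+) y) T)"
    unfolding act_comp by (rule arg_cong2[where f = act]) (simp_all add: fun_eq_iff add.assoc)
  then show "x \<otimes>\<^bsub>translation_group T\<^esub> y \<in> carrier (translation_group T)"
    using xy by (simp add: translation_group_def)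
next
  have "(+) (0 :: real ^ 'a) = id" by (simp add: fun_eq_iff)
  then show "\<one>\<^bsub>translation_group T\<^esub> \<in> carrier (translation_group T)"
    by (simp add: translation_group_def)
next
  fix x assume "x \<in> carrier (translation_group T)"
  then have "act ((+) x) T = T" by (simp add: translation_group_def)
  from translation_period_neg[OF this]
  show "\<exists>y\<in>carrier (translation_group T). y \<otimes>\<^bsub>translation_group T\<^esub> x = \<one>\<^bsub>translation_group T\<^esub>"
    by (intro bexI[of _ "- x"]) (simp_all add: translation_group_def)
qed (simp_all add: translation_group_def add.assoc)

lemma group_special_orthogonal_group: "group special_orthogonal_group"
proof (rule groupI)
  fix A :: "real ^ 'a ^ 'a" assume "A \<in> carrier special_orthogonal_group"
  then have "rotation_matrix A" by (simp add: special_orthogonal_group_def)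
  then show "\<exists>B\<in>carrier special_orthogonal_group. B \<otimes>\<^bsub>special_orthogonal_group\<^esub> A = \<one>\<^bsub>special_orthogonal_group\<^esub>"
    by (intro bexI[of _ "transpose A"])
      (simp_all add: special_orthogonal_group_def rotation_matrix_transpose rotation_matrix_inverse)
qed (simp_all add: special_orthogonal_group_def rotation_matrix_mult rotation_matrix_one matrix_mul_assoc)

lemma linear_part_hom: "linear_part \<in> hom (positive_space_group T) special_orthogonal_group"
proof (rule homI)
  fix f assume "f \<in> carrier (positive_space_group T)"
  then show "linear_part f \<in> carrier special_orthogonal_group"
    unfolding carrier_positive_space_group by (auto simp: linear_part_motion special_orthogonal_group_def)
next
  fix f g assume "f \<in> carrier (positive_space_group T)" "g \<in> carrier (positive_space_group T)"
  then obtain A v B w where "f = motion A v" "g = motion B w"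
    unfolding carrier_positive_space_group by blast
  then show "linear_part (f \<otimes>\<^bsub>positive_space_group T\<^esub> g) =
      linear_part f \<otimes>\<^bsub>special_orthogonal_group\<^esub> linear_part g"
    by (simp add: positive_space_group_def special_orthogonal_group_def motion_comp linear_part_motion)
qed

lemma subgroup_point_group: "subgroup (carrier (point_group T)) special_orthogonal_group"
proof -
  interpret group_hom "positive_space_group T" special_orthogonal_group linear_part
    by (intro group_hom.intro group_hom_axioms.intro group_positive_space_group
        group_special_orthogonal_group linear_part_hom)
  show ?thesis using img_is_subgroup by (simp add: point_group_def)
qed

lemma translation_in_positive_space_group:
  "(+) x \<in> carrier (positive_space_group T) \<longleftrightarrow> x \<in> carrier (translation_group T)"
proof -
  have "(+) x \<in> carrier (positive_space_group T) \<longleftrightarrow> act ((+) x) T = T"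
    unfolding carrier_positive_space_group using motion_one rotation_matrix_one by metis
  then show ?thesis by (simp add: translation_group_def)
qed

lemma linear_part_translation: "linear_part ((+) x) = mat 1"
  unfolding motion_one[symmetric] by (rule linear_part_motion)

lemma translation_of_linear_part_one:
  assumes "f \<in> carrier (positive_space_group T)" "linear_part f = mat 1"
  shows "f = (+) (f 0)" "f 0 \<in> carrier (translation_group T)"
proof -
  obtain A v where f: "f = motion A v"
    using assms(1) unfolding carrier_positive_space_group by blast
  have "A = mat 1" using assms(2) unfolding f linear_part_motion .
  then have "f = (+) v" unfolding f by (simp add: motion_one)
  moreover from this have "f 0 = v" by simp
  ultimately show "f = (+) (f 0)" by simp
  then show "f 0 \<in> carrier (translation_group T)"
    using assms(1) translation_in_positive_space_group by metis
qed

lemma positive_space_group_extension: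
  "group_extension (translation_group T) (+) (positive_space_group T) linear_part (point_group T)"
  unfolding group_extension_def
proof (intro conjI)
  show "group (translation_group T)" by (rule group_translation_group)
  show "group (positive_space_group T)" by (rule group_positive_space_group)
  have "special_orthogonal_group\<lparr>carrier := carrier (point_group T)\<rparr> = point_group T"
    by (simp add: point_group_def)
  then show "group (point_group T)"
    using subgroup.subgroup_is_group[OF subgroup_point_group group_special_orthogonal_group] by metis
  have "(+) \<in> hom (translation_group T) (positive_space_group T)"
    by (rule homI) (simp_all add: translation_in_positive_space_group,
      simp add: translation_group_def positive_space_group_def fun_eq_iff add.assoc)
  moreover have "inj_on (+) (carrier (translation_group T))"
    by (rule inj_onI) (metis add.right_neutral)
  ultimately show "(+) \<in> mon (translation_group T) (positive_space_group T)"
    by (simp add: mon_def)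
  show "linear_part \<in> epi (positive_space_group T) (point_group T)"
    using linear_part_hom[of T] by (auto simp: epi_def hom_def point_group_def)
  show "(+) ` carrier (translation_group T) = kernel (positive_space_group T) (point_group T) linear_part"
  proof (intro equalityI subsetI)
    fix f assume "f \<in> (+) ` carrier (translation_group T)"
    then show "f \<in> kernel (positive_space_group T) (point_group T) linear_part"
      by (auto simp: kernel_def translation_in_positive_space_group linear_part_translation
          point_group_def special_orthogonal_group_def)
  next
    fix f assume "f \<in> kernel (positive_space_group T) (point_group T) linear_part"
    then have "f \<in> carrier (positive_space_group T)" "linear_part f = mat 1"
      by (auto simp: kernel_def point_group_def special_orthogonal_group_def)
    from translation_of_linear_part_one[OF this] show "f \<in> (+) ` carrier (translation_group T)"
      by blast
  qed
qed

text \<open>A diagram chase: each homomorphism of the target is the source one conjugated by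
  bijections. With the pullback as source, it supplies exactness of the sequence of fundamental
  groups.\<close>

lemma group_extension_transfer:
  assumes ext: "group_extension A \<iota> E \<rho> Q" and iso: "extension_iso A \<iota> E \<rho> Q A' \<iota>' E' \<rho>' Q' \<alpha> \<kappa> \<beta>"
    and groups: "group A'" "group E'" "group Q'"
  shows "group_extension A' \<iota>' E' \<rho>' Q'"
proof -
  have A: "group A" and E: "group E" and Q: "group Q" and \<iota>: "\<iota> \<in> mon A E" and \<rho>: "\<rho> \<in> epi E Q"
    and ker: "\<iota> ` carrier A = kernel E Q \<rho>"
    using ext unfolding group_extension_def by blast+
  have \<alpha>: "\<alpha> \<in> iso A A'" and \<kappa>: "\<kappa> \<in> iso E E'" and \<beta>: "\<beta> \<in> iso Q Q'"
    and \<kappa>\<iota>: "\<And>a. a \<in> carrier A \<Longrightarrow> \<kappa> (\<iota> a) = \<iota>' (\<alpha> a)"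
    and \<rho>\<kappa>: "\<And>e. e \<in> carrier E \<Longrightarrow> \<rho>' (\<kappa> e) = \<beta> (\<rho> e)"
    using iso unfolding extension_iso_def by blast+
  have bij: "bij_betw \<alpha> (carrier A) (carrier A')" "bij_betw \<kappa> (carrier E) (carrier E')"
    "bij_betw \<beta> (carrier Q) (carrier Q')"
    using \<alpha> \<kappa> \<beta> unfolding iso_def by blast+
  have hom: "\<alpha> \<in> hom A A'" "\<kappa> \<in> hom E E'" "\<beta> \<in> hom Q Q'" "\<iota> \<in> hom A E" "\<rho> \<in> hom E Q"
    using \<alpha> \<kappa> \<beta> \<iota> \<rho> unfolding iso_def mon_def epi_def by blast+
  have inj\<iota>: "inj_on \<iota> (carrier A)" and surj\<rho>: "\<rho> ` carrier E = carrier Q"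
    using \<iota> \<rho> unfolding mon_def epi_def by blast+
  have surj: "carrier A' = \<alpha> ` carrier A" "carrier E' = \<kappa> ` carrier E" "carrier Q' = \<beta> ` carrier Q"
    using bij unfolding bij_betw_def by simp_all
  have inj: "inj_on \<kappa> (carrier E)" "inj_on \<beta> (carrier Q)"
    using bij unfolding bij_betw_def by simp_all
  note cl = hom_in_carrier[OF hom(1)] hom_in_carrier[OF hom(2)] hom_in_carrier[OF hom(3)]
    hom_in_carrier[OF hom(4)] hom_in_carrier[OF hom(5)]
  have one: "\<beta> \<one>\<^bsub>Q\<^esub> = \<one>\<^bsub>Q'\<^esub>" by (rule hom_one[OF hom(3) Q groups(3)])
  have "\<iota>' \<in> hom A' E'"
  proof (rule homI)
    fix a' assume "a' \<in> carrier A'"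
    then obtain a where a: "a \<in> carrier A" "a' = \<alpha> a" unfolding surj by blast
    then show "\<iota>' a' \<in> carrier E'" using \<kappa>\<iota>[OF a(1)] cl by metis
    fix b' assume "b' \<in> carrier A'"
    then obtain b where b: "b \<in> carrier A" "b' = \<alpha> b" unfolding surj by blast
    have ab: "a \<otimes>\<^bsub>A\<^esub> b \<in> carrier A" using A a(1) b(1) by (simp add: group.is_monoid monoid.m_closed)
    have "\<iota>' (a' \<otimes>\<^bsub>A'\<^esub> b') = \<iota>' (\<alpha> (a \<otimes>\<^bsub>A\<^esub> b))"
      using hom_mult[OF hom(1) a(1) b(1)] a(2) b(2) by simp
    also have "\<dots> = \<kappa> (\<iota> a \<otimes>\<^bsub>E\<^esub> \<iota> b)"
      using \<kappa>\<iota>[OF ab] hom_mult[OF hom(4) a(1) b(1)] by simp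
    also have "\<dots> = \<iota>' a' \<otimes>\<^bsub>E'\<^esub> \<iota>' b'"
      using hom_mult[OF hom(2) cl(4)[OF a(1)] cl(4)[OF b(1)]] \<kappa>\<iota>[OF a(1)] \<kappa>\<iota>[OF b(1)] a(2) b(2) by simp
    finally show "\<iota>' (a' \<otimes>\<^bsub>A'\<^esub> b') = \<iota>' a' \<otimes>\<^bsub>E'\<^esub> \<iota>' b'" .
  qed
  moreover have "inj_on \<iota>' (carrier A')"
  proof (rule inj_onI)
    fix a' b' assume ab': "a' \<in> carrier A'" "b' \<in> carrier A'" "\<iota>' a' = \<iota>' b'"
    obtain a where a: "a \<in> carrier A" "a' = \<alpha> a" using ab'(1) unfolding surj by blast
    obtain b where b: "b \<in> carrier A" "b' = \<alpha> b" using ab'(2) unfolding surj by blast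
    have "\<kappa> (\<iota> a) = \<kappa> (\<iota> b)" using \<kappa>\<iota>[OF a(1)] \<kappa>\<iota>[OF b(1)] ab'(3) a(2) b(2) by simp
    then have "\<iota> a = \<iota> b" using inj_onD[OF inj(1)] cl(4)[OF a(1)] cl(4)[OF b(1)] by blast
    then show "a' = b'" using inj_onD[OF inj\<iota> _ a(1) b(1)] a(2) b(2) by simp
  qed
  ultimately have 1: "\<iota>' \<in> mon A' E'" by (simp add: mon_def)
  have "\<rho>' \<in> hom E' Q'"
  proof (rule homI)
    fix a' assume "a' \<in> carrier E'"
    then obtain a where a: "a \<in> carrier E" "a' = \<kappa> a" unfolding surj by blast
    then show "\<rho>' a' \<in> carrier Q'" using \<rho>\<kappa>[OF a(1)] cl(3)[OF cl(5)[OF a(1)]] by simp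
    fix b' assume "b' \<in> carrier E'"
    then obtain b where b: "b \<in> carrier E" "b' = \<kappa> b" unfolding surj by blast
    have ab: "a \<otimes>\<^bsub>E\<^esub> b \<in> carrier E" using E a(1) b(1) by (simp add: group.is_monoid monoid.m_closed)
    have "\<rho>' (a' \<otimes>\<^bsub>E'\<^esub> b') = \<rho>' (\<kappa> (a \<otimes>\<^bsub>E\<^esub> b))"
      using hom_mult[OF hom(2) a(1) b(1)] a(2) b(2) by simp
    also have "\<dots> = \<beta> (\<rho> a \<otimes>\<^bsub>Q\<^esub> \<rho> b)"
      using \<rho>\<kappa>[OF ab] hom_mult[OF hom(5) a(1) b(1)] by simp
    also have "\<dots> = \<rho>' a' \<otimes>\<^bsub>Q'\<^esub> \<rho>' b'"
      using hom_mult[OF hom(3) cl(5)[OF a(1)] cl(5)[OF b(1)]] \<rho>\<kappa>[OF a(1)] \<rho>\<kappa>[OF b(1)] a(2) b(2) by simp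
    finally show "\<rho>' (a' \<otimes>\<^bsub>E'\<^esub> b') = \<rho>' a' \<otimes>\<^bsub>Q'\<^esub> \<rho>' b'" .
  qed
  moreover have "\<rho>' ` carrier E' = carrier Q'"
  proof -
    have "\<rho>' ` carrier E' = \<beta> ` (\<rho> ` carrier E)"
      unfolding surj image_image by (rule image_cong[OF refl \<rho>\<kappa>])
    then show ?thesis unfolding surj\<rho> surj .
  qed
  ultimately have 2: "\<rho>' \<in> epi E' Q'" by (simp add: epi_def)
  have "\<iota>' ` carrier A' = \<kappa> ` (\<iota> ` carrier A)"
    unfolding surj image_image by (rule image_cong[OF refl \<kappa>\<iota>[symmetric]])
  also have "\<dots> = kernel E' Q' \<rho>'"
    unfolding ker
  proof (intro equalityI subsetI)
    fix e' assume "e' \<in> \<kappa> ` kernel E Q \<rho>"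
    then obtain e where "e \<in> carrier E" "\<rho> e = \<one>\<^bsub>Q\<^esub>" "e' = \<kappa> e" unfolding kernel_def by blast
    then show "e' \<in> kernel E' Q' \<rho>'"
      unfolding kernel_def using \<rho>\<kappa>[of e] one cl(2)[of e] by simp
  next
    fix e' assume "e' \<in> kernel E' Q' \<rho>'"
    then have "e' \<in> carrier E'" "\<rho>' e' = \<one>\<^bsub>Q'\<^esub>" unfolding kernel_def by simp_all
    then obtain e where e: "e \<in> carrier E" "e' = \<kappa> e" unfolding surj by blast
    have "\<beta> (\<rho> e) = \<beta> \<one>\<^bsub>Q\<^esub>" using \<rho>\<kappa>[OF e(1)] e(2) \<open>\<rho>' e' = \<one>\<^bsub>Q'\<^esub>\<close> one by simp
    then have "\<rho> e = \<one>\<^bsub>Q\<^esub>"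
      using inj_onD[OF inj(2) _ cl(5)[OF e(1)]] Q by (simp add: group.is_monoid monoid.one_closed)
    then show "e' \<in> \<kappa> ` kernel E Q \<rho>" using e unfolding kernel_def by blast
  qed
  finally show ?thesis
    unfolding group_extension_def using 1 2 groups by simp
qed

text \<open>The group structure is transported from \<open>H\<close> along the isomorphism of lifts.
  Transport delivers the image of the identity as unit, which is the class of the constant loop
  because that loop lifts to a constant.\<close>

lemma (in discrete_quotient) group_fundamental_group: "group (fundamental_group Y y0)"
proof -
  have H1: "\<one> \<in> H" by (rule subgroup.one_closed[OF subgroup_H])
  have "(\<lambda>_. y0) \<in> lift_class S q \<one>"
    unfolding lift_class_def by (intro CollectI exI[of _ "\<lambda>_. \<one>"]) auto
  from loop_class_eq[OF H1 this] have one: "lift_class S q \<one> = \<one>\<^bsub>fundamental_group Y y0\<^esub>"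
    by (simp add: fundamental_group_def)
  have "group (S\<lparr>carrier := H\<rparr>)" by (rule subgroup.subgroup_is_group[OF subgroup_H is_group])
  from group.iso_imp_img_group[OF this lift_class_iso]
  have "group ((fundamental_group Y y0)\<lparr>one := lift_class S q \<one>\<rparr>)" by simp
  then show ?thesis unfolding one by simp
qed

section \<open>The three quotients\<close>

text \<open>Open continuous surjections are quotient maps. This moves openness between parameters
  made of rotation matrices and the simply connected group above them.\<close>

lemma openin_open_map_preimage:
  assumes "continuous_on S p" "p ` S = S'" "W \<subseteq> S'"
    and op: "\<And>U. openin (top_of_set S) U \<Longrightarrow> openin (top_of_set S') (p ` U)"
  shows "openin (top_of_set S) {x \<in> S. p x \<in> W} \<longleftrightarrow> openin (top_of_set S') W"
proof
  assume "openin (top_of_set S) {x \<in> S. p x \<in> W}"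
  from op[OF this] have "openin (top_of_set S') (p ` {x \<in> S. p x \<in> W})" .
  moreover have "p ` {x \<in> S. p x \<in> W} = W"
  proof (intro equalityI subsetI)
    fix y assume y: "y \<in> W"
    then have "y \<in> p ` S" using assms(2,3) by blast
    then show "y \<in> p ` {x \<in> S. p x \<in> W}" using y by blast
  qed blast
  ultimately show "openin (top_of_set S') W" by simp
next
  assume W: "openin (top_of_set S') W"
  have "p \<in> S \<rightarrow> S'" using assms(2) by blast
  from continuous_openin_preimage[OF assms(1) this W]
  have "openin (top_of_set S) (S \<inter> p -` W)" .
  moreover have "S \<inter> p -` W = {x \<in> S. p x \<in> W}" by blast
  ultimately show "openin (top_of_set S) {x \<in> S. p x \<in> W}" by simp
qed

lemma (in group) l_coset_eq_iff:
  assumes H: "subgroup H G" and x: "x \<in> carrier G" and y: "y \<in> carrier G"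
  shows "x <# H = y <# H \<longleftrightarrow> inv x \<otimes> y \<in> H"
proof
  assume "x <# H = y <# H"
  then have "y \<in> x <# H" using lcos_self[OF y H] by simp
  from subgroup.lcos_module_imp[OF H is_group x this] show "inv x \<otimes> y \<in> H" .
next
  assume "inv x \<otimes> y \<in> H"
  moreover have "y = x \<otimes> (inv x \<otimes> y)" using x y by simp
  ultimately have "y \<in> x <# H" unfolding l_coset_def by blast
  from l_repr_independence[OF this x H] show "x <# H = y <# H" .
qed

lemma continuous_on_matrix_vector_mult [continuous_intros]:
  fixes f :: "'a::topological_space \<Rightarrow> real ^ 'n::finite ^ 'm::finite"
  assumes "continuous_on S f" "continuous_on S g"
  shows "continuous_on S (\<lambda>x. f x *v g x)"
  using assms unfolding continuous_on_def by (auto intro: tendsto_matrix_vector_mult)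

section \<open>Simply connected groups over the hulls, and pullbacks of extensions\<close>

definition vector_group :: "(real ^ 'n) monoid" where
  "vector_group = \<lparr>carrier = UNIV, mult = (+), one = 0\<rparr>"

lemma group_vector_group: "group vector_group"
  by (rule groupI) (auto simp: vector_group_def add.assoc intro: exI[of _ "- _"])

lemma inv_vector_group: "inv\<^bsub>vector_group\<^esub> x = - x"
  by (rule group.inv_equality[OF group_vector_group]) (simp_all add: vector_group_def)

text \<open>The semidirect product of \<open>S\<close> with the vector space, with the
  multiplication read off from \<open>motion_comp\<close>, so that sending \<open>(s, v)\<close> to
  \<open>motion (\<pi> s) v\<close> is multiplicative.\<close>

definition motion_cover :: "('s::topological_space) monoid \<Rightarrow> ('s \<Rightarrow> real ^ 'n::finite ^ 'n) \<Rightarrow> ('s \<times> (real ^ 'n)) monoid" where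
  "motion_cover S \<pi> = \<lparr>carrier = carrier S \<times> UNIV,
     mult = (\<lambda>x y. (fst x \<otimes>\<^bsub>S\<^esub> fst y, \<pi> (fst x) *v snd y + snd x)), one = (\<one>\<^bsub>S\<^esub>, 0)\<rparr>"

definition cover_act :: "('s \<Rightarrow> real ^ 'n::finite ^ 'n) \<Rightarrow> ('n, 'l) tiling \<Rightarrow> 's \<times> (real ^ 'n) \<Rightarrow> ('n, 'l) tiling" where
  "cover_act \<pi> T x = act (motion (\<pi> (fst x)) (snd x)) T"

definition cover_stabiliser :: "('s::topological_space) monoid \<Rightarrow> ('s \<Rightarrow> real ^ 'n::finite ^ 'n) \<Rightarrow> ('n, 'l) tiling \<Rightarrow> ('s \<times> (real ^ 'n)) set" where
  "cover_stabiliser S \<pi> T = {x \<in> carrier (motion_cover S \<pi>). cover_act \<pi> T x = T}"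

lemma fibre_product_simps:
  "x \<in> carrier (fibre_product E \<rho> R \<sigma>) \<longleftrightarrow> fst x \<in> carrier E \<and> snd x \<in> carrier R \<and> \<rho> (fst x) = \<sigma> (snd x)"
  "x \<otimes>\<^bsub>fibre_product E \<rho> R \<sigma>\<^esub> y = (fst x \<otimes>\<^bsub>E\<^esub> fst y, snd x \<otimes>\<^bsub>R\<^esub> snd y)"
  "\<one>\<^bsub>fibre_product E \<rho> R \<sigma>\<^esub> = (\<one>\<^bsub>E\<^esub>, \<one>\<^bsub>R\<^esub>)"
  by (auto simp: fibre_product_def mult_DirProd')

lemma group_fibre_product:
  assumes E: "group E" and R: "group R" and Q: "group Q" and \<rho>: "\<rho> \<in> hom E Q" and \<sigma>: "\<sigma> \<in> hom R Q"
  shows "group (fibre_product E \<rho> R \<sigma>)"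
proof (rule groupI)
  interpret E: group E by fact
  interpret R: group R by fact
  fix x y assume "x \<in> carrier (fibre_product E \<rho> R \<sigma>)" "y \<in> carrier (fibre_product E \<rho> R \<sigma>)"
  then show "x \<otimes>\<^bsub>fibre_product E \<rho> R \<sigma>\<^esub> y \<in> carrier (fibre_product E \<rho> R \<sigma>)"
    by (simp add: fibre_product_simps hom_mult[OF \<rho>] hom_mult[OF \<sigma>])
next
  show "\<one>\<^bsub>fibre_product E \<rho> R \<sigma>\<^esub> \<in> carrier (fibre_product E \<rho> R \<sigma>)"
    using E R by (simp add: fibre_product_simps hom_one[OF \<rho> E Q] hom_one[OF \<sigma> R Q] group.is_monoid monoid.one_closed)
next
  interpret E: group E by fact
  interpret R: group R by fact
  fix x y z
  assume "x \<in> carrier (fibre_product E \<rho> R \<sigma>)" "y \<in> carrier (fibre_product E \<rho> R \<sigma>)" "z \<in> carrier (fibre_product E \<rho> R \<sigma>)"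
  then show "x \<otimes>\<^bsub>fibre_product E \<rho> R \<sigma>\<^esub> y \<otimes>\<^bsub>fibre_product E \<rho> R \<sigma>\<^esub> z =
      x \<otimes>\<^bsub>fibre_product E \<rho> R \<sigma>\<^esub> (y \<otimes>\<^bsub>fibre_product E \<rho> R \<sigma>\<^esub> z)"
    by (simp add: fibre_product_simps E.m_assoc R.m_assoc)
next
  interpret E: group E by fact
  interpret R: group R by fact
  fix x assume "x \<in> carrier (fibre_product E \<rho> R \<sigma>)"
  then show "\<one>\<^bsub>fibre_product E \<rho> R \<sigma>\<^esub> \<otimes>\<^bsub>fibre_product E \<rho> R \<sigma>\<^esub> x = x"
    by (simp add: fibre_product_simps)
next
  interpret \<rho>: group_hom E Q \<rho> by (intro group_hom.intro group_hom_axioms.intro assms)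
  interpret \<sigma>: group_hom R Q \<sigma> by (intro group_hom.intro group_hom_axioms.intro assms)
  fix x assume x: "x \<in> carrier (fibre_product E \<rho> R \<sigma>)"
  then have "(inv\<^bsub>E\<^esub> fst x, inv\<^bsub>R\<^esub> snd x) \<in> carrier (fibre_product E \<rho> R \<sigma>)"
    by (simp add: fibre_product_simps)
  moreover have "(inv\<^bsub>E\<^esub> fst x, inv\<^bsub>R\<^esub> snd x) \<otimes>\<^bsub>fibre_product E \<rho> R \<sigma>\<^esub> x = \<one>\<^bsub>fibre_product E \<rho> R \<sigma>\<^esub>"
    using x by (simp add: fibre_product_simps)
  ultimately show "\<exists>y\<in>carrier (fibre_product E \<rho> R \<sigma>). y \<otimes>\<^bsub>fibre_product E \<rho> R \<sigma>\<^esub> x = \<one>\<^bsub>fibre_product E \<rho> R \<sigma>\<^esub>"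
    by blast
qed

text \<open>An element over the identity of \<open>R\<close> has its first component in the kernel
  of \<open>\<rho>\<close>, hence in the image of \<open>\<iota>\<close>; surjectivity of
  \<open>\<rho>\<close> provides a partner for every element of \<open>R\<close>.\<close>

lemma group_extension_pullback:
  assumes ext: "group_extension A \<iota> E \<rho> Q" and R: "group R" and \<sigma>: "\<sigma> \<in> hom R Q"
  shows "group_extension A (\<lambda>a. (\<iota> a, \<one>\<^bsub>R\<^esub>)) (fibre_product E \<rho> R \<sigma>) snd R"
proof -
  have A: "group A" and E: "group E" and Q: "group Q" and \<iota>: "\<iota> \<in> mon A E" and \<rho>: "\<rho> \<in> epi E Q"
    and ker: "\<iota> ` carrier A = kernel E Q \<rho>"
    using ext unfolding group_extension_def by blast+
  have \<rho>_hom: "\<rho> \<in> hom E Q" and \<rho>_surj: "\<rho> ` carrier E = carrier Q" using \<rho> by (simp_all add: epi_def)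
  have \<iota>_hom: "\<iota> \<in> hom A E" and \<iota>_inj: "inj_on \<iota> (carrier A)" using \<iota> by (simp_all add: mon_def)
  interpret R: group R by fact
  have \<sigma>1: "\<sigma> \<one>\<^bsub>R\<^esub> = \<one>\<^bsub>Q\<^esub>" by (rule hom_one[OF \<sigma> R Q])
  have \<iota>_ker: "\<iota> a \<in> carrier E" "\<rho> (\<iota> a) = \<one>\<^bsub>Q\<^esub>" if "a \<in> carrier A" for a
  proof -
    have "\<iota> a \<in> kernel E Q \<rho>" using that ker by blast
    then show "\<iota> a \<in> carrier E" "\<rho> (\<iota> a) = \<one>\<^bsub>Q\<^esub>" by (simp_all add: kernel_def)
  qed
  have "(\<lambda>a. (\<iota> a, \<one>\<^bsub>R\<^esub>)) \<in> mon A (fibre_product E \<rho> R \<sigma>)"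
    using \<iota>_inj by (auto simp: mon_def hom_def inj_on_def fibre_product_simps \<iota>_ker \<sigma>1 hom_mult[OF \<iota>_hom])
  moreover have "snd \<in> epi (fibre_product E \<rho> R \<sigma>) R"
  proof -
    have "r \<in> snd ` carrier (fibre_product E \<rho> R \<sigma>)" if r: "r \<in> carrier R" for r
    proof -
      have "\<sigma> r \<in> \<rho> ` carrier E" unfolding \<rho>_surj using hom_in_carrier[OF \<sigma> r] .
      then obtain e where "e \<in> carrier E" "\<sigma> r = \<rho> e" by (rule imageE)
      then have "(e, r) \<in> carrier (fibre_product E \<rho> R \<sigma>)" using r by (simp add: fibre_product_simps)
      then show ?thesis by force
    qed
    then show ?thesis
      by (auto simp: epi_def hom_def fibre_product_simps)
  qed
  moreover have "(\<lambda>a. (\<iota> a, \<one>\<^bsub>R\<^esub>)) ` carrier A = kernel (fibre_product E \<rho> R \<sigma>) R snd"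
  proof (intro equalityI subsetI)
    fix x assume "x \<in> (\<lambda>a. (\<iota> a, \<one>\<^bsub>R\<^esub>)) ` carrier A"
    then show "x \<in> kernel (fibre_product E \<rho> R \<sigma>) R snd"
      by (auto simp: kernel_def fibre_product_simps \<iota>_ker \<sigma>1)
  next
    fix x assume "x \<in> kernel (fibre_product E \<rho> R \<sigma>) R snd"
    then have x: "fst x \<in> carrier E" "snd x = \<one>\<^bsub>R\<^esub>" "\<rho> (fst x) = \<one>\<^bsub>Q\<^esub>"
      by (auto simp: kernel_def fibre_product_simps \<sigma>1)
    then have "fst x \<in> \<iota> ` carrier A" unfolding ker by (simp add: kernel_def)
    then obtain a where "fst x = \<iota> a" "a \<in> carrier A" by (rule imageE)
    then show "x \<in> (\<lambda>a. (\<iota> a, \<one>\<^bsub>R\<^esub>)) ` carrier A"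
      using x(2) by (intro image_eqI[of _ _ a]) (simp_all add: prod_eq_iff)
  qed
  ultimately show ?thesis
    unfolding group_extension_def
    using A R group_fibre_product[OF E R Q \<rho>_hom \<sigma>] by simp
qed

section \<open>The three spaces as quotients by discrete subgroups\<close>

context
  fixes T :: "('n::finite, 'l) tiling"
    and Spin :: "('s::topological_space) monoid" (structure)
    and \<pi> :: "'s \<Rightarrow> real ^ 'n ^ 'n"
  assumes T: "tiling T" and per: "periodic T"
    and cov: "universal_covering_group Spin \<pi> special_orthogonal_group"
begin

lemma Spin: "group Spin"
  "continuous_on (carrier Spin \<times> carrier Spin) (\<lambda>(x, y). x \<otimes> y)"
  "continuous_on (carrier Spin) (\<lambda>x. inv x)"
  "\<pi> \<in> hom Spin special_orthogonal_group"
  "covering_space (carrier Spin) \<pi> {A. rotation_matrix A}"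
  "simply_connected (carrier Spin)"
  using cov unfolding universal_covering_group_def by (simp_all add: special_orthogonal_group_def)

lemma pi_rotation: "s \<in> carrier Spin \<Longrightarrow> rotation_matrix (\<pi> s)"
  using hom_in_carrier[OF Spin(4)] by (simp add: special_orthogonal_group_def)

lemma pi_mult: "s \<in> carrier Spin \<Longrightarrow> t \<in> carrier Spin \<Longrightarrow> \<pi> (s \<otimes> t) = \<pi> s ** \<pi> t"
  using hom_mult[OF Spin(4)] by (simp add: special_orthogonal_group_def)

lemma pi_one: "\<pi> \<one> = mat 1"
  using hom_one[OF Spin(4,1) group_special_orthogonal_group] by (simp add: special_orthogonal_group_def)

lemma pi_inv:
  assumes "s \<in> carrier Spin"
  shows "\<pi> (inv s) = transpose (\<pi> s)"
proof -
  have s': "inv s \<in> carrier Spin" using group.inv_closed[OF Spin(1) assms] .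
  have "\<pi> (inv s) ** \<pi> s = mat 1"
    using pi_mult[OF s' assms] group.l_inv[OF Spin(1) assms] pi_one by simp
  then have "\<pi> (inv s) ** \<pi> s ** transpose (\<pi> s) = transpose (\<pi> s)" by simp
  then show ?thesis
    by (simp only: rotation_matrix_inverse[OF pi_rotation[OF assms]] matrix_mul_rid flip: matrix_mul_assoc)
qed

lemma pi_surj: "\<pi> ` carrier Spin = {A. rotation_matrix A}"
  using covering_space_imp_surjective[OF Spin(5)] .

lemma continuous_pi: "continuous_on (carrier Spin) \<pi>"
  using covering_space_imp_continuous[OF Spin(5)] .

lemma carrier_lifted_point_group:
  "s \<in> carrier (lifted_point_group Spin \<pi> T) \<longleftrightarrow> s \<in> carrier Spin \<and> (\<exists>v. act (motion (\<pi> s) v) T = T)"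
  unfolding lifted_point_group_def using pi_rotation by (auto simp: carrier_point_group)

lemma group_motion_cover: "group (motion_cover Spin \<pi>)"
proof (rule groupI)
  interpret group Spin by (rule Spin(1))
  fix x assume x: "x \<in> carrier (motion_cover Spin \<pi>)"
  then have s: "fst x \<in> carrier Spin" by (auto simp: motion_cover_def)
  let ?y = "(inv (fst x), - (\<pi> (inv (fst x)) *v snd x))"
  have "?y \<in> carrier (motion_cover Spin \<pi>)" using s by (simp add: motion_cover_def)
  moreover have "?y \<otimes>\<^bsub>motion_cover Spin \<pi>\<^esub> x = \<one>\<^bsub>motion_cover Spin \<pi>\<^esub>"
    using s by (simp add: motion_cover_def)
  ultimately show "\<exists>y\<in>carrier (motion_cover Spin \<pi>). y \<otimes>\<^bsub>motion_cover Spin \<pi>\<^esub> x = \<one>\<^bsub>motion_cover Spin \<pi>\<^esub>"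
    by blast
next
  interpret group Spin by (rule Spin(1))
  fix x y assume "x \<in> carrier (motion_cover Spin \<pi>)" "y \<in> carrier (motion_cover Spin \<pi>)"
  then show "x \<otimes>\<^bsub>motion_cover Spin \<pi>\<^esub> y \<in> carrier (motion_cover Spin \<pi>)"
    by (auto simp: motion_cover_def)
next
  interpret group Spin by (rule Spin(1))
  show "\<one>\<^bsub>motion_cover Spin \<pi>\<^esub> \<in> carrier (motion_cover Spin \<pi>)"
    by (auto simp: motion_cover_def)
next
  interpret group Spin by (rule Spin(1))
  fix x y z
  assume "x \<in> carrier (motion_cover Spin \<pi>)" "y \<in> carrier (motion_cover Spin \<pi>)" "z \<in> carrier (motion_cover Spin \<pi>)"
  then have "fst x \<in> carrier Spin" "fst y \<in> carrier Spin" "fst z \<in> carrier Spin"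
    by (auto simp: motion_cover_def)
  then show "x \<otimes>\<^bsub>motion_cover Spin \<pi>\<^esub> y \<otimes>\<^bsub>motion_cover Spin \<pi>\<^esub> z =
      x \<otimes>\<^bsub>motion_cover Spin \<pi>\<^esub> (y \<otimes>\<^bsub>motion_cover Spin \<pi>\<^esub> z)"
    by (simp add: motion_cover_def m_assoc pi_mult matrix_vector_right_distrib matrix_vector_mul_assoc)
next
  interpret group Spin by (rule Spin(1))
  fix x assume "x \<in> carrier (motion_cover Spin \<pi>)"
  then have "fst x \<in> carrier Spin" by (auto simp: motion_cover_def)
  then show "\<one>\<^bsub>motion_cover Spin \<pi>\<^esub> \<otimes>\<^bsub>motion_cover Spin \<pi>\<^esub> x = x"
    by (simp add: motion_cover_def pi_one prod_eq_iff)
qed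

lemma inv_motion_cover:
  assumes "x \<in> carrier (motion_cover Spin \<pi>)"
  shows "inv\<^bsub>motion_cover Spin \<pi>\<^esub> x = (inv (fst x), - (transpose (\<pi> (fst x)) *v snd x))"
proof (rule group.inv_equality[OF group_motion_cover _ assms])
  have s: "fst x \<in> carrier Spin" using assms by (auto simp: motion_cover_def)
  show "(inv (fst x), - (transpose (\<pi> (fst x)) *v snd x)) \<in> carrier (motion_cover Spin \<pi>)"
    using group.inv_closed[OF Spin(1) s] by (simp add: motion_cover_def)
  show "(inv (fst x), - (transpose (\<pi> (fst x)) *v snd x)) \<otimes>\<^bsub>motion_cover Spin \<pi>\<^esub> x = \<one>\<^bsub>motion_cover Spin \<pi>\<^esub>"
    using group.l_inv[OF Spin(1) s] by (simp add: motion_cover_def pi_inv[OF s])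
qed

lemma cover_act_mult:
  assumes "x \<in> carrier (motion_cover Spin \<pi>)" "y \<in> carrier (motion_cover Spin \<pi>)"
  shows "cover_act \<pi> T (x \<otimes>\<^bsub>motion_cover Spin \<pi>\<^esub> y) = act (motion (\<pi> (fst x)) (snd x)) (cover_act \<pi> T y)"
proof -
  have "fst x \<in> carrier Spin" "fst y \<in> carrier Spin" using assms by (auto simp: motion_cover_def)
  then show ?thesis
    unfolding cover_act_def act_comp motion_comp by (simp add: motion_cover_def pi_mult)
qed

text \<open>Undoing the motion of \<open>x\<close> on both sides turns equality of the two tilings
  into stabilisation of \<open>T\<close>, so the fibres of the orbit map are left cosets of the
  stabiliser.\<close>

lemma cover_act_eq_iff:
  assumes x: "x \<in> carrier (motion_cover Spin \<pi>)" and y: "y \<in> carrier (motion_cover Spin \<pi>)"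
  shows "cover_act \<pi> T x = cover_act \<pi> T y \<longleftrightarrow> inv\<^bsub>motion_cover Spin \<pi>\<^esub> x \<otimes>\<^bsub>motion_cover Spin \<pi>\<^esub> y \<in> cover_stabiliser Spin \<pi> T"
proof -
  interpret M: group "motion_cover Spin \<pi>" by (rule group_motion_cover)
  have s: "fst x \<in> carrier Spin" using x by (auto simp: motion_cover_def)
  note rot = pi_rotation[OF s]
  let ?m = "motion (\<pi> (fst x)) (snd x)" and ?n = "motion (transpose (\<pi> (fst x))) (- (transpose (\<pi> (fst x)) *v snd x))"
  have "cover_act \<pi> T (inv\<^bsub>motion_cover Spin \<pi>\<^esub> x \<otimes>\<^bsub>motion_cover Spin \<pi>\<^esub> y) = act ?n (cover_act \<pi> T y)"
    using cover_act_mult[OF M.inv_closed[OF x] y] by (simp add: inv_motion_cover[OF x] pi_inv[OF s])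
  then have "inv\<^bsub>motion_cover Spin \<pi>\<^esub> x \<otimes>\<^bsub>motion_cover Spin \<pi>\<^esub> y \<in> cover_stabiliser Spin \<pi> T \<longleftrightarrow> act ?n (cover_act \<pi> T y) = T"
    unfolding cover_stabiliser_def using x y by simp
  also have "\<dots> \<longleftrightarrow> cover_act \<pi> T x = cover_act \<pi> T y"
  proof
    assume "act ?n (cover_act \<pi> T y) = T"
    then have "act ?m (act ?n (cover_act \<pi> T y)) = cover_act \<pi> T x" by (simp add: cover_act_def)
    then show "cover_act \<pi> T x = cover_act \<pi> T y" unfolding act_motion_inverse(2)[OF rot] by simp
  next
    assume "cover_act \<pi> T x = cover_act \<pi> T y"
    then have "act ?n (cover_act \<pi> T y) = act ?n (act ?m T)" by (simp add: cover_act_def)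
    then show "act ?n (cover_act \<pi> T y) = T" unfolding act_motion_inverse(1)[OF rot] .
  qed
  finally show ?thesis by simp
qed

lemma subgroup_cover_stabiliser: "subgroup (cover_stabiliser Spin \<pi> T) (motion_cover Spin \<pi>)"
proof -
  interpret M: group "motion_cover Spin \<pi>" by (rule group_motion_cover)
  have one: "cover_act \<pi> T \<one>\<^bsub>motion_cover Spin \<pi>\<^esub> = T"
    by (simp add: cover_act_def motion_cover_def pi_one motion_id)
  show ?thesis
  proof (rule M.subgroupI)
    show "cover_stabiliser Spin \<pi> T \<subseteq> carrier (motion_cover Spin \<pi>)"
      unfolding cover_stabiliser_def by blast
    show "cover_stabiliser Spin \<pi> T \<noteq> {}"
      using one M.one_closed unfolding cover_stabiliser_def by blast
  next
    fix x assume x: "x \<in> cover_stabiliser Spin \<pi> T"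
    then have "x \<in> carrier (motion_cover Spin \<pi>)" "cover_act \<pi> T x = T"
      unfolding cover_stabiliser_def by blast+
    then show "inv\<^bsub>motion_cover Spin \<pi>\<^esub> x \<in> cover_stabiliser Spin \<pi> T"
      using cover_act_eq_iff[of x "\<one>\<^bsub>motion_cover Spin \<pi>\<^esub>"] one by simp
  next
    fix x y assume "x \<in> cover_stabiliser Spin \<pi> T" "y \<in> cover_stabiliser Spin \<pi> T"
    then have xy: "x \<in> carrier (motion_cover Spin \<pi>)" "cover_act \<pi> T x = T"
      "y \<in> carrier (motion_cover Spin \<pi>)" "cover_act \<pi> T y = T"
      unfolding cover_stabiliser_def by blast+
    have "cover_act \<pi> T (x \<otimes>\<^bsub>motion_cover Spin \<pi>\<^esub> y) = T"
      using cover_act_mult[OF xy(1,3)] xy(2,4) by (simp add: cover_act_def)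
    then show "x \<otimes>\<^bsub>motion_cover Spin \<pi>\<^esub> y \<in> cover_stabiliser Spin \<pi> T"
      unfolding cover_stabiliser_def using xy by simp
  qed
qed

lemma subgroup_lifted_point_group: "subgroup (carrier (lifted_point_group Spin \<pi> T)) Spin"
proof -
  interpret group_hom Spin special_orthogonal_group \<pi>
    by (intro group_hom.intro group_hom_axioms.intro Spin group_special_orthogonal_group)
  interpret G: subgroup "carrier (point_group T)" special_orthogonal_group
    by (rule subgroup_point_group)
  show ?thesis
    unfolding lifted_point_group_def
    by (rule G.subgroupI) (auto simp: G.m_closed hom_inv intro: exI[of _ "\<one>"])
qed

text \<open>The neighbourhood is a sheet on which \<open>\<pi>\<close> is injective, cut down to
  matrices so near the identity that no other element of the point group occurs.\<close>

lemma lifted_point_group_discrete: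
  "\<exists>O'. openin (top_of_set (carrier Spin)) O' \<and> O' \<inter> carrier (lifted_point_group Spin \<pi> T) = {\<one>}"
proof -
  have one: "\<one> \<in> carrier Spin" by (rule monoid.one_closed[OF group.is_monoid[OF Spin(1)]])
  obtain V W q where V: "\<one> \<in> V" "openin (top_of_set (carrier Spin)) V"
    and "\<pi> \<one> \<in> W" "openin (top_of_set {A. rotation_matrix A}) W" and h: "homeomorphism V W \<pi> q"
    by (rule covering_space_local_homeomorphism[OF Spin(5) one])
  have inj: "inj_on \<pi> V" by (rule inj_on_inverseI) (rule homeomorphism_apply1[OF h])
  obtain \<epsilon> where \<epsilon>: "\<epsilon> > 0" "\<forall>A\<in>carrier (point_group T). dist A (mat 1) < \<epsilon> \<longrightarrow> A = mat 1"
    using point_group_discrete[OF T per] by (elim exE conjE)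
  let ?O = "V \<inter> (carrier Spin \<inter> \<pi> -` ball (mat 1) \<epsilon>)"
  have "openin (top_of_set (carrier Spin)) (carrier Spin \<inter> \<pi> -` ball (mat 1) \<epsilon>)"
    using continuous_openin_preimage_gen[OF continuous_pi open_ball] by simp
  then have "openin (top_of_set (carrier Spin)) ?O" by (rule openin_Int[OF V(2)])
  moreover have "?O \<inter> carrier (lifted_point_group Spin \<pi> T) = {\<one>}"
  proof (intro equalityI subsetI)
    fix s assume "s \<in> ?O \<inter> carrier (lifted_point_group Spin \<pi> T)"
    then have s: "s \<in> V" "dist (\<pi> s) (mat 1) < \<epsilon>" "\<pi> s \<in> carrier (point_group T)"
      by (auto simp: lifted_point_group_def dist_commute)
    then have "\<pi> s = \<pi> \<one>" using \<epsilon>(2) pi_one by simp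
    then show "s \<in> {\<one>}" using inj_onD[OF inj _ s(1) V(1)] by simp
  next
    fix s assume "s \<in> {\<one>}"
    then show "s \<in> ?O \<inter> carrier (lifted_point_group Spin \<pi> T)"
      using V(1) one \<epsilon>(1) pi_one subgroup.one_closed[OF subgroup_lifted_point_group] by simp
  qed
  ultimately show ?thesis by blast
qed

text \<open>The hull topology is known on \<open>{mat 1} \<times> UNIV\<close>; the open embedding
  of vectors as the second component transfers it to the vector group.\<close>

lemma translational_quotient:
  "discrete_quotient vector_group (carrier (translation_group T)) (\<lambda>x. act ((+) x) T)
     (hull_topology (translational_hull T))"
proof (intro discrete_quotient.intro discrete_quotient_axioms.intro group_vector_group)
  have c: "carrier vector_group = (UNIV :: (real ^ 'n) set)" by (simp add: vector_group_def)
  show "continuous_on (carrier vector_group \<times> carrier vector_group) (\<lambda>(x, y). x \<otimes>\<^bsub>vector_group\<^esub> y :: real ^ 'n)"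
    by (simp add: vector_group_def case_prod_unfold continuous_intros)
  show "continuous_on (carrier vector_group) (\<lambda>x. inv\<^bsub>vector_group\<^esub> x :: real ^ 'n)"
    unfolding inv_vector_group by (intro continuous_intros)
  show "simply_connected (carrier vector_group :: (real ^ 'n) set)"
    unfolding c by (intro convex_imp_simply_connected convex_UNIV)
  show "subgroup (carrier (translation_group T)) vector_group"
  proof (rule group.subgroupI[OF group_vector_group])
    show "carrier (translation_group T) \<noteq> {}"
      using monoid.one_closed[OF group.is_monoid[OF group_translation_group]] by blast
    show "inv\<^bsub>vector_group\<^esub> a \<in> carrier (translation_group T)" if "a \<in> carrier (translation_group T)" for a
      using that translation_period_neg unfolding inv_vector_group by (simp add: translation_group_def)
    show "a \<otimes>\<^bsub>vector_group\<^esub> b \<in> carrier (translation_group T)"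
      if "a \<in> carrier (translation_group T)" "b \<in> carrier (translation_group T)" for a b
      using monoid.m_closed[OF group.is_monoid[OF group_translation_group] that]
      by (simp add: translation_group_def vector_group_def)
  qed (simp add: c)
  obtain r where r: "r > 0" "\<forall>x. act ((+) x) T = T \<longrightarrow> norm x < r \<longrightarrow> x = 0"
    using translation_periods_discrete[OF T] by (elim exE conjE)
  have "act ((+) 0) T = T" unfolding motion_one[symmetric] motion_id by simp
  then have "ball 0 r \<inter> carrier (translation_group T) = {\<one>\<^bsub>vector_group\<^esub>}"
    using r by (auto simp: translation_group_def vector_group_def)
  then show "\<exists>O'. openin (top_of_set (carrier vector_group)) O' \<and> O' \<inter> carrier (translation_group T) = {\<one>\<^bsub>vector_group\<^esub>}"
    by (intro exI[of _ "ball 0 r"]) (simp add: c)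
  fix U
  have orbit: "motion_orbit {mat 1} T = (\<lambda>x. act ((+) x) T) ` carrier vector_group"
    unfolding motion_orbit_def c by (auto simp: motion_one)
  have "openin (top_of_set UNIV) {x \<in> UNIV. (mat 1, x) \<in> {z \<in> {mat 1} \<times> UNIV. act (motion (fst z) (snd z)) T \<in> U}} \<longleftrightarrow>
    openin (top_of_set ({mat 1} \<times> UNIV)) {z \<in> {mat 1} \<times> UNIV. act (motion (fst z) (snd z)) T \<in> U}"
  proof (rule openin_open_map_preimage[where p = "\<lambda>x. (mat 1 :: real ^ 'n ^ 'n, x :: real ^ 'n)"])
    show "continuous_on UNIV (\<lambda>x. (mat 1 :: real ^ 'n ^ 'n, x :: real ^ 'n))" by (intro continuous_intros)
    fix V :: "(real ^ 'n) set" assume "openin (top_of_set UNIV) V"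
    then have "open V" by simp
    then have "openin (top_of_set ({mat 1 :: real ^ 'n ^ 'n} \<times> UNIV)) ({mat 1} \<times> V)"
      by (intro openin_Times) simp_all
    moreover have "(\<lambda>x. (mat 1 :: real ^ 'n ^ 'n, x)) ` V = {mat 1} \<times> V" by auto
    ultimately show "openin (top_of_set ({mat 1 :: real ^ 'n ^ 'n} \<times> UNIV)) ((\<lambda>x. (mat 1, x)) ` V)" by simp
  qed auto
  then show "openin (hull_topology (translational_hull T)) U \<longleftrightarrow> U \<subseteq> (\<lambda>x. act ((+) x) T) ` carrier vector_group \<and>
      openin (top_of_set (carrier vector_group)) {x \<in> carrier vector_group. act ((+) x) T \<in> U}"
    unfolding translational_hull_eq[OF T per]
      openin_hull_topology_motion_orbit[OF compact_rotation_group_trivial T per]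
    unfolding orbit c by (simp add: motion_one)
next
  fix x y :: "real ^ 'n"
  have "act ((+) x) T = act ((+) y) T \<longleftrightarrow> act ((+) (- x + y)) T = T"
  proof
    assume "act ((+) x) T = act ((+) y) T"
    then have "act ((+) (- x)) (act ((+) y) T) = act ((+) (- x)) (act ((+) x) T)" by simp
    then show "act ((+) (- x + y)) T = T"
      unfolding act_comp by (simp add: o_def add.assoc[symmetric] flip: id_def)
  next
    assume "act ((+) (- x + y)) T = T"
    then have "act ((+) x) (act ((+) (- x + y)) T) = act ((+) x) T" by simp
    then show "act ((+) x) T = act ((+) y) T"
      unfolding act_comp by (simp add: o_def add.assoc[symmetric])
  qed
  then show "act ((+) x) T = act ((+) y) T \<longleftrightarrow>
      inv\<^bsub>vector_group\<^esub> x \<otimes>\<^bsub>vector_group\<^esub> y \<in> carrier (translation_group T)"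
    unfolding inv_vector_group by (simp add: vector_group_def translation_group_def)
qed

text \<open>The hull topology is known over pairs of a rotation matrix and a vector, and the
  covering map times the identity is an open surjection onto these pairs.\<close>

lemma rotational_quotient:
  "discrete_quotient (motion_cover Spin \<pi>) (cover_stabiliser Spin \<pi> T) (cover_act \<pi> T)
     (hull_topology (rotational_hull T))"
proof (intro discrete_quotient.intro discrete_quotient_axioms.intro group_motion_cover subgroup_cover_stabiliser)
  let ?M = "motion_cover Spin \<pi>"
  have c: "carrier ?M = carrier Spin \<times> UNIV" by (simp add: motion_cover_def)
  let ?X = "carrier Spin \<times> (UNIV :: (real ^ 'n) set)"
  have "continuous_on (?X \<times> ?X) (\<lambda>z. (\<lambda>(x, y). x \<otimes> y) (fst (fst z), fst (snd z)))"
    by (rule continuous_on_compose2[OF Spin(2)]) (auto intro!: continuous_intros)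
  then have pair: "continuous_on (?X \<times> ?X) (\<lambda>z. fst (fst z) \<otimes> fst (snd z))" by simp
  have pi_fst: "continuous_on (?X \<times> ?X) (\<lambda>z. \<pi> (fst (fst z)))"
    by (rule continuous_on_compose2[OF continuous_pi]) (auto intro!: continuous_intros)
  show "continuous_on (carrier ?M \<times> carrier ?M) (\<lambda>(x, y). x \<otimes>\<^bsub>?M\<^esub> y)"
    unfolding c by (simp add: motion_cover_def case_prod_unfold)
      (intro continuous_intros pair pi_fst)
  have inv_fst: "continuous_on (carrier Spin \<times> (UNIV :: (real ^ 'n) set)) (\<lambda>x. inv (fst x))"
    by (rule continuous_on_compose2[OF Spin(3)]) (auto intro!: continuous_intros)
  have "continuous_on (carrier Spin \<times> (UNIV :: (real ^ 'n) set)) (\<lambda>x. \<pi> (inv (fst x)))"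
    by (rule continuous_on_compose2[OF continuous_pi inv_fst])
      (use group.inv_closed[OF Spin(1)] in auto)
  then have "continuous_on (carrier ?M) (\<lambda>x. (inv (fst x), - (\<pi> (inv (fst x)) *v snd x)))"
    unfolding c by (intro continuous_intros inv_fst)
  then show "continuous_on (carrier ?M) (\<lambda>x. inv\<^bsub>?M\<^esub> x)"
    by (rule continuous_on_eq) (use inv_motion_cover pi_inv in \<open>auto simp: c\<close>)
  show "simply_connected (carrier ?M)"
    unfolding c by (intro simply_connected_prod Spin(6) convex_imp_simply_connected convex_UNIV)
  obtain O' where O': "openin (top_of_set (carrier Spin)) O'" "O' \<inter> carrier (lifted_point_group Spin \<pi> T) = {\<one>}"
    using lifted_point_group_discrete by (elim exE conjE)
  obtain r where r: "r > 0" "\<forall>x. act ((+) x) T = T \<longrightarrow> norm x < r \<longrightarrow> x = 0"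
    using translation_periods_discrete[OF T] by (elim exE conjE)
  have "openin (top_of_set (carrier ?M)) (O' \<times> ball 0 r)"
    unfolding c by (intro openin_Times O'(1)) simp
  \<comment> \<open>A stabilising element has its first component in the lifted point group, so
    \<open>O'\<close> forces that component to be the identity; what remains is a translational
    period shorter than \<open>r\<close>.\<close>
  moreover have "(O' \<times> ball 0 r) \<inter> cover_stabiliser Spin \<pi> T = {\<one>\<^bsub>?M\<^esub>}"
  proof (intro equalityI subsetI)
    fix x assume x: "x \<in> (O' \<times> ball 0 r) \<inter> cover_stabiliser Spin \<pi> T"
    then have s: "fst x \<in> O'" "fst x \<in> carrier Spin" "norm (snd x) < r" "act (motion (\<pi> (fst x)) (snd x)) T = T"
      by (auto simp: cover_stabiliser_def cover_act_def c)
    then have "fst x \<in> carrier (lifted_point_group Spin \<pi> T)"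
      unfolding carrier_lifted_point_group by blast
    then have 1: "fst x = \<one>" using s(1) O'(2) by blast
    then have "act ((+) (snd x)) T = T" using s(4) by (simp add: pi_one motion_one)
    then have "snd x = 0" using r(2) s(3) by blast
    then show "x \<in> {\<one>\<^bsub>?M\<^esub>}" using 1 by (simp add: motion_cover_def prod_eq_iff)
  next
    fix x assume "x \<in> {\<one>\<^bsub>?M\<^esub>}"
    then have x: "x = \<one>\<^bsub>?M\<^esub>" by simp
    have "\<one> \<in> O'" using O'(2) by blast
    then show "x \<in> (O' \<times> ball 0 r) \<inter> cover_stabiliser Spin \<pi> T"
      using subgroup.one_closed[OF subgroup_cover_stabiliser] r(1) unfolding x by (simp add: motion_cover_def)
  qed
  ultimately show "\<exists>O'. openin (top_of_set (carrier ?M)) O' \<and> O' \<inter> cover_stabiliser Spin \<pi> T = {\<one>\<^bsub>?M\<^esub>}"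
    by blast
  fix U
  let ?R = "{A :: real ^ 'n ^ 'n. rotation_matrix A}"
  let ?p = "\<lambda>x :: 's \<times> (real ^ 'n). (\<pi> (fst x), snd x)"
  have p_image: "?p ` (carrier Spin \<times> UNIV) = ?R \<times> UNIV"
    unfolding pi_surj[symmetric] by force
  have orbit: "motion_orbit ?R T = cover_act \<pi> T ` carrier ?M"
  proof -
    have "motion_orbit ?R T = (\<lambda>z. act (motion (fst z) (snd z)) T) ` (?R \<times> UNIV)"
      unfolding motion_orbit_def by force
    also have "\<dots> = (\<lambda>x. act (motion (\<pi> (fst x)) (snd x)) T) ` (carrier Spin \<times> UNIV)"
      unfolding p_image[symmetric] image_image by simp
    finally show ?thesis unfolding c cover_act_def .
  qed
  have preimage: "openin (top_of_set (carrier Spin \<times> UNIV)) {x \<in> carrier Spin \<times> UNIV. ?p x \<in> {z \<in> ?R \<times> UNIV. act (motion (fst z) (snd z)) T \<in> U}} \<longleftrightarrow>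
    openin (top_of_set (?R \<times> UNIV)) {z \<in> ?R \<times> UNIV. act (motion (fst z) (snd z)) T \<in> U}"
  proof (rule openin_open_map_preimage[OF _ p_image])
    have "continuous_on (carrier Spin \<times> (UNIV :: (real ^ 'n) set)) (\<lambda>x. \<pi> (fst x))"
      by (rule continuous_on_compose2[OF continuous_pi]) (auto intro!: continuous_intros)
    then show "continuous_on (carrier Spin \<times> UNIV) ?p" by (intro continuous_intros)
    fix V assume V: "openin (top_of_set (carrier Spin \<times> (UNIV :: (real ^ 'n) set))) V"
    show "openin (top_of_set (?R \<times> UNIV)) (?p ` V)"
    \<comment> \<open>Openness need only be checked on product boxes, where the image is a product
      of images.\<close>
    proof (subst openin_subopen, intro ballI)
      fix z assume "z \<in> ?p ` V"
      then obtain s v where sv: "(s, v) \<in> V" "z = (\<pi> s, v)" by force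
      from openin_prod_topology_alt[THEN iffD1, rule_format, OF V[folded prod_topology_top_of_set] sv(1)]
      obtain A B where AB: "openin (top_of_set (carrier Spin)) A" "openin (top_of_set UNIV) B" "s \<in> A" "v \<in> B" "A \<times> B \<subseteq> V"
        by (elim exE conjE)
      have "openin (top_of_set (?R \<times> UNIV)) (\<pi> ` A \<times> B)"
        using covering_space_open_map'[OF Spin(5) AB(1)] AB(2) by (rule openin_Times)
      moreover have "z \<in> \<pi> ` A \<times> B" using AB(3,4) sv(2) by blast
      moreover have "\<pi> ` A \<times> B \<subseteq> ?p ` V" using AB(5) by force
      ultimately show "\<exists>W. openin (top_of_set (?R \<times> UNIV)) W \<and> z \<in> W \<and> W \<subseteq> ?p ` V" by blast
    qed
  qed blast
  have eq: "{x \<in> carrier Spin \<times> UNIV. ?p x \<in> {z \<in> ?R \<times> UNIV. act (motion (fst z) (snd z)) T \<in> U}} =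
      {x \<in> carrier ?M. cover_act \<pi> T x \<in> U}"
    unfolding c cover_act_def using pi_rotation by auto
  have "openin (hull_topology (rotational_hull T)) U \<longleftrightarrow> U \<subseteq> motion_orbit ?R T \<and>
      openin (top_of_set (?R \<times> UNIV)) {z \<in> ?R \<times> UNIV. act (motion (fst z) (snd z)) T \<in> U}"
    unfolding rotational_hull_eq[OF T per]
    by (rule openin_hull_topology_motion_orbit[OF compact_rotation_group_all T per])
  then show "openin (hull_topology (rotational_hull T)) U \<longleftrightarrow> U \<subseteq> cover_act \<pi> T ` carrier ?M \<and>
      openin (top_of_set (carrier ?M)) {x \<in> carrier ?M. cover_act \<pi> T x \<in> U}"
    unfolding preimage[symmetric] eq orbit unfolding c .
qed (rule cover_act_eq_iff)

lemma coset_quotient: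
  "discrete_quotient Spin (carrier (lifted_point_group Spin \<pi> T)) (\<lambda>s. s <# carrier (lifted_point_group Spin \<pi> T))
     (coset_topology Spin (carrier (lifted_point_group Spin \<pi> T)))"
proof (intro discrete_quotient.intro discrete_quotient_axioms.intro Spin
    subgroup_lifted_point_group lifted_point_group_discrete)
  let ?H = "carrier (lifted_point_group Spin \<pi> T)"
  have "lcosets ?H = (\<lambda>s. s <# ?H) ` carrier Spin" unfolding LCOSETS_def by blast
  then show "openin (coset_topology Spin ?H) U \<longleftrightarrow> U \<subseteq> (\<lambda>s. s <# ?H) ` carrier Spin \<and>
      openin (top_of_set (carrier Spin)) {s \<in> carrier Spin. s <# ?H \<in> U}" for U
    unfolding openin_coset_topology by simp
qed (rule group.l_coset_eq_iff[OF Spin(1) subgroup_lifted_point_group])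

section \<open>The maps between the quotients and the canonical identifications\<close>

interpretation Xt: discrete_quotient vector_group "carrier (translation_group T)" "\<lambda>x. act ((+) x) T"
  "hull_topology (translational_hull T)"
  by (rule translational_quotient)

interpretation Xr: discrete_quotient "motion_cover Spin \<pi>" "cover_stabiliser Spin \<pi> T" "cover_act \<pi> T"
  "hull_topology (rotational_hull T)"
  by (rule rotational_quotient)

interpretation B: discrete_quotient Spin "carrier (lifted_point_group Spin \<pi> T)"
  "\<lambda>s. s <# carrier (lifted_point_group Spin \<pi> T)" "coset_topology Spin (carrier (lifted_point_group Spin \<pi> T))"
  by (rule coset_quotient)

lemma base_Xt: "act ((+) \<one>\<^bsub>vector_group\<^esub>) T = T"
  unfolding vector_group_def by (simp add: motion_id flip: motion_one)

lemma base_Xr: "cover_act \<pi> T \<one>\<^bsub>motion_cover Spin \<pi>\<^esub> = T"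
  by (simp add: cover_act_def motion_cover_def pi_one motion_id)

text \<open>Two ways of writing one tiling as a rotated member of the translational hull differ by
  an element of the stabiliser, whose first component lies in the lifted point group. So the
  description by \<open>THE\<close> is well defined and the orientation map is induced by
  \<open>fst\<close>.\<close>

lemma orientation_map_cover_act:
  assumes x: "x \<in> carrier (motion_cover Spin \<pi>)"
  shows "orientation_map Spin \<pi> T (cover_act \<pi> T x) = fst x <# carrier (lifted_point_group Spin \<pi> T)"
proof -
  have sx: "fst x \<in> carrier Spin" using x by (auto simp: motion_cover_def)
  have hull: "T' \<in> translational_hull T \<longleftrightarrow> (\<exists>w. T' = act ((+) w) T)" for T'
    unfolding translational_hull_eq[OF T per] motion_orbit_def by (auto simp: motion_one)
  have rotate: "act ((*v) A) (act ((+) w) T) = act (motion A (A *v w)) T" for A w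
    unfolding act_comp
    by (rule arg_cong2[where f = act]) (simp_all add: fun_eq_iff motion_def matrix_vector_right_distrib)
  show ?thesis
    unfolding orientation_map_def
  proof (rule the_equality)
    \<comment> \<open>A motion with rotation \<open>A\<close> and vector \<open>v\<close> is
      translation by \<open>transpose A *v v\<close> followed by the rotation.\<close>
    let ?w = "transpose (\<pi> (fst x)) *v snd x"
    have "cover_act \<pi> T x = act ((*v) (\<pi> (fst x))) (act ((+) ?w) T)"
      unfolding rotate cover_act_def rotation_matrix_cancel[OF pi_rotation[OF sx]] ..
    then show "\<exists>s\<in>carrier Spin. \<exists>T'\<in>translational_hull T.
        cover_act \<pi> T x = act ((*v) (\<pi> s)) T' \<and>
        fst x <# carrier (lifted_point_group Spin \<pi> T) = s <# carrier (lifted_point_group Spin \<pi> T)"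
      using sx hull by blast
  next
    fix C assume "\<exists>s\<in>carrier Spin. \<exists>T'\<in>translational_hull T.
        cover_act \<pi> T x = act ((*v) (\<pi> s)) T' \<and> C = s <# carrier (lifted_point_group Spin \<pi> T)"
    then obtain s T' where s: "s \<in> carrier Spin" "T' \<in> translational_hull T"
      "cover_act \<pi> T x = act ((*v) (\<pi> s)) T'" "C = s <# carrier (lifted_point_group Spin \<pi> T)"
      by (elim bexE conjE)
    obtain w where w: "T' = act ((+) w) T" using s(2) unfolding hull by (elim exE)
    let ?y = "(s, \<pi> s *v w)"
    have y: "?y \<in> carrier (motion_cover Spin \<pi>)" using s(1) by (simp add: motion_cover_def)
    have "cover_act \<pi> T ?y = cover_act \<pi> T x"
      unfolding s(3) w rotate by (simp add: cover_act_def)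
    then have "inv\<^bsub>motion_cover Spin \<pi>\<^esub> ?y \<otimes>\<^bsub>motion_cover Spin \<pi>\<^esub> x \<in> cover_stabiliser Spin \<pi> T"
      using Xr.q_eq_iff[OF y x] by simp
    then have "fst (inv\<^bsub>motion_cover Spin \<pi>\<^esub> ?y \<otimes>\<^bsub>motion_cover Spin \<pi>\<^esub> x) \<in> carrier (lifted_point_group Spin \<pi> T)"
      unfolding cover_stabiliser_def carrier_lifted_point_group cover_act_def
      by (auto simp: motion_cover_def)
    then have "inv s \<otimes> fst x \<in> carrier (lifted_point_group Spin \<pi> T)"
      unfolding inv_motion_cover[OF y] by (simp add: motion_cover_def)
    then show "C = fst x <# carrier (lifted_point_group Spin \<pi> T)"
      unfolding s(4) using B.q_eq_iff[OF s(1) sx] by simp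
  qed
qed

lemma base_B: "orientation_map Spin \<pi> T T = \<one> <# carrier (lifted_point_group Spin \<pi> T)"
  using orientation_map_cover_act[OF Xr.one_closed] unfolding base_Xr by (simp add: motion_cover_def)

text \<open>The straight segment from \<open>x\<close> to the origin is a lift of the loop in
  question.\<close>

lemma translation_loop_class_eq:
  assumes x: "x \<in> carrier (translation_group T)"
  shows "translation_loop_class T x = lift_class vector_group (\<lambda>x. act ((+) x) T) x"
proof -
  have "(\<lambda>t. act ((+) ((1 - t) *\<^sub>R x)) T) \<in> lift_class vector_group (\<lambda>x. act ((+) x) T) x"
    unfolding lift_class_def
    by (intro CollectI exI[of _ "\<lambda>t. (1 - t) *\<^sub>R x"] conjI continuous_intros) (simp_all add: vector_group_def)
  from Xt.loop_class_eq[OF x this] show ?thesis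
    unfolding translation_loop_class_def base_Xt .
qed

text \<open>Every path from \<open>g\<close> to the identity is itself a lift of its image, so all
  choices yield one class and \<open>THE\<close> is justified.\<close>

lemma coset_loop_class_eq:
  assumes g: "g \<in> carrier (lifted_point_group Spin \<pi> T)"
  shows "coset_loop_class Spin (carrier (lifted_point_group Spin \<pi> T)) g =
    lift_class Spin (\<lambda>s. s <# carrier (lifted_point_group Spin \<pi> T)) g"
  unfolding coset_loop_class_def
proof (rule the_equality)
  let ?H = "carrier (lifted_point_group Spin \<pi> T)"
  have eq: "loop_class (coset_topology Spin ?H) (\<one> <# ?H) (\<lambda>t. \<gamma> t <# ?H) = lift_class Spin (\<lambda>s. s <# ?H) g"
    if "path \<gamma>" "path_image \<gamma> \<subseteq> carrier Spin" "pathstart \<gamma> = g" "pathfinish \<gamma> = \<one>" for \<gamma>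
  proof (rule B.loop_class_eq[OF g])
    show "(\<lambda>t. \<gamma> t <# ?H) \<in> lift_class Spin (\<lambda>s. s <# ?H) g"
      unfolding lift_class_def using that
      by (intro CollectI exI[of _ \<gamma>]) (simp add: path_def path_image_def pathstart_def pathfinish_def)
  qed
  obtain \<gamma> where \<gamma>: "continuous_on {0..1::real} \<gamma>" "\<gamma> ` {0..1} \<subseteq> carrier Spin" "\<gamma> 0 = g" "\<gamma> 1 = \<one>"
    using B.carrier_path[OF B.H_carrier[OF g]] by (elim exE conjE)
  then have \<gamma>': "path \<gamma>" "path_image \<gamma> \<subseteq> carrier Spin" "pathstart \<gamma> = g" "pathfinish \<gamma> = \<one>"
    by (simp_all add: path_def path_image_def pathstart_def pathfinish_def)
  show "\<exists>\<gamma>. path \<gamma> \<and> path_image \<gamma> \<subseteq> carrier Spin \<and> pathstart \<gamma> = g \<and> pathfinish \<gamma> = \<one> \<and>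
      lift_class Spin (\<lambda>s. s <# ?H) g = loop_class (coset_topology Spin ?H) (\<one> <# ?H) (\<lambda>t. \<gamma> t <# ?H)"
    using \<gamma>' eq[OF \<gamma>'] by (intro exI[of _ \<gamma>]) simp
  fix C assume "\<exists>\<gamma>. path \<gamma> \<and> path_image \<gamma> \<subseteq> carrier Spin \<and> pathstart \<gamma> = g \<and> pathfinish \<gamma> = \<one> \<and>
      C = loop_class (coset_topology Spin ?H) (\<one> <# ?H) (\<lambda>t. \<gamma> t <# ?H)"
  then obtain \<delta> where "path \<delta>" "path_image \<delta> \<subseteq> carrier Spin" "pathstart \<delta> = g" "pathfinish \<delta> = \<one>"
      "C = loop_class (coset_topology Spin ?H) (\<one> <# ?H) (\<lambda>t. \<delta> t <# ?H)"
    by (elim exE conjE)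
  then show "C = lift_class Spin (\<lambda>s. s <# ?H) g" using eq by simp
qed

text \<open>For \<open>(f, s)\<close> in the pullback the linear part of \<open>f\<close> is
  \<open>\<pi> s\<close>, so \<open>f\<close> is recovered from \<open>s\<close> and
  \<open>f 0\<close>; its fixing \<open>T\<close> is the stabiliser condition.\<close>

lemma fibre_product_iso_stabiliser:
  "(\<lambda>x. (snd x, fst x 0)) \<in>
     iso (fibre_product (positive_space_group T) linear_part (lifted_point_group Spin \<pi> T) \<pi>)
       ((motion_cover Spin \<pi>)\<lparr>carrier := cover_stabiliser Spin \<pi> T\<rparr>)"
proof -
  let ?P = "fibre_product (positive_space_group T) linear_part (lifted_point_group Spin \<pi> T) \<pi>"
  let ?\<psi> = "\<lambda>x. (snd x, fst x 0) :: 's \<times> (real ^ 'n)"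
  have P: "snd x \<in> carrier Spin \<and> fst x = motion (\<pi> (snd x)) (fst x 0) \<and> act (fst x) T = T"
    if x: "x \<in> carrier ?P" for x
  proof -
    obtain A v where A: "fst x = motion A v" "act (fst x) T = T"
      using x unfolding fibre_product_simps carrier_positive_space_group by blast
    have "linear_part (fst x) = \<pi> (snd x)" "snd x \<in> carrier Spin"
      using x unfolding fibre_product_simps carrier_lifted_point_group by blast+
    then have "A = \<pi> (snd x)" unfolding A(1) linear_part_motion by simp
    moreover have "fst x 0 = v" unfolding A(1) motion_def by simp
    ultimately show ?thesis using A \<open>snd x \<in> carrier Spin\<close> by simp
  qed
  have "?\<psi> \<in> hom ?P ((motion_cover Spin \<pi>)\<lparr>carrier := cover_stabiliser Spin \<pi> T\<rparr>)"
  proof (rule homI)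
    fix x assume x: "x \<in> carrier ?P"
    show "?\<psi> x \<in> carrier ((motion_cover Spin \<pi>)\<lparr>carrier := cover_stabiliser Spin \<pi> T\<rparr>)"
      using P[OF x] by (simp add: cover_stabiliser_def motion_cover_def cover_act_def)
    fix y assume y: "y \<in> carrier ?P"
    have "fst x = motion (\<pi> (snd x)) (fst x 0)" using P[OF x] by blast
    from fun_cong[OF this, of "fst y 0"] have "fst x (fst y 0) = \<pi> (snd x) *v fst y 0 + fst x 0"
      unfolding motion_def .
    then show "?\<psi> (x \<otimes>\<^bsub>?P\<^esub> y) = ?\<psi> x \<otimes>\<^bsub>(motion_cover Spin \<pi>)\<lparr>carrier := cover_stabiliser Spin \<pi> T\<rparr>\<^esub> ?\<psi> y"
      by (simp add: fibre_product_simps motion_cover_def positive_space_group_def lifted_point_group_def)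
  qed
  moreover have "inj_on ?\<psi> (carrier ?P)"
  proof (rule inj_onI)
    fix x y assume xy: "x \<in> carrier ?P" "y \<in> carrier ?P" and eq: "?\<psi> x = ?\<psi> y"
    then have s: "snd x = snd y" "fst x 0 = fst y 0" by simp_all
    have "fst x = motion (\<pi> (snd x)) (fst x 0)" using P[OF xy(1)] by blast
    also have "\<dots> = motion (\<pi> (snd y)) (fst y 0)" by (simp only: s)
    also have "\<dots> = fst y" using P[OF xy(2)] by metis
    finally show "x = y" using s(1) by (simp add: prod_eq_iff)
  qed
  moreover have "?\<psi> ` carrier ?P = cover_stabiliser Spin \<pi> T"
  proof (intro equalityI subsetI)
    fix z assume "z \<in> ?\<psi> ` carrier ?P"
    then show "z \<in> cover_stabiliser Spin \<pi> T"
      using calculation(1) unfolding hom_def by auto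
  next
    fix z assume "z \<in> cover_stabiliser Spin \<pi> T"
    then have z: "fst z \<in> carrier Spin" "act (motion (\<pi> (fst z)) (snd z)) T = T"
      by (auto simp: cover_stabiliser_def motion_cover_def cover_act_def)
    have "(motion (\<pi> (fst z)) (snd z), fst z) \<in> carrier ?P"
      unfolding fibre_product_simps carrier_positive_space_group carrier_lifted_point_group
      using z pi_rotation[OF z(1)] by (auto simp: linear_part_motion)
    moreover have "?\<psi> (motion (\<pi> (fst z)) (snd z), fst z) = z"
      by (simp add: motion_def)
    ultimately show "z \<in> ?\<psi> ` carrier ?P" by (metis (no_types, lifting) image_eqI)
  qed
  ultimately show ?thesis by (simp add: iso_def bij_betw_def)
qed

lemma pullback_extension:
  "group_extension (translation_group T) (\<lambda>x. ((+) x, \<one>))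
     (fibre_product (positive_space_group T) linear_part (lifted_point_group Spin \<pi> T) \<pi>) snd
     (lifted_point_group Spin \<pi> T)"
proof -
  have "group (lifted_point_group Spin \<pi> T)"
    using subgroup.subgroup_is_group[OF subgroup_lifted_point_group Spin(1)]
    unfolding lifted_point_group_def by simp
  moreover have "\<pi> \<in> hom (lifted_point_group Spin \<pi> T) (point_group T)"
    using Spin(4) by (auto simp: hom_def lifted_point_group_def point_group_def)
  ultimately have "group_extension (translation_group T) (\<lambda>x. ((+) x, \<one>\<^bsub>lifted_point_group Spin \<pi> T\<^esub>))
     (fibre_product (positive_space_group T) linear_part (lifted_point_group Spin \<pi> T) \<pi>) snd
     (lifted_point_group Spin \<pi> T)"
    by (rule group_extension_pullback[OF positive_space_group_extension])
  then show ?thesis by (simp add: lifted_point_group_def)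
qed

text \<open>The middle map reads an element of the pullback as a stabilising pair and takes its
  class of lifts. Both squares are instances of naturality.\<close>

lemma hull_extension_iso:
  "extension_iso (translation_group T) (\<lambda>x. ((+) x, \<one>))
     (fibre_product (positive_space_group T) linear_part (lifted_point_group Spin \<pi> T) \<pi>) snd
     (lifted_point_group Spin \<pi> T)
     (fundamental_group (hull_topology (translational_hull T)) T)
     (induced_hom (hull_topology (rotational_hull T)) T id)
     (fundamental_group (hull_topology (rotational_hull T)) T)
     (induced_hom (coset_topology Spin (carrier (lifted_point_group Spin \<pi> T))) T (orientation_map Spin \<pi> T))
     (fundamental_group (coset_topology Spin (carrier (lifted_point_group Spin \<pi> T))) (orientation_map Spin \<pi> T T))
     (translation_loop_class T)
     (\<lambda>x. lift_class (motion_cover Spin \<pi>) (cover_act \<pi> T) (snd x, fst x 0))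
     (coset_loop_class Spin (carrier (lifted_point_group Spin \<pi> T)))"
  unfolding extension_iso_def
proof (intro conjI ballI)
  let ?H = "carrier (lifted_point_group Spin \<pi> T)"
  let ?P = "fibre_product (positive_space_group T) linear_part (lifted_point_group Spin \<pi> T) \<pi>"
  have L: "vector_group\<lparr>carrier := carrier (translation_group T)\<rparr> = translation_group T"
    by (simp add: vector_group_def translation_group_def)
  show "translation_loop_class T \<in> iso (translation_group T) (fundamental_group (hull_topology (translational_hull T)) T)"
    using group.iso_eq[OF group_translation_group Xt.lift_class_iso[unfolded L base_Xt]]
      translation_loop_class_eq by simp
  show "(\<lambda>x. lift_class (motion_cover Spin \<pi>) (cover_act \<pi> T) (snd x, fst x 0)) \<in>
      iso ?P (fundamental_group (hull_topology (rotational_hull T)) T)"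
    using iso_set_trans[OF fibre_product_iso_stabiliser Xr.lift_class_iso] unfolding base_Xr by (simp add: o_def)
  have Gt: "Spin\<lparr>carrier := ?H\<rparr> = lifted_point_group Spin \<pi> T" by (simp add: lifted_point_group_def)
  have "group (lifted_point_group Spin \<pi> T)"
    using subgroup.subgroup_is_group[OF subgroup_lifted_point_group Spin(1)] unfolding Gt .
  from group.iso_eq[OF this B.lift_class_iso[unfolded Gt]]
  show "coset_loop_class Spin ?H \<in> iso (lifted_point_group Spin \<pi> T)
      (fundamental_group (coset_topology Spin ?H) (orientation_map Spin \<pi> T T))"
    unfolding base_B using coset_loop_class_eq by simp
  fix x assume x: "x \<in> carrier (translation_group T)"
  \<comment> \<open>The inclusion of hulls is induced by the homomorphism sending \<open>v\<close>
    to \<open>(\<one>, v)\<close>.\<close>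
  have "induced_hom (hull_topology (rotational_hull T)) (act ((+) \<one>\<^bsub>vector_group\<^esub>) T) id
      (lift_class vector_group (\<lambda>x. act ((+) x) T) x) = lift_class (motion_cover Spin \<pi>) (cover_act \<pi> T) (\<one>, x)"
  proof (rule induced_hom_lift_class[where f = "\<lambda>v. (\<one>, v)",
        OF Xt.discrete_quotient_axioms Xr.discrete_quotient_axioms])
    show "continuous_on (carrier vector_group) (\<lambda>v. (\<one>, v))" by (intro continuous_intros)
    show "(\<lambda>v. (\<one>, v)) ` carrier vector_group \<subseteq> carrier (motion_cover Spin \<pi>)"
      by (auto simp: motion_cover_def)
    show "(\<one>, \<one>\<^bsub>vector_group\<^esub>) = \<one>\<^bsub>motion_cover Spin \<pi>\<^esub>"
      by (simp add: motion_cover_def vector_group_def)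
    show "(\<lambda>v. (\<one>, v)) ` carrier (translation_group T) \<subseteq> cover_stabiliser Spin \<pi> T"
    proof
      fix z assume "z \<in> (\<lambda>v. (\<one>, v)) ` carrier (translation_group T)"
      then obtain v where v: "z = (\<one>, v)" "v \<in> carrier (translation_group T)" by (rule imageE)
      have "act ((+) v) T = T" using v(2) by (simp add: translation_group_def)
      then show "z \<in> cover_stabiliser Spin \<pi> T"
        unfolding v(1) cover_stabiliser_def cover_act_def
        by (simp add: motion_cover_def pi_one motion_one)
    qed
    show "id (act ((+) v) T) = cover_act \<pi> T (\<one>, v)" for v
      by (simp add: cover_act_def pi_one motion_one)
  qed (rule x)
  then show "lift_class (motion_cover Spin \<pi>) (cover_act \<pi> T) (snd ((+) x, \<one>), fst ((+) x, \<one>) 0) =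
      induced_hom (hull_topology (rotational_hull T)) T id (translation_loop_class T x)"
    unfolding translation_loop_class_eq[OF x] base_Xt by simp
next
  let ?H = "carrier (lifted_point_group Spin \<pi> T)"
  fix e assume e: "e \<in> carrier (fibre_product (positive_space_group T) linear_part (lifted_point_group Spin \<pi> T) \<pi>)"
  have stab: "(snd e, fst e 0) \<in> cover_stabiliser Spin \<pi> T"
    using fibre_product_iso_stabiliser e unfolding iso_def hom_def by auto
  have snd_e: "snd e \<in> ?H" using e unfolding fibre_product_simps by blast
  \<comment> \<open>The orientation map is induced by the projection \<open>fst\<close> of the
    semidirect product.\<close>
  have "induced_hom (coset_topology Spin ?H) (cover_act \<pi> T \<one>\<^bsub>motion_cover Spin \<pi>\<^esub>) (orientation_map Spin \<pi> T)
      (lift_class (motion_cover Spin \<pi>) (cover_act \<pi> T) (snd e, fst e 0)) =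
    lift_class Spin (\<lambda>s. s <# ?H) (fst (snd e, fst e 0))"
  proof (rule induced_hom_lift_class[where f = fst,
        OF Xr.discrete_quotient_axioms B.discrete_quotient_axioms])
    show "continuous_on (carrier (motion_cover Spin \<pi>)) fst" by (intro continuous_intros)
    show "fst ` carrier (motion_cover Spin \<pi>) \<subseteq> carrier Spin" by (auto simp: motion_cover_def)
    show "fst \<one>\<^bsub>motion_cover Spin \<pi>\<^esub> = \<one>" by (simp add: motion_cover_def)
    show "fst ` cover_stabiliser Spin \<pi> T \<subseteq> ?H"
    proof
      fix s assume "s \<in> fst ` cover_stabiliser Spin \<pi> T"
      then obtain v where "s \<in> carrier Spin" "act (motion (\<pi> s) v) T = T"
        by (auto simp: cover_stabiliser_def motion_cover_def cover_act_def)
      then show "s \<in> ?H" unfolding carrier_lifted_point_group by blast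
    qed
  qed (rule orientation_map_cover_act, assumption, rule stab)
  then show "induced_hom (coset_topology Spin ?H) T (orientation_map Spin \<pi> T)
      (lift_class (motion_cover Spin \<pi>) (cover_act \<pi> T) (snd e, fst e 0)) = coset_loop_class Spin ?H (snd e)"
    unfolding base_Xr coset_loop_class_eq[OF snd_e] by simp
qed

lemma hull_extension:
  "group_extension (fundamental_group (hull_topology (translational_hull T)) T)
     (induced_hom (hull_topology (rotational_hull T)) T id)
     (fundamental_group (hull_topology (rotational_hull T)) T)
     (induced_hom (coset_topology Spin (carrier (lifted_point_group Spin \<pi> T))) T (orientation_map Spin \<pi> T))
     (fundamental_group (coset_topology Spin (carrier (lifted_point_group Spin \<pi> T))) (orientation_map Spin \<pi> T T))"
  by (rule group_extension_transfer[OF pullback_extension hull_extension_iso])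
    (use Xt.group_fundamental_group Xr.group_fundamental_group B.group_fundamental_group
      in \<open>simp_all only: base_Xt base_Xr base_B\<close>)

end

theorem corollary5p11:
  fixes T :: "('n::finite, 'l) tiling"
    and Spin :: "('s::topological_space) monoid"
    and \<pi> :: "'s \<Rightarrow> real ^ 'n ^ 'n"
  assumes "CARD('n) \<ge> 2"
    and "tiling T" and "periodic T"
    and "universal_covering_group Spin \<pi> special_orthogonal_group"
  shows
    "let L = translation_group T;
         \<Gamma> = positive_space_group T;
         G = point_group T;
         Gt = lifted_point_group Spin \<pi> T;
         P = fibre_product \<Gamma> linear_part Gt \<pi>;
         \<iota>P = (\<lambda>x. ((+) x, \<one>\<^bsub>Spin\<^esub>));
         Xt = hull_topology (translational_hull T);
         Xr = hull_topology (rotational_hull T);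
         B = coset_topology Spin (carrier Gt);
         \<theta> = orientation_map Spin \<pi> T;
         A = fundamental_group Xt T;
         E = fundamental_group Xr T;
         Q = fundamental_group B (\<theta> T)
     in group_extension L (+) \<Gamma> linear_part G \<and>
        group_extension L \<iota>P P snd Gt \<and>
        group_extension A (induced_hom Xr T id) E (induced_hom B T \<theta>) Q \<and>
        (\<exists>\<kappa>. extension_iso L \<iota>P P snd Gt A (induced_hom Xr T id) E (induced_hom B T \<theta>) Q
               (translation_loop_class T) \<kappa> (coset_loop_class Spin (carrier Gt)))"
  unfolding Let_def
\<comment> \<open>\<open>exI\<close> leaves \<open>\<kappa>\<close> open; unification with
  \<open>hull_extension_iso\<close> supplies the class of lifts of
  \<open>(snd x, fst x 0)\<close>.\<close>
proof (intro conjI exI)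
  show "group_extension (translation_group T) (+) (positive_space_group T) linear_part (point_group T)"
    by (rule positive_space_group_extension)
qed (rule pullback_extension[OF assms(2-4)] hull_extension[OF assms(2-4)]
    hull_extension_iso[OF assms(2-4)])+

end
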